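(* Let $\varphi\colon \mathbb{N}\to \mathbb{R}_{+}$ be a positive function, and let $$\mathcal{F}_2(\varphi)=\Big\{x\in[0,1)\colon \exists\, 1\le k\neq l \le n \text{ with } a_{k}(x)a_{k+1}(x)\ge \varphi(n) \text{ and } a_{l}(x)a_{l+1}(x)\ge \varphi(n), \text{ for infinitely many } n\in \mathbb{N}\Big\}.$$ Write $$\log B=\liminf_{n\to\infty}\frac{\log \varphi(n)}{n} \quad\text{and}\quad \log b=\liminf_{n\to\infty}\frac{\log\log \varphi(n)}{n}.$$ Then: (1) When $B=1$, $\dim_{H}\mathcal{F}_2(\varphi)=1$. (2) When $B=\infty$, $\dim_{H}\mathcal{F}_2(\varphi)=\frac{1}{1+b}$. (3) When $1<B<\infty$, $$\dim_{H}\mathcal{F}_2(\varphi)=s_B:=\inf\Big\{s\ge0\colon \mathsf{P}\big(T, -(3s-1-s^2)\log B-s\log |T'|\big)\le0\Big\}.$$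
   Context: For an irrational $x\in[0,1)$, $x=[a_1(x),a_2(x),\ldots]=\cfrac{1}{a_1(x)+\cfrac{1}{a_2(x)+\cdots}}$ denotes its simple infinite continued fraction expansion with partial quotients $a_n(x)\in\mathbb{N}=\{1,2,\ldots\}$; equivalently $a_n(x)=\lfloor 1/T^{n-1}(x)\rfloor$, where $T\colon[0,1)\to[0,1)$ is the Gauss map $T(0)=0$, $T(x)=1/x \pmod 1$ for $x\in(0,1)$. $T'$ is the derivative of $T$, so $|T'(x)|=x^{-2}$. (Rational numbers form a countable set and play no role.) The condition in $\mathcal{F}_2(\varphi)$ means: for infinitely many $n$ there exist distinct $k,l\in\{1,\ldots,n\}$ (depending on $n$) with both inequalities. $\dim_H$ is Hausdorff dimension. In the definitions of $B$ and $b$ the value $+\infty$ is allowed, and $1/(1+b)$ is read as $0$ when $b=\infty$; $b$ is only used when $B=\infty$, in which case $\varphi(n)>1$ for all large $n$. Pressure function: for a potential $\phi$, with ergodic sums $S_n\phi(x)=\phi(x)+\phi(Tx)+\cdots+\phi(T^{n-1}x)$, $$\mathsf{P}(T,\phi)=\lim_{n\to\infty}\frac1n\log\sum_{(a_1,\ldots,a_n)\in\mathbb{N}^n}\ \sup_{x}\ \exp S_n\phi([a_1,\ldots,a_n+x]),$$ where the supremum is over irrational $x\in[0,1)$ and $[a_1,\ldots,a_n+x]$ is the point whose continued fraction expansion is $a_1,\ldots,a_n$ followed by that of $x$. The value $+\infty$ is allowed. *)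

theory Defs
  imports "HOL-Analysis.Analysis"
begin

definition exp_ereal :: "ereal \<Rightarrow> ereal" where
  "exp_ereal x = (case x of ereal r \<Rightarrow> ereal (exp r) | PInfty \<Rightarrow> \<infinity> | MInfty \<Rightarrow> 0)"

definition ln_ennreal :: "ennreal \<Rightarrow> ereal" where
  "ln_ennreal x =
     (if x = 0 then -\<infinity> else if x = \<infinity> then \<infinity> else ereal (ln (enn2real x)))"

(* The exponent 0 is treated separately because 0 powr 0 = 0 in HOL, whereas a nonempty set
   of diameter 0 has to contribute 1 to a zero-dimensional Hausdorff sum. *)
definition diam_pow :: "real \<Rightarrow> 'a::metric_space set \<Rightarrow> ennreal" where
  "diam_pow s U =
     (if U = {} then 0 else if s = 0 then 1 else ennreal (diameter U powr s))"

(* Boundedness is required explicitly: diameter is unspecified on unbounded sets. *)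
definition hausdorff_premeasure :: "real \<Rightarrow> real \<Rightarrow> 'a::metric_space set \<Rightarrow> ennreal" where
  "hausdorff_premeasure \<delta> s A =
     Inf {(\<Sum>i. diam_pow s (U i)) | U :: nat \<Rightarrow> 'a set.
            A \<subseteq> (\<Union>i. U i) \<and> (\<forall>i. bounded (U i) \<and> diameter (U i) \<le> \<delta>)}"

definition hausdorff_measure :: "real \<Rightarrow> 'a::metric_space set \<Rightarrow> ennreal" where
  "hausdorff_measure s A = (SUP \<delta>\<in>{0<..}. hausdorff_premeasure \<delta> s A)"

definition hausdorff_dim :: "'a::metric_space set \<Rightarrow> ereal" where
  "hausdorff_dim A = Inf {ereal s | s. 0 \<le> s \<and> hausdorff_measure s A = 0}"

definition gauss_map :: "real \<Rightarrow> real" where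
  "gauss_map x = (if x = 0 then 0 else frac (1 / x))"

definition irrationals01 :: "real set" where
  "irrationals01 = {0..<1} - \<rat>"

(* Partial quotients are indexed from 1; the index 0 is never used. *)
definition partial_quotient :: "nat \<Rightarrow> real \<Rightarrow> nat" where
  "partial_quotient n x = nat \<lfloor>1 / (gauss_map ^^ (n - 1)) x\<rfloor>"

(* cf_branch [a1, ..., an] x is the point [a1, ..., an + x]. *)
fun cf_branch :: "nat list \<Rightarrow> real \<Rightarrow> real" where
  "cf_branch [] x = x"
| "cf_branch (a # as) x = 1 / (real a + cf_branch as x)"

definition birkhoff_sum :: "('a \<Rightarrow> 'a) \<Rightarrow> ('a \<Rightarrow> real) \<Rightarrow> nat \<Rightarrow> 'a \<Rightarrow> real" where
  "birkhoff_sum T \<psi> n x = (\<Sum>i<n. \<psi> ((T ^^ i) x))"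

definition gauss_pressure :: "(real \<Rightarrow> real) \<Rightarrow> ereal" where
  "gauss_pressure \<psi> =
     lim (\<lambda>n. ln_ennreal
       (\<Sum>\<^sub>\<infinity>as\<in>{as :: nat list. length as = n \<and> (\<forall>a\<in>set as. 1 \<le> a)}.
          SUP x\<in>irrationals01.
            ennreal (exp (birkhoff_sum gauss_map \<psi> n (cf_branch as x)))) / ereal (real n))"

(* The continued fraction expansion is infinite only at irrational points, so the set is
   taken inside the irrationals; this removes at most countably many points. *)
definition F2_set :: "(nat \<Rightarrow> real) \<Rightarrow> real set" where
  "F2_set \<phi> = {x \<in> irrationals01.
     \<exists>\<^sub>\<infinity>n. \<exists>k\<in>{1..n}. \<exists>l\<in>{1..n}. k \<noteq> l \<and>
       real (partial_quotient k x * partial_quotient (k + 1) x) \<ge> \<phi> n \<and>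
       real (partial_quotient l x * partial_quotient (l + 1) x) \<ge> \<phi> n}"

definition growth_B :: "(nat \<Rightarrow> real) \<Rightarrow> ereal" where
  "growth_B \<phi> = exp_ereal (liminf (\<lambda>n. ereal (ln (\<phi> n) / real n)))"

(* Meaningful only if \<phi> n > 1 for all large n, as is the case when growth_B \<phi> = \<infinity>. *)
definition growth_b :: "(nat \<Rightarrow> real) \<Rightarrow> ereal" where
  "growth_b \<phi> = exp_ereal (liminf (\<lambda>n. ereal (ln (ln (\<phi> n)) / real n)))"

definition s_B :: "real \<Rightarrow> ereal" where
  "s_B B = Inf {ereal s | s. 0 \<le> s \<and>
     gauss_pressure
       (\<lambda>x. - (3 * s - 1 - s\<^sup>2) * ln B - s * ln \<bar>deriv gauss_map x\<bar>) \<le> 0}"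

end

theory Submission
  imports Defs "HOL-Probability.Probability"
begin

text \<open>Write \<open>q\<close> for the denominator of a word, so that its cylinder has length about
  \<open>q powr -2\<close>, and \<open>\<Phi>\<close> for \<open>\<phi> n\<close>. Two adjacent products \<open>a c\<close> and \<open>c d\<close> exceed \<open>\<Phi>\<close> most cheaply when
  \<open>a\<close>, \<open>c\<close>, \<open>d\<close> have sizes \<open>\<Phi> powr (1 - s)\<close>, \<open>\<Phi> powr s\<close>, \<open>\<Phi> powr (1 - s)\<close>: covering the triples
  accordingly multiplies the \<open>s\<close>-dimensional sum by \<open>\<Phi> powr -(3 s - 1 - s\<^sup>2)\<close>, up to \<open>\<Phi> powr \<epsilon>\<close>, while
  products at distant positions cost \<open>\<Phi> powr -(2 s - 1 + s\<^sup>2)\<close>, which is less for \<open>s > 1/2\<close>. Summed over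
  all prefixes this gives the upper bound \<open>s_B\<close>. Conversely, a random point whose digits are
  independent blocks from a finite set of words, weighted by \<open>q powr (-2 s)\<close>, interrupted at
  sparse times by such triples with uniformly chosen digits, satisfies a mass distribution bound
  with exponent \<open>s\<close> as soon as the pressure at \<open>s\<close> is positive.

  If \<open>\<phi>\<close> grows doubly exponentially with base \<open>b > c\<close>, a point of the set has infinitely many \<open>n\<close>
  with \<open>a\<^sub>n\<^sub>+\<^sub>1 \<ge> G ^ n * (a\<^sub>1 \<cdots> a\<^sub>n) powr (c - 1)\<close> for every \<open>G\<close>, since otherwise the products
  \<open>a\<^sub>1 \<cdots> a\<^sub>n\<close> would grow too slowly; the resulting cover has a finite sum when \<open>s (1 + c) > 1\<close>. Choosing \<open>a\<^sub>n\<close> uniformly of size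
  \<open>exp (b ^ n)\<close> gives the matching lower bound.\<close>

section \<open>Continued fraction branches\<close>

text \<open>The values \<Phi>^s and \<Phi>^(1-s) are those at which three competing covers of a
  triple cost the same. In the random construction they are critical again: the mass estimate then
  holds with exponent exactly 0 of \<Phi> at the second and at the third special digit. The obstacle
  in the lower bound is that a huge digit squeezes the chosen points into a tiny part of their
  cylinder, so that mass has to be compared with length at all scales in between. A digit uniform in
  \<open>{T..<2 * T}\<close> makes the mass of a ball grow linearly in its radius there, which is
  harmless as s \<le> 1. The factor \<Phi>^(-c), with c = 3 s - 1 - s^2, that pays for a triple is
  earned by ordinary words: positive pressure yields a finite set of words of length m with weight
  sum above 2 * 4^s * B^(c m). The spare 1/2 per word, collected over long runs, repays every
  constant and the digits placed earlier, so only the length of the runs has to be arranged. A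
  finite set also avoids the infinite pressure at s \<le> 1/2; dimension 1/2 comes from the doubly
  exponential construction.\<close>

definition pos_word :: "nat list \<Rightarrow> bool" where
  "pos_word w \<longleftrightarrow> (\<forall>a\<in>set w. 1 \<le> a)"

text \<open>The derivative of \<open>cf_branch w\<close> at x has modulus
  \<open>1 / (cf_den w x)\<^sup>2\<close>. In classical notation the value is q_n + x q_(n-1), and
  at 0 it is the continuant q_n; the recursion writes it as the product of the inverses of the
  points visited by the orbit.\<close>

fun cf_den :: "nat list \<Rightarrow> real \<Rightarrow> real" where
  "cf_den [] x = 1"
| "cf_den (a # as) x = (real a + cf_branch as x) * cf_den as x"

lemma pos_word_simps [simp]:
  "pos_word []" "pos_word (a # w) \<longleftrightarrow> 1 \<le> a \<and> pos_word w"
  "pos_word (v @ w) \<longleftrightarrow> pos_word v \<and> pos_word w"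
  by (auto simp: pos_word_def)

lemma cf_branch_append: "cf_branch (v @ w) x = cf_branch v (cf_branch w x)"
  by (induction v) auto

lemma cf_den_append: "cf_den (v @ w) x = cf_den v (cf_branch w x) * cf_den w x"
  by (induction v) (auto simp: cf_branch_append)

lemma cf_branch_range:
  assumes "pos_word w" "0 \<le> x" "x \<le> 1"
  shows "0 \<le> cf_branch w x" "cf_branch w x \<le> 1"
  using assms by (induction w) auto

lemma cf_branch_pos:
  assumes "pos_word w" "0 < x"
  shows "0 < cf_branch w x"
  using assms by (induction w) (auto intro!: divide_pos_pos add_nonneg_pos)

lemma cf_branch_less_1:
  assumes "pos_word w" "0 < x" "x < 1"
  shows "cf_branch w x < 1"
  using assms
proof (cases w)
  case (Cons a v)
  then have "0 < cf_branch v x" using cf_branch_pos assms by auto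
  then show ?thesis using Cons assms by (auto simp: divide_simps)
qed auto

lemma cf_den_ge_1:
  assumes "pos_word w" "0 \<le> x" "x \<le> 1"
  shows "1 \<le> cf_den w x"
  using assms
proof (induction w)
  case (Cons a w)
  then have "1 \<le> real a + cf_branch w x" "1 \<le> cf_den w x"
    using cf_branch_range[of w x] by auto
  then show ?case using mult_mono[of 1 "real a + cf_branch w x" 1 "cf_den w x"] by simp
qed auto

text \<open>The slope e is the continuant of the word without its last digit: appending a digit a
  turns the pair (q, e) into (a q + e, q). This is why the induction runs from the right.\<close>

lemma cf_den_affine:
  assumes "pos_word w"
  shows "\<exists>e. 0 \<le> e \<and> e \<le> cf_den w 0 \<and> (\<forall>x\<ge>0. cf_den w x = cf_den w 0 + e * x)"
  using assms
proof (induction w rule: rev_induct)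
  case Nil
  show ?case by (intro exI[of _ 0]) auto
next
  case (snoc a w)
  from snoc.prems have "pos_word w" by simp
  from snoc.IH[OF this] obtain e where e: "0 \<le> e" "e \<le> cf_den w 0"
      "\<And>x. x \<ge> 0 \<Longrightarrow> cf_den w x = cf_den w 0 + e * x"
    by blast
  have a: "1 \<le> a" using snoc by simp
  have *: "cf_den (w @ [a]) x = real a * cf_den w 0 + e + cf_den w 0 * x" if "x \<ge> 0" for x
  proof -
    have "real a + x > 0" using a that by linarith
    then show ?thesis
      using that e(3)[of "1 / (real a + x)"] by (simp add: cf_den_append field_simps)
  qed
  have "cf_den w 0 \<ge> 1" using cf_den_ge_1[of w 0] snoc by auto
  moreover have "cf_den w 0 \<le> real a * cf_den w 0"
    using a calculation by (simp add: mult_le_cancel_right1)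
  ultimately have "0 \<le> cf_den w 0" "cf_den w 0 \<le> cf_den (w @ [a]) 0"
    using *[of 0] e(1) by linarith+
  moreover have "\<forall>x\<ge>0. cf_den (w @ [a]) x = cf_den (w @ [a]) 0 + cf_den w 0 * x"
    using *[of 0] * by simp
  ultimately show ?case by blast
qed

lemma cf_den_bounds:
  assumes "pos_word w" "0 \<le> x" "x \<le> 1"
  shows "cf_den w 0 \<le> cf_den w x" "cf_den w x \<le> 2 * cf_den w 0"
proof -
  obtain e where e: "0 \<le> e" "e \<le> cf_den w 0" "cf_den w x = cf_den w 0 + e * x"
    using cf_den_affine[OF assms(1)] assms(2) by blast
  have "0 \<le> e * x" "e * x \<le> cf_den w 0"
    using e assms mult_left_le[of x e] by (auto intro: order_trans)
  then show "cf_den w 0 \<le> cf_den w x" "cf_den w x \<le> 2 * cf_den w 0"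
    using e by auto
qed

text \<open>\<open>cf_branch w\<close> is a Moebius map of determinant 1 or -1, so the identity is
  exact; together with \<open>cf_den_bounds\<close> it gives distortion at most 4.\<close>

lemma cf_branch_diff:
  assumes "pos_word w" "0 \<le> x" "x \<le> 1" "0 \<le> y" "y \<le> 1"
  shows "\<bar>cf_branch w x - cf_branch w y\<bar> = \<bar>x - y\<bar> / (cf_den w x * cf_den w y)"
  using assms
proof (induction w)
  case (Cons a w)
  define u v where "u = cf_branch w x" and "v = cf_branch w y"
  have uv: "real a + u > 0" "real a + v > 0"
    using Cons cf_branch_range[of w x] cf_branch_range[of w y] by (auto simp: u_def v_def)
  have "1 / (real a + u) - 1 / (real a + v) = (v - u) / ((real a + u) * (real a + v))"
    using uv by (simp add: field_simps)
  then have "\<bar>1 / (real a + u) - 1 / (real a + v)\<bar> = \<bar>u - v\<bar> / ((real a + u) * (real a + v))"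
    using uv by (simp add: abs_mult abs_minus_commute)
  also have "\<bar>u - v\<bar> = \<bar>x - y\<bar> / (cf_den w x * cf_den w y)"
    using Cons by (simp add: u_def v_def)
  finally show ?case by (simp add: u_def v_def mult_ac)
qed auto

lemma cf_branch_diff_le:
  assumes "pos_word w" "0 \<le> x" "x \<le> 1" "0 \<le> y" "y \<le> 1"
  shows "\<bar>cf_branch w x - cf_branch w y\<bar> \<le> \<bar>x - y\<bar> / (cf_den w 0)\<^sup>2"
proof -
  have q: "1 \<le> cf_den w 0" "1 \<le> cf_den w x" "1 \<le> cf_den w y"
    using cf_den_ge_1 assms by auto
  have "(cf_den w 0)\<^sup>2 \<le> cf_den w x * cf_den w y"
    unfolding power2_eq_square
    using cf_den_bounds(1)[of w x] cf_den_bounds(1)[of w y] assms q by (intro mult_mono) auto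
  then show ?thesis
    unfolding cf_branch_diff[OF assms] using q
    by (intro divide_left_mono) auto
qed

lemma cf_branch_diff_ge:
  assumes "pos_word w" "0 \<le> x" "x \<le> 1" "0 \<le> y" "y \<le> 1"
  shows "\<bar>x - y\<bar> / (4 * (cf_den w 0)\<^sup>2) \<le> \<bar>cf_branch w x - cf_branch w y\<bar>"
proof -
  have q: "1 \<le> cf_den w 0" "1 \<le> cf_den w x" "1 \<le> cf_den w y"
    using cf_den_ge_1 assms by auto
  have "cf_den w x * cf_den w y \<le> (2 * cf_den w 0) * (2 * cf_den w 0)"
    using cf_den_bounds assms q by (intro mult_mono) auto
  also have "\<dots> = 4 * (cf_den w 0)\<^sup>2" by (simp add: power2_eq_square)
  finally show ?thesis
    unfolding cf_branch_diff[OF assms] using q by (intro divide_left_mono) auto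
qed

text \<open>Chain rule and bounded distortion. The 2, raised to the power 2 s, reappears below as
  \<open>4 powr s\<close>.\<close>

lemma cf_den_append_bounds:
  assumes "pos_word v" "pos_word w"
  shows "cf_den v 0 * cf_den w 0 \<le> cf_den (v @ w) 0"
    and "cf_den (v @ w) 0 \<le> 2 * (cf_den v 0 * cf_den w 0)"
proof -
  have q: "1 \<le> cf_den w 0" using cf_den_ge_1[of w 0] assms by auto
  note r = cf_branch_range[OF assms(2), of 0]
  show "cf_den v 0 * cf_den w 0 \<le> cf_den (v @ w) 0"
    unfolding cf_den_append using cf_den_bounds(1)[OF assms(1)] r q by (intro mult_right_mono) auto
  show "cf_den (v @ w) 0 \<le> 2 * (cf_den v 0 * cf_den w 0)"
    unfolding cf_den_append mult.assoc[symmetric]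
    using cf_den_bounds(2)[OF assms(1)] r q by (intro mult_right_mono) auto
qed

lemma prod_list_le_cf_den:
  assumes "pos_word w"
  shows "real (prod_list w) \<le> cf_den w 0"
  using assms
proof (induction w)
  case (Cons a w)
  then show ?case
    using cf_branch_range[of w 0] cf_den_ge_1[of w 0] by (auto intro!: mult_mono)
qed auto

text \<open>Two digits a, b contribute at least their continuant a b + 1 \<ge> 2, hence a doubling
  with every second digit.\<close>

lemma cf_den_exp_growth:
  assumes "pos_word w"
  shows "2 ^ (length w div 2) \<le> cf_den w 0"
  using assms
proof (induction w rule: induct_list012)
  case (3 a b w)
  have "cf_den [a,b] 0 \<ge> 2"
  proof -
    have "1 \<le> a * b" using 3 by simp
    then have "1 \<le> real a * real b" by (metis of_nat_1 of_nat_le_iff of_nat_mult)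
    then show ?thesis using 3 by (simp add: field_simps)
  qed
  then have "2 * 2 ^ (length w div 2) \<le> cf_den [a,b] 0 * cf_den w 0"
    using 3 by (intro mult_mono) auto
  also have "\<dots> \<le> cf_den ([a,b] @ w) 0"
    using 3 by (intro cf_den_append_bounds) auto
  finally show ?case by simp
qed auto

section \<open>The Gauss map on irrationals: digits and inverse branches\<close>

lemma irrationals01_iff: "x \<in> irrationals01 \<longleftrightarrow> 0 < x \<and> x < 1 \<and> x \<notin> \<rat>"
  by (auto simp: irrationals01_def less_le)

lemma gauss_map_irrational:
  assumes "x \<in> irrationals01"
  shows "gauss_map x \<in> irrationals01"
proof -
  have x: "0 < x" "x < 1" "x \<notin> \<rat>" using assms by (auto simp: irrationals01_iff)
  have "frac (1 / x) \<notin> \<rat>"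
  proof
    assume "frac (1 / x) \<in> \<rat>"
    then have "frac (1 / x) + of_int \<lfloor>1 / x\<rfloor> \<in> \<rat>" by (intro Rats_add) auto
    then have "1 / x \<in> \<rat>" by (simp add: frac_def)
    then have "inverse (1 / x) \<in> \<rat>" by (rule Rats_inverse)
    then show False using x by simp
  qed
  then show ?thesis
    using x frac_lt_1[of "1/x"] by (auto simp: gauss_map_def irrationals01_def)
qed

lemma gauss_iterate_irrational:
  "x \<in> irrationals01 \<Longrightarrow> (gauss_map ^^ n) x \<in> irrationals01"
  by (induction n) (auto intro: gauss_map_irrational)

lemma cf_branch_irrational:
  assumes "pos_word w" "x \<in> irrationals01"
  shows "cf_branch w x \<in> irrationals01"
  using assms
proof (induction w)
  case (Cons a w)
  define u where "u = cf_branch w x"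
  have u: "0 < u" "u < 1" "u \<notin> \<rat>" using Cons by (auto simp: u_def irrationals01_iff)
  have a: "1 \<le> real a" using Cons by simp
  have "1 / (real a + u) \<notin> \<rat>"
  proof
    assume "1 / (real a + u) \<in> \<rat>"
    then have "inverse (1 / (real a + u)) - real a \<in> \<rat>" by (intro Rats_diff Rats_inverse) auto
    then show False using u a by simp
  qed
  then show ?case using u a unfolding irrationals01_iff by (auto simp: u_def[symmetric] divide_simps)
qed auto

lemma floor_frac_inverse:
  assumes "1 \<le> a" "0 < u" "u < 1"
  shows "nat \<lfloor>1 / (1 / (real a + u))\<rfloor> = a" "gauss_map (1 / (real a + u)) = u"
proof -
  have "\<lfloor>real a + u\<rfloor> = int a" using assms by linarith
  then show "nat \<lfloor>1 / (1 / (real a + u))\<rfloor> = a" "gauss_map (1 / (real a + u)) = u"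
    using assms by (auto simp: gauss_map_def frac_def)
qed

lemma gauss_map_cf_branch_Cons:
  assumes "pos_word (a # w)" "0 < x" "x < 1"
  shows "gauss_map (cf_branch (a # w) x) = cf_branch w x"
  using floor_frac_inverse(2)[of a "cf_branch w x"] assms cf_branch_pos cf_branch_less_1 by auto

lemma gauss_iterate_cf_branch:
  assumes "pos_word w" "0 < x" "x < 1" "i \<le> length w"
  shows "(gauss_map ^^ i) (cf_branch w x) = cf_branch (drop i w) x"
  using assms(4)
proof (induction i)
  case (Suc i)
  then obtain a v where *: "drop i w = a # v" "drop (Suc i) w = v"
    by (metis Suc_le_lessD Cons_nth_drop_Suc)
  have "pos_word (a # v)"
    using assms(1) append_take_drop_id[of i w] unfolding *(1) pos_word_def by (metis in_set_dropD *(1))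
  then show ?case using Suc * gauss_map_cf_branch_Cons[of a v x] assms by auto
qed auto

lemma partial_quotient_cf_branch:
  assumes "pos_word w" "0 < x" "x < 1" "i < length w"
  shows "partial_quotient (Suc i) (cf_branch w x) = w ! i"
proof -
  have *: "drop i w = (w ! i) # drop (Suc i) w" using assms by (simp add: Cons_nth_drop_Suc)
  have p: "pos_word (w ! i # drop (Suc i) w)"
    using assms(1) unfolding *[symmetric] pos_word_def by (meson in_set_dropD)
  have "0 < cf_branch (drop (Suc i) w) x" "cf_branch (drop (Suc i) w) x < 1"
    using cf_branch_pos cf_branch_less_1 p assms by auto
  then show ?thesis
    using gauss_iterate_cf_branch[of w x i] assms p floor_frac_inverse(1)
    by (simp add: partial_quotient_def *)
qed

definition cf_digits :: "nat \<Rightarrow> real \<Rightarrow> nat list" where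
  "cf_digits n x = map (\<lambda>i. partial_quotient (Suc i) x) [0..<n]"

lemma length_cf_digits [simp]: "length (cf_digits n x) = n"
  by (simp add: cf_digits_def)

lemma cf_digits_Suc: "cf_digits (Suc n) x = cf_digits n x @ [partial_quotient (Suc n) x]"
  by (simp add: cf_digits_def)

lemma partial_quotient_pos:
  assumes "x \<in> irrationals01"
  shows "1 \<le> partial_quotient n x"
proof -
  define y where "y = (gauss_map ^^ (n - 1)) x"
  have "0 < y" "y < 1" using gauss_iterate_irrational[OF assms] by (auto simp: irrationals01_iff y_def)
  then have "1 \<le> 1 / y" by simp
  then show ?thesis unfolding partial_quotient_def y_def[symmetric] by linarith
qed

lemma pos_word_cf_digits: "x \<in> irrationals01 \<Longrightarrow> pos_word (cf_digits n x)"
  using partial_quotient_pos by (auto simp: pos_word_def cf_digits_def)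

lemma gauss_map_inverse:
  assumes "x \<in> irrationals01"
  shows "x = 1 / (real (nat \<lfloor>1 / x\<rfloor>) + gauss_map x)"
proof -
  have x: "0 < x" "x < 1" using assms by (auto simp: irrationals01_iff)
  then have "1 \<le> 1 / x" by simp
  then have "real (nat \<lfloor>1 / x\<rfloor>) = of_int \<lfloor>1 / x\<rfloor>" by linarith
  then show ?thesis using x by (simp add: gauss_map_def frac_def)
qed

lemma cf_branch_cf_digits:
  assumes "x \<in> irrationals01"
  shows "cf_branch (cf_digits n x) ((gauss_map ^^ n) x) = x"
proof (induction n)
  case (Suc n)
  have "cf_branch [partial_quotient (Suc n) x] ((gauss_map ^^ Suc n) x) = (gauss_map ^^ n) x"
    using gauss_map_inverse[OF gauss_iterate_irrational[OF assms], of n]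
    by (simp add: partial_quotient_def)
  then show ?case using Suc by (simp add: cf_digits_Suc cf_branch_append)
qed (simp add: cf_digits_def)

lemma gauss_iterate_le:
  assumes "x \<in> irrationals01"
  shows "(gauss_map ^^ n) x \<le> 1 / real (partial_quotient (Suc n) x)"
proof -
  define y where "y = (gauss_map ^^ n) x"
  have y: "0 < y" "y < 1" using gauss_iterate_irrational[OF assms] by (auto simp: irrationals01_iff y_def)
  have "1 \<le> partial_quotient (Suc n) x" using assms by (rule partial_quotient_pos)
  moreover have "real (partial_quotient (Suc n) x) \<le> 1 / y"
    using y by (simp add: partial_quotient_def y_def[symmetric])
  ultimately show ?thesis using y unfolding y_def[symmetric] by (simp add: field_simps)
qed

section \<open>Hausdorff content\<close>

text \<open>Diameters are not restricted, so cylinders may serve as covers without checking their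
  size. For s > 0 vanishing content already forces vanishing Hausdorff measure, and upper bounds for
  the dimension need only null sets.\<close>

definition hausdorff_content :: "real \<Rightarrow> 'a::metric_space set \<Rightarrow> ennreal" where
  "hausdorff_content s A =
     Inf {(\<Sum>i. diam_pow s (U i)) | U :: nat \<Rightarrow> 'a set.
            A \<subseteq> (\<Union>i. U i) \<and> (\<forall>i. bounded (U i))}"

lemma hausdorff_content_le:
  assumes "A \<subseteq> (\<Union>i. U i)" "\<And>i::nat. bounded (U i)"
  shows "hausdorff_content s A \<le> (\<Sum>i. diam_pow s (U i))"
  unfolding hausdorff_content_def using assms by (intro Inf_lower) blast

lemma hausdorff_content_mono: "A \<subseteq> B \<Longrightarrow> hausdorff_content s A \<le> hausdorff_content s B"
  unfolding hausdorff_content_def by (intro Inf_superset_mono) blast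

lemma diam_pow_empty [simp]: "diam_pow s {} = 0"
  by (simp add: diam_pow_def)

lemma hausdorff_content_diam:
  assumes "0 < s" "\<And>x y. x \<in> A \<Longrightarrow> y \<in> A \<Longrightarrow> dist x y \<le> d" "0 \<le> d"
  shows "hausdorff_content s A \<le> ennreal (d powr s)"
proof -
  have "bounded A"
  proof (cases "A = {}")
    case False
    then obtain a where "a \<in> A" by auto
    then show ?thesis using assms(2) unfolding bounded_def by blast
  qed auto
  moreover have "diameter A \<le> d"
    unfolding diameter_def using assms by (auto intro!: cSUP_least)
  moreover have "0 \<le> diameter A" using \<open>bounded A\<close> by (rule diameter_ge_0)
  ultimately have "diam_pow s A \<le> ennreal (d powr s)"
    using assms by (auto simp: diam_pow_def intro!: ennreal_leI powr_mono2)
  moreover have "hausdorff_content s A \<le> (\<Sum>i. diam_pow s (if i = (0::nat) then A else {}))"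
    using \<open>bounded A\<close> by (intro hausdorff_content_le) auto
  moreover have "(\<Sum>i. diam_pow s (if i = (0::nat) then A else {})) = diam_pow s A"
    by (subst suminf_finite[of "{0}"]) auto
  ultimately show ?thesis by simp
qed

lemma hausdorff_content_UN_le:
  "hausdorff_content s (\<Union>i::nat. A i) \<le> (\<Sum>i. hausdorff_content s (A i))"
proof (rule ennreal_le_epsilon)
  fix e :: real
  assume e: "0 < e" and fin: "(\<Sum>i. hausdorff_content s (A i)) < \<top>"
  have "\<exists>U. A i \<subseteq> (\<Union>j. U j) \<and> (\<forall>j::nat. bounded (U j)) \<and>
      (\<Sum>j. diam_pow s (U j)) \<le> hausdorff_content s (A i) + ennreal (e * (1/2) ^ Suc i)" for i
  proof -
    have "hausdorff_content s (A i) < \<top>"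
    proof (rule ccontr)
      assume "\<not> hausdorff_content s (A i) < \<top>"
      then have "hausdorff_content s (A i) = \<top>" using less_top by blast
      moreover have "hausdorff_content s (A i) \<le> (\<Sum>i. hausdorff_content s (A i))"
        using sum_le_suminf[of "\<lambda>i. hausdorff_content s (A i)" "{i}"] by simp
      ultimately show False using fin by simp
    qed
    then have "hausdorff_content s (A i) < hausdorff_content s (A i) + ennreal (e * (1/2) ^ Suc i)"
      using e by (cases "hausdorff_content s (A i)")
        (auto simp: ennreal_plus[symmetric] ennreal_less_iff simp del: ennreal_plus)
    then obtain y where "y \<in> {(\<Sum>j. diam_pow s (U j)) | U. A i \<subseteq> (\<Union>j. U j) \<and> (\<forall>j::nat. bounded (U j))}"
       "y < hausdorff_content s (A i) + ennreal (e * (1/2) ^ Suc i)"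
      unfolding hausdorff_content_def[of s "A i"] Inf_less_iff by blast
    then show ?thesis by (auto intro: less_imp_le)
  qed
  then obtain U where U: "\<And>i. A i \<subseteq> (\<Union>j. U i j)" "\<And>i j. bounded (U i (j::nat))"
     "\<And>i. (\<Sum>j. diam_pow s (U i j)) \<le> hausdorff_content s (A i) + ennreal (e * (1/2) ^ Suc i)"
    by metis
  define V where "V = (\<lambda>n. case prod_decode n of (i, j) \<Rightarrow> U i j)"
  have "hausdorff_content s (\<Union>i. A i) \<le> (\<Sum>n. diam_pow s (V n))"
  proof (rule hausdorff_content_le)
    show "(\<Union>i. A i) \<subseteq> (\<Union>n. V n)"
    proof
      fix x assume "x \<in> (\<Union>i. A i)"
      then obtain i j where "x \<in> U i j" using U(1) by blast
      then have "x \<in> V (prod_encode (i, j))" by (simp add: V_def)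
      then show "x \<in> (\<Union>n. V n)" by blast
    qed
    show "bounded (V n)" for n using U(2) by (auto simp: V_def split: prod.splits)
  qed
  also have "(\<Sum>n. diam_pow s (V n)) = (\<Sum>i. \<Sum>j. diam_pow s (U i j))"
    using suminf_ennreal_2dimen[of "\<lambda>i. \<Sum>j. diam_pow s (U i j)" "\<lambda>(i, j). diam_pow s (U i j)"]
    by (simp add: V_def o_def case_prod_unfold)
  also have "\<dots> \<le> (\<Sum>i. hausdorff_content s (A i) + ennreal (e * (1/2) ^ Suc i))"
    using U(3) by (intro suminf_le) auto
  also have "\<dots> = (\<Sum>i. hausdorff_content s (A i)) + (\<Sum>i. ennreal (e * (1/2) ^ Suc i))"
    by (rule suminf_add[symmetric]) auto
  also have "(\<Sum>i. ennreal (e * (1/2) ^ Suc i)) = ennreal e"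
    using e sums_mult[OF power_half_series, of e] by (intro suminf_ennreal_eq) auto
  finally show "hausdorff_content s (\<Union>i. A i) \<le> (\<Sum>i. hausdorff_content s (A i)) + ennreal e" .
qed

lemma hausdorff_content_empty [simp]: "hausdorff_content s {} = 0"
  using hausdorff_content_le[of "{}" "\<lambda>_. {}" s] by simp

lemma hausdorff_content_Un_le:
  "hausdorff_content s (A \<union> B) \<le> hausdorff_content s A + hausdorff_content s B"
proof -
  define C where "C i = (if i = 0 then A else if i = 1 then B else {})" for i :: nat
  have "A \<union> B = (\<Union>i. C i)" by (auto simp: C_def split: if_splits)
  moreover have "(\<Sum>i. hausdorff_content s (C i)) = hausdorff_content s A + hausdorff_content s B"
    by (subst suminf_finite[of "{0,1}"]) (auto simp: C_def)
  ultimately show ?thesis using hausdorff_content_UN_le[of s C] by simp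
qed

lemma hausdorff_content_UN_finite_le:
  assumes "finite I"
  shows "hausdorff_content s (\<Union>i\<in>I. A i) \<le> (\<Sum>i\<in>I. hausdorff_content s (A i))"
  using assms
proof (induction I)
  case (insert i I)
  then show ?case
    using order_trans[OF hausdorff_content_Un_le add_left_mono] by fastforce
qed auto

lemma hausdorff_content_UN_count_space_le:
  assumes "countable I"
  shows "hausdorff_content s (\<Union>i\<in>I. A i) \<le> (\<integral>\<^sup>+ i. hausdorff_content s (A i) \<partial>count_space I)"
proof (cases "finite I")
  case True
  then show ?thesis
    using hausdorff_content_UN_finite_le by (simp add: nn_integral_count_space_finite)
next
  case False
  define f where "f = from_nat_into I"
  have f: "bij_betw f UNIV I" using assms False unfolding f_def by (rule bij_betw_from_nat_into)
  then have "(\<Union>i\<in>I. A i) = (\<Union>n. A (f n))" by (auto simp: bij_betw_def)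
  moreover have "(\<integral>\<^sup>+ i. hausdorff_content s (A i) \<partial>count_space I) = (\<Sum>n. hausdorff_content s (A (f n)))"
    by (simp add: nn_integral_bij_count_space[OF f, symmetric] nn_integral_count_space_nat)
  ultimately show ?thesis using hausdorff_content_UN_le[of s "\<lambda>n. A (f n)"] by simp
qed

text \<open>Borel-Cantelli for the content: every tail union of the \<open>A n\<close> covers E, and
  its content is at most a tail of a convergent series.\<close>

lemma hausdorff_content_limsup:
  assumes "E \<subseteq> {x. \<exists>\<^sub>\<infinity>n. x \<in> A n}" "(\<Sum>n. hausdorff_content s (A n)) < \<top>"
  shows "hausdorff_content s E = 0"
proof -
  define f where "f n = hausdorff_content s (A n)" for n
  have fin: "f n \<noteq> \<top>" for n
    using sum_le_suminf[of f "{n}"] assms(2) by (auto simp: f_def[symmetric] top_unique)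
  have *: "hausdorff_content s E \<le> (\<Sum>i. f (i + n))" for n
  proof -
    have "E \<subseteq> (\<Union>i. A (i + n))"
    proof
      fix x assume "x \<in> E"
      then obtain m where "m \<ge> n" "x \<in> A m" using assms(1) by (auto simp: INFM_nat_le)
      then show "x \<in> (\<Union>i. A (i + n))" by (intro UN_I[of "m - n"]) auto
    qed
    then have "hausdorff_content s E \<le> hausdorff_content s (\<Union>i. A (i + n))"
      by (rule hausdorff_content_mono)
    also have "\<dots> \<le> (\<Sum>i. f (i + n))" unfolding f_def by (rule hausdorff_content_UN_le)
    finally show ?thesis .
  qed
  have sm: "summable (\<lambda>n. enn2real (f n))"
    using assms(2) fin by (intro summable_suminf_not_top) (auto simp: f_def[symmetric] less_top)
  have "(\<lambda>n. \<Sum>i. enn2real (f (i + n))) \<longlonglongrightarrow> 0"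
    using suminf_exist_split2[OF sm] by simp
  then have "(\<lambda>n. ennreal (\<Sum>i. enn2real (f (i + n)))) \<longlonglongrightarrow> 0"
    using tendsto_ennrealI by fastforce
  moreover have "ennreal (\<Sum>i. enn2real (f (i + n))) = (\<Sum>i. f (i + n))" for n
  proof -
    have "(\<Sum>i. ennreal (enn2real (f (i + n)))) = ennreal (\<Sum>i. enn2real (f (i + n)))"
      using summable_ignore_initial_segment[OF sm] by (intro suminf_ennreal2) auto
    then show ?thesis using fin by (simp add: less_top)
  qed
  ultimately have "(\<lambda>n. \<Sum>i. f (i + n)) \<longlonglongrightarrow> 0" by simp
  then have "hausdorff_content s E \<le> 0"
    by (rule LIMSEQ_le_const) (use * in auto)
  then show ?thesis by simp
qed

text \<open>A cover of total cost below d^s contains no set of diameter above d, since such a set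
  alone would cost at least d^s. Cheap covers are therefore automatically fine; this is the role of
  \<open>e'\<close>.\<close>

lemma hausdorff_measure_eq_0:
  assumes "0 < s" "hausdorff_content s E = 0"
  shows "hausdorff_measure s E = 0"
proof -
  have le: "hausdorff_premeasure d s E \<le> ennreal e" if "0 < d" "0 < e" for d e
  proof -
    define e' where "e' = min e (d powr s)"
    have e': "0 < e'" "e' \<le> e" "e' \<le> d powr s" using that by (auto simp: e'_def)
    have "hausdorff_content s E < ennreal e'" using assms e' by simp
    then obtain y where "y \<in> {(\<Sum>j. diam_pow s (U j)) | U. E \<subseteq> (\<Union>j. U j) \<and> (\<forall>j::nat. bounded (U j))}"
       "y < ennreal e'"
      unfolding hausdorff_content_def[of s E] Inf_less_iff by blast
    then obtain U where U: "E \<subseteq> (\<Union>j. U j)" "\<And>j::nat. bounded (U j)" "(\<Sum>j. diam_pow s (U j)) < ennreal e'"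
      by auto
    have "diameter (U j) \<le> d" for j
    proof (rule ccontr)
      assume d: "\<not> diameter (U j) \<le> d"
      then have "U j \<noteq> {}" using \<open>0 < d\<close> by auto
      then have "diam_pow s (U j) = ennreal (diameter (U j) powr s)"
        using assms by (simp add: diam_pow_def)
      moreover have "ennreal (d powr s) \<le> ennreal (diameter (U j) powr s)"
        using d \<open>0 < d\<close> assms by (intro ennreal_leI powr_mono2) auto
      moreover have "diam_pow s (U j) \<le> (\<Sum>j. diam_pow s (U j))"
        using sum_le_suminf[of "\<lambda>j. diam_pow s (U j)" "{j}"] by simp
      ultimately have "ennreal (d powr s) < ennreal e'" using U(3) by (metis order.trans order.strict_trans1)
      then show False using e' by (simp add: ennreal_less_iff)
    qed
    then have "hausdorff_premeasure d s E \<le> (\<Sum>j. diam_pow s (U j))"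
      unfolding hausdorff_premeasure_def using U by (intro Inf_lower) blast
    also have "\<dots> \<le> ennreal e"
      using U(3) e'(2) by (meson ennreal_leI less_imp_le order_trans)
    finally show ?thesis .
  qed
  have "hausdorff_premeasure d s E \<le> 0" if "0 < d" for d
    by (rule ennreal_le_epsilon) (use le[OF that] in simp)
  then show ?thesis by (simp add: hausdorff_measure_def)
qed

section \<open>Bounding the Hausdorff dimension by null contents and by mass distributions\<close>

lemma hausdorff_dim_le:
  assumes "\<And>t. s < t \<Longrightarrow> hausdorff_content t E = 0" "0 \<le> s"
  shows "hausdorff_dim E \<le> ereal s"
proof (rule ereal_le_epsilon2)
  fix e :: real assume "0 < e"
  then have "hausdorff_measure (s + e) E = 0"
    using assms by (intro hausdorff_measure_eq_0) auto
  then show "hausdorff_dim E \<le> ereal s + ereal e"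
    unfolding hausdorff_dim_def using \<open>0 < e\<close> assms by (intro Inf_lower) (auto intro!: exI[of _ "s+e"])
qed

lemma hausdorff_dim_nonneg: "0 \<le> hausdorff_dim E"
  unfolding hausdorff_dim_def by (intro Inf_greatest) auto

text \<open>The centres are restricted to a set \<open>S\<close> of full measure: a set of the cover that meets
  \<open>X ` S\<close> lies in a ball around a point of \<open>X ` S\<close>.\<close>

lemma (in prob_space) mass_distribution_principle:
  fixes X :: "'a \<Rightarrow> real"
  assumes X: "X \<in> borel_measurable M" and S: "AE \<omega> in M. \<omega> \<in> S" "S \<subseteq> space M"
    and E: "\<And>\<omega>. \<omega> \<in> S \<Longrightarrow> X \<omega> \<in> E"
    and s: "0 < s" and r0: "0 < r0" "r0 \<le> 1" and C: "0 < C"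
    and ball: "\<And>\<omega>0 r. \<omega>0 \<in> S \<Longrightarrow> 0 < r \<Longrightarrow> r \<le> r0 \<Longrightarrow>
       prob {\<omega> \<in> space M. \<bar>X \<omega> - X \<omega>0\<bar> \<le> r} \<le> C * r powr s"
  shows "ereal s \<le> hausdorff_dim E"
proof -
  have "hausdorff_measure t E \<noteq> 0" if t: "0 \<le> t" "t < s" for t
  proof
    assume 0: "hausdorff_measure t E = 0"
    have "hausdorff_premeasure r0 t E \<le> hausdorff_measure t E"
      unfolding hausdorff_measure_def using r0 by (intro SUP_upper) auto
    \<comment> \<open>With this threshold C times the cost of the cover stays below 1, whereas the
      balls built from it must carry the whole mass 1.\<close>
    then have "hausdorff_premeasure r0 t E < ennreal (1 / C)" using 0 C by simp
    then obtain y where "y \<in> {(\<Sum>j. diam_pow t (U j)) | U. E \<subseteq> (\<Union>j. U j) \<and>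
        (\<forall>j::nat. bounded (U j) \<and> diameter (U j) \<le> r0)}"
       "y < ennreal (1 / C)"
      unfolding hausdorff_premeasure_def Inf_less_iff by blast
    then obtain U where U: "E \<subseteq> (\<Union>j. U j)" "\<And>j::nat. bounded (U j)" "\<And>j. diameter (U j) \<le> r0"
        "(\<Sum>j. diam_pow t (U j)) < ennreal (1 / C)"
      by auto
    define c where "c j = (if U j \<inter> X ` S = {} then None else Some (SOME \<omega>. \<omega> \<in> S \<and> X \<omega> \<in> U j))" for j
    have c: "\<omega>0 \<in> S \<and> X \<omega>0 \<in> U j" if "c j = Some \<omega>0" for j \<omega>0
    proof -
      have "\<exists>\<omega>. \<omega> \<in> S \<and> X \<omega> \<in> U j" using that by (auto simp: c_def split: if_splits)
      from someI_ex[OF this] show ?thesis using that by (auto simp: c_def split: if_splits)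
    qed
    define V where "V j = (case c j of None \<Rightarrow> {} | Some \<omega>0 \<Rightarrow>
        {\<omega> \<in> space M. \<bar>X \<omega> - X \<omega>0\<bar> \<le> diameter (U j)})" for j
    have meas: "V j \<in> events" for j
      using X by (auto simp: V_def split: option.splits)
    have V: "emeasure M (V j) \<le> ennreal C * diam_pow t (U j)" for j
    proof (cases "c j")
      case (Some \<omega>0)
      have w: "\<omega>0 \<in> S" "X \<omega>0 \<in> U j" using c[OF Some] by auto
      have Vj: "V j = {\<omega> \<in> space M. \<bar>X \<omega> - X \<omega>0\<bar> \<le> diameter (U j)}" by (simp add: V_def Some)
      have d0: "0 \<le> diameter (U j)" using U(2) by (rule diameter_ge_0)
      have lim: "prob (V j) \<le> C * r powr s" if "diameter (U j) \<le> r" "0 < r" "r \<le> r0" for r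
      proof -
        have "prob (V j) \<le> prob {\<omega> \<in> space M. \<bar>X \<omega> - X \<omega>0\<bar> \<le> r}"
          using X that by (intro finite_measure_mono) (auto simp: Vj)
        then show ?thesis using ball[OF w(1) that(2,3)] by simp
      qed
      have le: "C * r powr s \<le> C * r powr t" if "0 < r" "r \<le> r0" for r
        using that r0 C t by (intro mult_left_mono powr_mono') auto
      have "prob (V j) \<le> C * (if t = 0 then 1 else diameter (U j) powr t)"
      proof (cases "diameter (U j) = 0")
        case True
        \<comment> \<open>The ball bound asks for a positive radius. A set of diameter 0 is treated
          by letting the radius tend to 0, where s > 0 makes the bound vanish.\<close>
        have "prob (V j) \<le> 0"
        proof (rule tendsto_lowerbound[where F = "at_right (0::real)" and f = "\<lambda>r. C * r powr s"])
          show "((\<lambda>r. C * r powr s) \<longlongrightarrow> 0) (at_right 0)"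
            using s by real_asymp
          show "\<forall>\<^sub>F r in at_right 0. prob (V j) \<le> C * r powr s"
            using eventually_at_right_real[OF r0(1)]
            by eventually_elim (use lim True in auto)
        qed auto
        then show ?thesis using True C by auto
      next
        case False
        then have "prob (V j) \<le> C * diameter (U j) powr t"
          using lim[of "diameter (U j)"] le[of "diameter (U j)"] d0 U(3)[of j] by auto
        then show ?thesis using False by (cases "t = 0") auto
      qed
      moreover have "U j \<noteq> {}" using w by auto
      ultimately have "emeasure M (V j) \<le> ennreal (C * (if t = 0 then 1 else diameter (U j) powr t))"
        unfolding emeasure_eq_measure by (intro ennreal_leI)
      also have "\<dots> = ennreal C * diam_pow t (U j)"
        using C \<open>U j \<noteq> {}\<close> by (auto simp: diam_pow_def ennreal_mult)
      finally show ?thesis .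
    qed (simp add: V_def)
    have "1 = emeasure M (\<Union>j. V j)"
    proof (rule emeasure_eq_1_AE[symmetric])
      show "AE x in M. x \<in> (\<Union>j. V j)"
        using S(1)
      proof eventually_elim
        case (elim \<omega>)
        then obtain j where j: "X \<omega> \<in> U j" using E U(1) by blast
        then have "U j \<inter> X ` S \<noteq> {}" using elim by auto
        then obtain \<omega>0 where w: "c j = Some \<omega>0" by (auto simp: c_def)
        have "\<bar>X \<omega> - X \<omega>0\<bar> \<le> diameter (U j)"
          using diameter_bounded_bound[OF U(2) j, of "X \<omega>0"] c[OF w] by (simp add: dist_real_def)
        then show ?case using elim S(2) by (auto simp: V_def w intro!: exI[of _ j])
      qed
    qed (use meas in auto)
    also have "\<dots> \<le> (\<Sum>j. emeasure M (V j))"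
      using meas by (intro emeasure_subadditive_countably) auto
    also have "\<dots> \<le> (\<Sum>j. ennreal C * diam_pow t (U j))"
      using V by (intro suminf_le) auto
    also have "\<dots> = ennreal C * (\<Sum>j. diam_pow t (U j))" by simp
    also have "\<dots> < ennreal C * ennreal (1 / C)"
      using U(4) C by (intro ennreal_mult_strict_left_mono) auto
    also have "\<dots> = 1" using C by (simp add: ennreal_mult[symmetric])
    finally show False by simp
  qed
  then show ?thesis
    unfolding hausdorff_dim_def by (intro Inf_greatest) (force simp: not_less[symmetric])
qed

section \<open>Sums over words\<close>

text \<open>The pressure is an \<open>infsum\<close>; as an integral over a counting measure it is
  open to Tonelli and to pulling out constants.\<close>

lemma infsum_ennreal_eq_nn_integral:
  fixes f :: "'a \<Rightarrow> ennreal"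
  assumes "countable A"
  shows "infsum f A = (\<integral>\<^sup>+ x. f x \<partial>count_space A)"
proof (cases "finite A")
  case True
  then show ?thesis by (simp add: nn_integral_count_space_finite)
next
  case False
  define g where "g = from_nat_into A"
  have g: "bij_betw g UNIV A" using assms False unfolding g_def by (rule bij_betw_from_nat_into)
  have "infsum f A = infsum (\<lambda>n. f (g n)) UNIV"
    using infsum_reindex_bij_betw[OF g] by metis
  also have "\<dots> = (\<Sum>n. f (g n))"
  proof -
    have "(\<lambda>n. f (g n)) summable_on UNIV" by (rule nonneg_summable_on_complete) simp
    then have "(\<lambda>n. f (g n)) sums infsum (\<lambda>n. f (g n)) UNIV"
      by (intro has_sum_imp_sums has_sum_infsum)
    then show ?thesis by (rule sums_unique)
  qed
  also have "\<dots> = (\<integral>\<^sup>+ x. f x \<partial>count_space A)"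
    by (simp add: nn_integral_bij_count_space[OF g, symmetric] nn_integral_count_space_nat)
  finally show ?thesis .
qed

lemma nn_integral_count_space_prod:
  assumes "countable A" "countable B"
  shows "(\<integral>\<^sup>+ x. \<integral>\<^sup>+ y. f x y \<partial>count_space B \<partial>count_space A)
     = (\<integral>\<^sup>+ z. f (fst z) (snd z) \<partial>count_space (A \<times> B))"
proof -
  interpret B: sigma_finite_measure "count_space B"
    using assms(2) by (rule sigma_finite_measure_count_space_countable)
  have eq: "count_space A \<Otimes>\<^sub>M count_space B = count_space (A \<times> B)"
    using assms by (rule pair_measure_countable)
  have "(\<lambda>z. f (fst z) (snd z)) \<in> borel_measurable (count_space A \<Otimes>\<^sub>M count_space B)"
    unfolding eq by simp
  from B.nn_integral_fst[OF this] show ?thesis by (simp add: eq)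
qed

definition words :: "nat \<Rightarrow> nat list set" where
  "words n = {w. length w = n \<and> pos_word w}"

lemma countable_nat_list_set [simp]: "countable A" for A :: "nat list set"
  by (rule countableI_type)

lemma words_0 [simp]: "words 0 = {[]}"
  by (auto simp: words_def)

lemma words_append: "bij_betw (\<lambda>z. fst z @ snd z) (words m \<times> words n) (words (m + n))"
proof (rule bij_betwI[where g = "\<lambda>w. (take m w, drop m w)"])
  show "(\<lambda>w. (take m w, drop m w)) \<in> words (m + n) \<rightarrow> words m \<times> words n"
    by (auto simp: words_def pos_word_def dest: in_set_takeD in_set_dropD)
qed (auto simp: words_def)

lemma nn_integral_words_add:
  "(\<integral>\<^sup>+ w. f w \<partial>count_space (words (m + n)))
    = (\<integral>\<^sup>+ u. \<integral>\<^sup>+ v. f (u @ v) \<partial>count_space (words n) \<partial>count_space (words m))"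
  using nn_integral_bij_count_space[OF words_append[of m n], of f]
    nn_integral_count_space_prod[of "words m" "words n" "\<lambda>u v. f (u @ v)"] by simp

lemma nn_integral_words_1:
  "(\<integral>\<^sup>+ w. f w \<partial>count_space (words 1)) = (\<integral>\<^sup>+ a. f [a] \<partial>count_space {1..})"
proof -
  have "bij_betw (\<lambda>a. [a]) {1::nat..} (words 1)"
  proof (rule bij_betwI[where g = hd])
    show "(\<lambda>a. [a]) \<in> {1..} \<rightarrow> words 1" by (auto simp: words_def)
    show "hd \<in> words 1 \<rightarrow> {1..}" by (auto simp: words_def length_Suc_conv)
    show "[hd w] = w" if "w \<in> words 1" for w using that by (auto simp: words_def length_Suc_conv)
  qed auto
  from nn_integral_bij_count_space[OF this, of f] show ?thesis by simp
qed

text \<open>The value zeta(\<sigma>), with \<top> for \<sigma> \<le> 1.\<close>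

definition digit_sum :: "real \<Rightarrow> ennreal" where
  "digit_sum \<sigma> = (\<integral>\<^sup>+ a. ennreal (real a powr (-\<sigma>)) \<partial>count_space {1..})"

text \<open>Up to a factor between \<open>4 powr (-s)\<close> and 1 this is the n-th partition sum
  of the potential -s log |T'|, with the supremum over x replaced by the value at x = 0.\<close>

definition word_sum :: "real \<Rightarrow> nat \<Rightarrow> ennreal" where
  "word_sum s n = (\<integral>\<^sup>+ w. ennreal (cf_den w 0 powr (-2 * s)) \<partial>count_space (words n))"

lemma digit_sum_eq_suminf: "digit_sum \<sigma> = (\<Sum>n. ennreal (real (Suc n) powr (-\<sigma>)))"
proof -
  have "bij_betw Suc UNIV {1..}"
    by (rule bij_betwI[where g = "\<lambda>n. n - 1"]) auto
  from nn_integral_bij_count_space[OF this, of "\<lambda>a. ennreal (real a powr (-\<sigma>))"]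
  show ?thesis by (simp add: digit_sum_def nn_integral_count_space_nat)
qed

lemma digit_sum_finite: "1 < \<sigma> \<Longrightarrow> digit_sum \<sigma> < \<top>"
proof -
  assume "1 < \<sigma>"
  then have "summable (\<lambda>n. real n powr (-\<sigma>))" by (simp add: summable_real_powr_iff)
  then have "summable (\<lambda>n. real (Suc n) powr (-\<sigma>))" by (subst summable_Suc_iff)
  then have "(\<Sum>n. ennreal (real (Suc n) powr (-\<sigma>))) = ennreal (\<Sum>n. real (Suc n) powr (-\<sigma>))"
    by (intro suminf_ennreal2) auto
  then show ?thesis by (simp add: digit_sum_eq_suminf)
qed

lemma digit_sum_infinite: "\<sigma> \<le> 1 \<Longrightarrow> digit_sum \<sigma> = \<top>"
proof (rule ccontr)
  assume "\<sigma> \<le> 1" "digit_sum \<sigma> \<noteq> \<top>"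
  then have "summable (\<lambda>n. real (Suc n) powr (-\<sigma>))"
    by (intro summable_suminf_not_top) (auto simp: digit_sum_eq_suminf)
  then have "summable (\<lambda>n. real n powr (-\<sigma>))" by (subst (asm) summable_Suc_iff)
  then show False using \<open>\<sigma> \<le> 1\<close> by (simp add: summable_real_powr_iff)
qed

lemma digit_sum_ge_1: "1 \<le> digit_sum \<sigma>"
proof -
  have "(\<Sum>n\<in>{0}. ennreal (real (Suc n) powr (-\<sigma>))) \<le> digit_sum \<sigma>"
    unfolding digit_sum_eq_suminf by (rule sum_le_suminf) auto
  then show ?thesis by simp
qed

text \<open>Unlike the continuant, the product of the digits is exactly multiplicative under
  concatenation, so the sum factorises.\<close>

lemma nn_integral_prod_list_words:
  "(\<integral>\<^sup>+ w. ennreal (real (prod_list w) powr (-\<sigma>)) \<partial>count_space (words n)) = digit_sum \<sigma> ^ n"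
proof (induction n)
  case 0
  show ?case by (simp add: nn_integral_count_space_finite)
next
  case (Suc n)
  have "(\<integral>\<^sup>+ w. ennreal (real (prod_list w) powr (-\<sigma>)) \<partial>count_space (words (1 + n)))
     = (\<integral>\<^sup>+ a. \<integral>\<^sup>+ v. ennreal (real a powr (-\<sigma>)) * ennreal (real (prod_list v) powr (-\<sigma>))
          \<partial>count_space (words n) \<partial>count_space {1..})"
    unfolding nn_integral_words_add nn_integral_words_1
  proof (intro nn_integral_cong)
    fix a v
    show "ennreal (real (prod_list ([a] @ v)) powr (-\<sigma>))
      = ennreal (real a powr (-\<sigma>)) * ennreal (real (prod_list v) powr (-\<sigma>))"
    proof -
      have "real (prod_list ([a] @ v)) = real a * real (prod_list v)" by simp
      then show ?thesis by (simp only: powr_mult of_nat_0_le_iff ennreal_mult'' powr_ge_zero)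
    qed
  qed
  also have "\<dots> = digit_sum \<sigma> * digit_sum \<sigma> ^ n"
    by (simp add: nn_integral_cmult nn_integral_multc Suc digit_sum_def)
  finally show ?case by simp
qed

lemma word_sum_add_le:
  assumes "0 \<le> s"
  shows "word_sum s (m + n) \<le> word_sum s m * word_sum s n"
proof -
  have "word_sum s (m + n) \<le> (\<integral>\<^sup>+ u. \<integral>\<^sup>+ v. ennreal (cf_den u 0 powr (-2 * s)) * ennreal (cf_den v 0 powr (-2 * s))
          \<partial>count_space (words n) \<partial>count_space (words m))"
    unfolding word_sum_def nn_integral_words_add
  proof (intro nn_integral_mono)
    fix u v assume "u \<in> space (count_space (words m))" "v \<in> space (count_space (words n))"
    then have w: "pos_word u" "pos_word v" by (auto simp: words_def)
    have q: "1 \<le> cf_den u 0" "1 \<le> cf_den v 0" using cf_den_ge_1 w by auto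
    have "0 < cf_den u 0 * cf_den v 0" using q by simp
    then have "cf_den (u @ v) 0 powr (-2 * s) \<le> (cf_den u 0 * cf_den v 0) powr (-2 * s)"
      using cf_den_append_bounds(1)[OF w] assms by (intro powr_mono2') auto
    then show "ennreal (cf_den (u @ v) 0 powr (-2 * s)) \<le> ennreal (cf_den u 0 powr (-2 * s)) * ennreal (cf_den v 0 powr (-2 * s))"
      using q by (simp add: powr_mult ennreal_mult[symmetric] ennreal_leI)
  qed
  also have "\<dots> = word_sum s m * word_sum s n"
    by (simp add: nn_integral_cmult nn_integral_multc word_sum_def)
  finally show ?thesis .
qed

text \<open>The factor is \<open>2 powr (-2 * s)\<close>, from the upper half of
  quasi-multiplicativity. With \<open>word_sum_add_le\<close> it makes the logarithm of the sums
  almost additive.\<close>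

lemma word_sum_add_ge:
  assumes "0 \<le> s"
  shows "ennreal (4 powr (-s)) * (word_sum s m * word_sum s n) \<le> word_sum s (m + n)"
proof -
  have "ennreal (4 powr (-s)) * (word_sum s m * word_sum s n) =
      (\<integral>\<^sup>+ u. \<integral>\<^sup>+ v. ennreal (4 powr (-s)) * (ennreal (cf_den u 0 powr (-2 * s)) * ennreal (cf_den v 0 powr (-2 * s)))
          \<partial>count_space (words n) \<partial>count_space (words m))"
    by (simp add: nn_integral_cmult nn_integral_multc word_sum_def)
  also have "\<dots> \<le> word_sum s (m + n)"
    unfolding word_sum_def nn_integral_words_add
  proof (intro nn_integral_mono)
    fix u v assume "u \<in> space (count_space (words m))" "v \<in> space (count_space (words n))"
    then have w: "pos_word u" "pos_word v" by (auto simp: words_def)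
    have q: "1 \<le> cf_den u 0" "1 \<le> cf_den v 0" "1 \<le> cf_den (u @ v) 0"
      using cf_den_ge_1[of u 0] cf_den_ge_1[of v 0] cf_den_ge_1[of "u @ v" 0] w by auto
    have "(2 * (cf_den u 0 * cf_den v 0)) powr (-2 * s) \<le> cf_den (u @ v) 0 powr (-2 * s)"
      using cf_den_append_bounds(2)[OF w] assms q by (intro powr_mono2') auto
    moreover have "(2::real) powr (-2 * s) = 4 powr (-s)"
      using powr_powr[of 2 2 "-s"] by simp
    ultimately show "ennreal (4 powr (-s)) * (ennreal (cf_den u 0 powr (-2 * s)) * ennreal (cf_den v 0 powr (-2 * s)))
        \<le> ennreal (cf_den (u @ v) 0 powr (-2 * s))"
      using q by (simp add: powr_mult ennreal_mult[symmetric] ennreal_leI)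
  qed
  finally show ?thesis .
qed

lemma word_sum_0 [simp]: "word_sum s 0 = 1"
  by (simp add: word_sum_def nn_integral_count_space_finite)

lemma word_sum_1: "word_sum s (Suc 0) = digit_sum (2 * s)"
  using nn_integral_words_1[of "\<lambda>w. ennreal (cf_den w 0 powr (-2 * s))"]
  by (simp add: word_sum_def digit_sum_def)

lemma word_sum_pos: "0 < word_sum s n"
proof -
  define w where "w = replicate n (1::nat)"
  have w: "w \<in> words n" by (auto simp: w_def words_def pos_word_def)
  then have "pos_word w" by (simp add: words_def)
  then have "0 < cf_den w 0 powr (-2 * s)" using cf_den_ge_1[of w 0] by simp
  moreover have "(\<integral>\<^sup>+ v. ennreal (cf_den w 0 powr (-2 * s)) * indicator {w} v \<partial>count_space (words n)) \<le> word_sum s n"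
    unfolding word_sum_def by (intro nn_integral_mono) (auto split: split_indicator)
  moreover have "(\<integral>\<^sup>+ v. ennreal (cf_den w 0 powr (-2 * s)) * indicator {w} v \<partial>count_space (words n)) = ennreal (cf_den w 0 powr (-2 * s))"
    using w by (simp add: nn_integral_cmult_indicator)
  ultimately show ?thesis by (metis ennreal_less_zero_iff order.strict_trans2)
qed

lemma word_sum_finite:
  assumes "1/2 < s"
  shows "word_sum s n < \<top>"
proof (induction n)
  case (Suc n)
  have "word_sum s (1 + n) \<le> word_sum s 1 * word_sum s n"
    using assms by (intro word_sum_add_le) auto
  also have "\<dots> < \<top>"
    using Suc digit_sum_finite[of "2 * s"] assms by (simp add: word_sum_1 ennreal_mult_less_top)
  finally show ?case by simp
qed simp

lemma word_sum_infinite: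
  assumes "0 \<le> s" "s \<le> 1/2" "1 \<le> n"
  shows "word_sum s n = \<top>"
proof -
  have "ennreal (4 powr (-s)) * (word_sum s 1 * word_sum s (n - 1)) \<le> word_sum s (1 + (n - 1))"
    using assms by (intro word_sum_add_ge) auto
  moreover have "word_sum s 1 * word_sum s (n - 1) = \<top>"
    using digit_sum_infinite[of "2 * s"] assms word_sum_pos[of s "n-1"]
    by (simp add: word_sum_1 ennreal_top_mult)
  ultimately show ?thesis using assms by (simp add: ennreal_mult_top top_unique)
qed

lemma word_sum_antimono:
  assumes "s \<le> t"
  shows "word_sum t n \<le> word_sum s n"
  unfolding word_sum_def
proof (intro nn_integral_mono)
  fix w assume "w \<in> space (count_space (words n))"
  then have "1 \<le> cf_den w 0" using cf_den_ge_1[of w 0] by (auto simp: words_def)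
  then show "ennreal (cf_den w 0 powr (-2 * t)) \<le> ennreal (cf_den w 0 powr (-2 * s))"
    using assms by (intro ennreal_leI powr_mono) auto
qed

section \<open>Word sums at exponent 1 and their growth below it\<close>

lemma telescoping_digit_sum:
  assumes "0 \<le> x"
  shows "(\<integral>\<^sup>+ a. ennreal (1 / ((real a + x) * (real a + x + 1))) \<partial>count_space {1..}) = ennreal (1 / (1 + x))"
proof -
  have bij: "bij_betw Suc UNIV {1..}"
    by (rule bij_betwI[where g = "\<lambda>n. n - 1"]) auto
  have "(\<lambda>n. 1 / (real (Suc n) + x)) \<longlonglongrightarrow> 0" by real_asymp
  from telescope_sums'[OF this]
  have "(\<lambda>n. 1 / (real (Suc n) + x) - 1 / (real (Suc (Suc n)) + x)) sums (1 / (1 + x))" by simp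
  moreover have "1 / (real (Suc n) + x) - 1 / (real (Suc (Suc n)) + x)
     = 1 / ((real (Suc n) + x) * (real (Suc n) + x + 1))" for n
  proof -
    have "real n + 1 + x > 0" "real n + 2 + x > 0" using assms by linarith+
    then show ?thesis by (simp add: divide_simps)
  qed
  ultimately have "(\<lambda>n. 1 / ((real (Suc n) + x) * (real (Suc n) + x + 1))) sums (1 / (1 + x))" by simp
  then have "(\<Sum>n. ennreal (1 / ((real (Suc n) + x) * (real (Suc n) + x + 1)))) = ennreal (1 / (1 + x))"
    using assms by (intro suminf_ennreal_eq) auto
  then show ?thesis
    using nn_integral_bij_count_space[OF bij, of "\<lambda>a. ennreal (1 / ((real a + x) * (real a + x + 1)))"]
    by (simp add: nn_integral_count_space_nat)
qed

text \<open>The Gauss density \<open>1 / (1 + x)\<close> is a fixed point of the transfer operator.\<close>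

lemma gauss_density_invariant:
  assumes "0 \<le> x" "x \<le> 1"
  shows "(\<integral>\<^sup>+ w. ennreal (1 / ((cf_den w x)\<^sup>2 * (1 + cf_branch w x))) \<partial>count_space (words n)) = ennreal (1 / (1 + x))"
  using assms
proof (induction n arbitrary: x)
  case 0
  then show ?case by (simp add: nn_integral_count_space_finite)
next
  case (Suc n)
  have "(\<integral>\<^sup>+ w. ennreal (1 / ((cf_den w x)\<^sup>2 * (1 + cf_branch w x))) \<partial>count_space (words (n + 1)))
    = (\<integral>\<^sup>+ v. \<integral>\<^sup>+ a. ennreal (1 / ((cf_den (v @ [a]) x)\<^sup>2 * (1 + cf_branch (v @ [a]) x))) \<partial>count_space {1..} \<partial>count_space (words n))"
    unfolding nn_integral_words_add nn_integral_words_1 ..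
  \<comment> \<open>Splitting off the last digit and summing over it outside lets the induction
    hypothesis be used at the preimage \<open>1 / (real a + x)\<close>.\<close>
  also have "\<dots> = (\<integral>\<^sup>+ a. \<integral>\<^sup>+ v. ennreal (1 / ((cf_den (v @ [a]) x)\<^sup>2 * (1 + cf_branch (v @ [a]) x))) \<partial>count_space (words n) \<partial>count_space {1..})"
    by (rule nn_integral_count_space_nn_integral) auto
  also have "\<dots> = (\<integral>\<^sup>+ a. ennreal (1 / ((real a + x) * (real a + x + 1))) \<partial>count_space {1..})"
  proof (intro nn_integral_cong)
    fix a assume "a \<in> space (count_space {1::nat..})"
    then have a: "1 \<le> real a" by simp
    define y where "y = 1 / (real a + x)"
    have y: "0 \<le> y" "y \<le> 1" using a Suc.prems by (auto simp: y_def)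
    have "(\<integral>\<^sup>+ v. ennreal (1 / ((cf_den (v @ [a]) x)\<^sup>2 * (1 + cf_branch (v @ [a]) x))) \<partial>count_space (words n))
      = (\<integral>\<^sup>+ v. ennreal (1 / (real a + x)\<^sup>2) * ennreal (1 / ((cf_den v y)\<^sup>2 * (1 + cf_branch v y))) \<partial>count_space (words n))"
    proof (intro nn_integral_cong)
      fix v assume "v \<in> space (count_space (words n))"
      then have "0 \<le> cf_branch v y" using cf_branch_range y by (auto simp: words_def)
      then show "ennreal (1 / ((cf_den (v @ [a]) x)\<^sup>2 * (1 + cf_branch (v @ [a]) x)))
        = ennreal (1 / (real a + x)\<^sup>2) * ennreal (1 / ((cf_den v y)\<^sup>2 * (1 + cf_branch v y)))"
        by (simp add: ennreal_mult[symmetric] cf_den_append cf_branch_append y_def power_mult_distrib mult_ac)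
    qed
    also have "\<dots> = ennreal (1 / (real a + x)\<^sup>2) * ennreal (1 / (1 + y))"
      using Suc.IH[OF y] by (simp add: nn_integral_cmult)
    also have "\<dots> = ennreal (1 / ((real a + x) * (real a + x + 1)))"
    proof -
      have "real a + x > 0" using a Suc.prems by simp
      then have "1 / (real a + x)\<^sup>2 * (1 / (1 + y)) = 1 / ((real a + x) * (real a + x + 1))"
        by (simp add: y_def divide_simps power2_eq_square)
      then show ?thesis using y by (simp add: ennreal_mult[symmetric])
    qed
    finally show "(\<integral>\<^sup>+ v. ennreal (1 / ((cf_den (v @ [a]) x)\<^sup>2 * (1 + cf_branch (v @ [a]) x))) \<partial>count_space (words n))
       = ennreal (1 / ((real a + x) * (real a + x + 1)))" .
  qed
  also have "\<dots> = ennreal (1 / (1 + x))" using Suc.prems by (intro telescoping_digit_sum) auto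
  finally show ?case by simp
qed

text \<open>At x = 0 the invariance of the Gauss density reads as a weighted word sum equal to 1,
  and the weights \<open>1 / (1 + cf_branch w 0)\<close> lie between 1/2 and 1.\<close>

lemma word_sum_at_1: "1 \<le> word_sum 1 n" "word_sum 1 n \<le> 2"
proof -
  have eq: "(\<integral>\<^sup>+ w. ennreal (1 / ((cf_den w 0)\<^sup>2 * (1 + cf_branch w 0))) \<partial>count_space (words n)) = 1"
    using gauss_density_invariant[of 0 n] by simp
  have b: "0 \<le> cf_branch w 0" "cf_branch w 0 \<le> 1" "1 \<le> cf_den w 0" if "w \<in> words n" for w
    using that cf_branch_range[of w 0] cf_den_ge_1[of w 0] by (auto simp: words_def)
  have p: "cf_den w 0 powr (-2) = 1 / (cf_den w 0)\<^sup>2" if "w \<in> words n" for w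
    using b(3)[OF that] by (simp add: powr_minus divide_simps)
  have "(\<integral>\<^sup>+ w. ennreal (1 / ((cf_den w 0)\<^sup>2 * (1 + cf_branch w 0))) \<partial>count_space (words n)) \<le> word_sum 1 n"
    unfolding word_sum_def
  proof (intro nn_integral_mono ennreal_leI)
    fix w assume "w \<in> space (count_space (words n))"
    then have w: "w \<in> words n" by simp
    show "1 / ((cf_den w 0)\<^sup>2 * (1 + cf_branch w 0)) \<le> cf_den w 0 powr (-2 * 1)"
    proof -
      have "1 / ((cf_den w 0)\<^sup>2 * (1 + cf_branch w 0)) \<le> 1 / ((cf_den w 0)\<^sup>2 * 1)"
        using b[OF w] by (intro divide_left_mono mult_left_mono) auto
      then show ?thesis using p[OF w] by simp
    qed
  qed
  then show "1 \<le> word_sum 1 n" using eq by simp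
  have "word_sum 1 n \<le> (\<integral>\<^sup>+ w. ennreal 2 * ennreal (1 / ((cf_den w 0)\<^sup>2 * (1 + cf_branch w 0))) \<partial>count_space (words n))"
    unfolding word_sum_def
  proof (intro nn_integral_mono)
    fix w assume "w \<in> space (count_space (words n))"
    then have w: "w \<in> words n" by simp
    have "cf_den w 0 powr (-2 * 1) \<le> 2 * (1 / ((cf_den w 0)\<^sup>2 * (1 + cf_branch w 0)))"
    proof -
      have "2 / ((cf_den w 0)\<^sup>2 * 2) \<le> 2 / ((cf_den w 0)\<^sup>2 * (1 + cf_branch w 0))"
        using b[OF w] by (intro divide_left_mono mult_left_mono) auto
      then show ?thesis using p[OF w] by simp
    qed
    then show "ennreal (cf_den w 0 powr (-2 * 1)) \<le> ennreal 2 * ennreal (1 / ((cf_den w 0)\<^sup>2 * (1 + cf_branch w 0)))"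
      using b[OF w] by (simp add: ennreal_mult[symmetric] ennreal_leI del: ennreal_numeral)
  qed
  also have "\<dots> = 2" by (simp add: nn_integral_cmult eq)
  finally show "word_sum 1 n \<le> 2" .
qed

text \<open>Compared with exponent 1 each term gains the factor q^(2 (1 - s)), which grows
  exponentially in n uniformly over the words. This produces large weight sums for every s <
  1.\<close>

lemma word_sum_growth:
  assumes "s \<le> 1"
  shows "ennreal (2 powr (2 * (1 - s) * real (n div 2))) \<le> word_sum s n"
proof -
  define K where "K = (2::real) powr (2 * (1 - s) * real (n div 2))"
  have "ennreal K * word_sum 1 n \<le> word_sum s n"
    unfolding word_sum_def
  proof (subst nn_integral_cmult[symmetric], simp, intro nn_integral_mono)
    fix w assume "w \<in> space (count_space (words n))"
    then have w: "pos_word w" "length w = n" by (auto simp: words_def)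
    have q: "1 \<le> cf_den w 0" using cf_den_ge_1[of w 0] w by auto
    have "K = (2 ^ (n div 2)) powr (2 * (1 - s))"
      by (simp add: K_def powr_realpow[symmetric] powr_powr mult_ac)
    also have "\<dots> \<le> cf_den w 0 powr (2 * (1 - s))"
      using cf_den_exp_growth[OF w(1)] w(2) assms by (intro powr_mono2) auto
    finally have "K * cf_den w 0 powr (-2 * 1) \<le> cf_den w 0 powr (2 * (1 - s)) * cf_den w 0 powr (-2 * 1)"
      by (intro mult_right_mono) auto
    also have "\<dots> = cf_den w 0 powr (-2 * s)"
      by (simp add: powr_add[symmetric])
    finally show "ennreal K * ennreal (cf_den w 0 powr (-2 * 1)) \<le> ennreal (cf_den w 0 powr (-2 * s))"
      by (simp add: ennreal_mult[symmetric] ennreal_leI K_def)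
  qed
  moreover have "ennreal K * 1 \<le> ennreal K * word_sum 1 n"
    using word_sum_at_1(1) by (rule mult_left_mono) simp
  ultimately show ?thesis by (simp add: K_def)
qed

text \<open>The sum is the supremum of its finite partial sums; the statement also covers an
  infinite sum. Finiteness of W later bounds the digits from above and the probabilities from
  below.\<close>

lemma finite_subset_word_sum:
  assumes "ennreal K < word_sum s n" "0 \<le> K"
  shows "\<exists>W \<subseteq> words n. finite W \<and> K < (\<Sum>w\<in>W. cf_den w 0 powr (-2 * s))"
proof -
  have "word_sum s n = infsum (\<lambda>w. ennreal (cf_den w 0 powr (-2 * s))) (words n)"
    by (simp add: word_sum_def infsum_ennreal_eq_nn_integral)
  also have "\<dots> = (SUP F\<in>{F. finite F \<and> F \<subseteq> words n}. \<Sum>w\<in>F. ennreal (cf_den w 0 powr (-2 * s)))"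
    by (rule nonneg_infsum_complete) simp
  finally obtain F where "finite F" "F \<subseteq> words n" "ennreal K < (\<Sum>w\<in>F. ennreal (cf_den w 0 powr (-2 * s)))"
    using assms(1) by (auto simp: less_SUP_iff)
  moreover from this have "K < (\<Sum>w\<in>F. cf_den w 0 powr (-2 * s))"
    using assms(2) by (simp add: sum_ennreal ennreal_less_iff)
  ultimately show ?thesis by blast
qed

section \<open>Pressure\<close>

lemma almost_additive_multiple:
  fixes u :: "nat \<Rightarrow> real"
  assumes "\<And>m n. \<bar>u (m + n) - u m - u n\<bar> \<le> C" "u 0 = 0"
  shows "\<bar>u (k * m) - real k * u m\<bar> \<le> real k * C"
proof (induction k)
  case (Suc k)
  have "\<bar>u (m + k * m) - u m - u (k * m)\<bar> \<le> C" by (rule assms)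
  then show ?case using Suc by (simp add: algebra_simps abs_le_iff)
qed (simp add: assms)

text \<open>Evaluating \<open>u (m * n)\<close> in two ways gives a cross inequality between
  \<open>u m\<close> and \<open>u n\<close>, hence a Cauchy sequence with explicit rate. Letting n
  tend to infinity in it leaves an error bounded by C for each m, stronger than mere
  convergence.\<close>

lemma almost_additive_limit:
  fixes u :: "nat \<Rightarrow> real"
  assumes add: "\<And>m n. \<bar>u (m + n) - u m - u n\<bar> \<le> C" and u0: "u 0 = 0"
  shows "\<exists>P. (\<lambda>n. u n / real n) \<longlonglongrightarrow> P \<and> (\<forall>n. \<bar>u n - real n * P\<bar> \<le> C)"
proof -
  have C: "0 \<le> C" using add[of 0 0] by simp
  have cross: "\<bar>real n * u m - real m * u n\<bar> \<le> real n * C + real m * C" for m n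
  proof -
    have "\<bar>u (n * m) - real n * u m\<bar> \<le> real n * C" "\<bar>u (m * n) - real m * u n\<bar> \<le> real m * C"
      using almost_additive_multiple[of u C] add u0 by blast+
    then show ?thesis by (simp add: mult.commute abs_le_iff)
  qed
  have diff: "\<bar>u m / real m - u n / real n\<bar> \<le> C / real m + C / real n" if "1 \<le> m" "1 \<le> n" for m n
  proof -
    have "u m / real m - u n / real n = (real n * u m - real m * u n) / (real m * real n)"
      using that by (simp add: field_simps)
    also have "\<bar>\<dots>\<bar> \<le> (real n * C + real m * C) / (real m * real n)"
      using cross[of n m] that by (simp add: abs_mult divide_right_mono)
    also have "\<dots> = C / real m + C / real n" using that by (simp add: field_simps)
    finally show ?thesis .
  qed
  have "Cauchy (\<lambda>n. u n / real n)"
  proof (rule metric_CauchyI)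
    fix e :: real assume e: "0 < e"
    obtain N :: nat where N: "2 * C / e < real N" using reals_Archimedean2 by blast
    then have "0 < real N" using C e by (meson divide_nonneg_pos le_less_trans mult_nonneg_nonneg zero_le_numeral)
    show "\<exists>M. \<forall>m\<ge>M. \<forall>n\<ge>M. dist (u m / real m) (u n / real n) < e"
    proof (intro exI allI impI)
      fix m n assume mn: "N \<le> m" "N \<le> n"
      have "C / real m \<le> C / real N" "C / real n \<le> C / real N"
        using mn \<open>0 < real N\<close> C by (auto intro!: divide_left_mono)
      moreover have "C / real N < e / 2" using N \<open>0 < real N\<close> e by (simp add: field_simps)
      moreover have "\<bar>u m / real m - u n / real n\<bar> \<le> C / real m + C / real n"
        using mn \<open>0 < real N\<close> by (intro diff) auto
      ultimately show "dist (u m / real m) (u n / real n) < e" unfolding dist_real_def by linarith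
    qed
  qed
  then obtain P where P: "(\<lambda>n. u n / real n) \<longlonglongrightarrow> P"
    by (auto simp: Cauchy_convergent_iff convergent_def)
  have "\<bar>u m - real m * P\<bar> \<le> C" for m
  proof (cases "m = 0")
    case False
    have "(\<lambda>n. \<bar>u m - real m * (u n / real n)\<bar>) \<longlonglongrightarrow> \<bar>u m - real m * P\<bar>"
      by (intro tendsto_intros P)
    moreover have "(\<lambda>n. C + real m * C / real n) \<longlonglongrightarrow> C" by real_asymp
    moreover have "\<bar>u m - real m * (u n / real n)\<bar> \<le> C + real m * C / real n" if "1 \<le> n" for n
    proof -
      have "u m - real m * (u n / real n) = (real n * u m - real m * u n) / real n"
        using that by (simp add: field_simps)
      also have "\<bar>\<dots>\<bar> \<le> (real n * C + real m * C) / real n"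
        using cross[of n m] that by (simp add: divide_right_mono)
      also have "\<dots> = C + real m * C / real n" using that by (simp add: field_simps)
      finally show ?thesis .
    qed
    ultimately show ?thesis by (meson LIMSEQ_le)
  qed (use u0 C in auto)
  with P show ?thesis by blast
qed

text \<open>For s > 1/2 this is the pressure of -s log |T'|.\<close>

definition cf_pressure :: "real \<Rightarrow> real" where
  "cf_pressure s = lim (\<lambda>n. ln (enn2real (word_sum s n)) / real n)"

lemma cf_pressure:
  assumes "1/2 < s"
  shows "(\<lambda>n. ln (enn2real (word_sum s n)) / real n) \<longlonglongrightarrow> cf_pressure s"
    and "\<bar>ln (enn2real (word_sum s n)) - real n * cf_pressure s\<bar> \<le> s * ln 4"
proof -
  define z where "z n = enn2real (word_sum s n)" for n
  have z: "word_sum s n = ennreal (z n)" "0 < z n" for n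
    using word_sum_finite[OF assms, of n] word_sum_pos[of s n]
    by (auto simp: z_def enn2real_positive_iff)
  have 1: "z (m + n) \<le> z m * z n" for m n
    using word_sum_add_le[of s m n] assms z(2)[of m] z(2)[of n] by (simp add: z(1) ennreal_mult[symmetric])
  have 2: "4 powr (-s) * (z m * z n) \<le> z (m + n)" for m n
    using word_sum_add_ge[of s m n] assms z(2)[of m] z(2)[of n] z(2)[of "m + n"]
    by (simp add: z(1) ennreal_mult[symmetric])
  have "\<bar>ln (z (m + n)) - ln (z m) - ln (z n)\<bar> \<le> s * ln 4" for m n
  proof -
    have "ln (z (m + n)) \<le> ln (z m * z n)" using 1 z by simp
    then have a: "ln (z (m + n)) \<le> ln (z m) + ln (z n)" using z(2)[of m] z(2)[of n] by (simp add: ln_mult)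
    have "ln (4 powr (-s) * (z m * z n)) \<le> ln (z (m + n))" using 2 z(2) by (subst ln_le_cancel_iff) auto
    then have "- s * ln 4 + (ln (z m) + ln (z n)) \<le> ln (z (m + n))"
      using z(2)[of m] z(2)[of n] by (simp add: ln_mult ln_powr)
    with a assms show ?thesis by (simp add: abs_le_iff)
  qed
  moreover have "ln (z 0) = 0" by (simp add: z_def)
  ultimately obtain P where P: "(\<lambda>n. ln (z n) / real n) \<longlonglongrightarrow> P" "\<forall>n. \<bar>ln (z n) - real n * P\<bar> \<le> s * ln 4"
    using almost_additive_limit[of "\<lambda>n. ln (z n)" "s * ln 4"] by blast
  have "cf_pressure s = P" unfolding cf_pressure_def z_def[symmetric] using P(1) by (rule limI)
  then show "(\<lambda>n. ln (enn2real (word_sum s n)) / real n) \<longlonglongrightarrow> cf_pressure s"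
     "\<bar>ln (enn2real (word_sum s n)) - real n * cf_pressure s\<bar> \<le> s * ln 4"
    using P by (auto simp: z_def)
qed

text \<open>The bounded error of almost additivity fixes the word sums up to constants at every
  single n, as both the covers and the random construction require.\<close>

lemma word_sum_pressure_bounds:
  assumes "1/2 < s"
  shows "word_sum s n \<le> ennreal (4 powr s * exp (real n * cf_pressure s))"
    and "ennreal (4 powr (-s) * exp (real n * cf_pressure s)) \<le> word_sum s n"
proof -
  define z where "z = enn2real (word_sum s n)"
  have z: "word_sum s n = ennreal z" "0 < z"
    using word_sum_finite[OF assms, of n] word_sum_pos[of s n]
    by (auto simp: z_def enn2real_positive_iff)
  have "\<bar>ln z - real n * cf_pressure s\<bar> \<le> s * ln 4"
    using cf_pressure(2)[OF assms, of n] by (simp add: z_def)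
  then have "ln z \<le> s * ln 4 + real n * cf_pressure s" "- s * ln 4 + real n * cf_pressure s \<le> ln z"
    by (auto simp: abs_le_iff)
  then have "exp (ln z) \<le> exp (s * ln 4 + real n * cf_pressure s)"
     "exp (- s * ln 4 + real n * cf_pressure s) \<le> exp (ln z)" by auto
  then have "z \<le> 4 powr s * exp (real n * cf_pressure s)" "4 powr (-s) * exp (real n * cf_pressure s) \<le> z"
    using z by (simp_all add: powr_def exp_add[symmetric])
  then show "word_sum s n \<le> ennreal (4 powr s * exp (real n * cf_pressure s))"
    "ennreal (4 powr (-s) * exp (real n * cf_pressure s)) \<le> word_sum s n"
    unfolding z(1) by (auto intro: ennreal_leI)
qed

lemma cf_pressure_antimono:
  assumes "1/2 < s" "s \<le> t"
  shows "cf_pressure t \<le> cf_pressure s"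
proof (rule LIMSEQ_le[OF cf_pressure(1) cf_pressure(1)])
  have "enn2real (word_sum t n) \<le> enn2real (word_sum s n)" for n
    using word_sum_antimono[OF assms(2), of n] word_sum_finite[OF assms(1)] by (intro enn2real_mono) auto
  moreover have "0 < enn2real (word_sum t n)" for n
    using word_sum_finite[of t n] word_sum_pos[of t n] assms by (auto simp: enn2real_positive_iff)
  ultimately show "\<exists>N. \<forall>n\<ge>N. ln (enn2real (word_sum t n)) / real n \<le> ln (enn2real (word_sum s n)) / real n"
    by (intro exI[of _ 0] allI impI divide_right_mono) (auto intro: ln_mono less_le_trans)
qed (use assms in auto)

lemma cf_pressure_1: "cf_pressure 1 \<le> 0"
proof (rule LIMSEQ_le[OF cf_pressure(1)])
  show "(\<lambda>n. ln 2 / real n) \<longlonglongrightarrow> 0" by real_asymp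
  have "enn2real (word_sum 1 n) \<le> 2" for n
    using enn2real_mono[OF word_sum_at_1(2), of n] by simp
  moreover have "0 < enn2real (word_sum 1 n)" for n
    using word_sum_finite[of 1 n] word_sum_pos[of 1 n] by (auto simp: enn2real_positive_iff)
  ultimately show "\<exists>N. \<forall>n\<ge>N. ln (enn2real (word_sum 1 n)) / real n \<le> ln 2 / real n"
    by (intro exI[of _ 0] allI impI divide_right_mono) (auto intro: ln_mono)
qed auto

section \<open>The Gauss pressure in terms of word sums\<close>

lemma deriv_gauss_map:
  assumes "x \<in> irrationals01"
  shows "deriv gauss_map x = - 1 / x\<^sup>2"
proof (rule DERIV_imp_deriv)
  have x: "0 < x" "x < 1" "x \<notin> \<rat>" using assms by (auto simp: irrationals01_iff)
  define k where "k = \<lfloor>1 / x\<rfloor>"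
  have "1 / x \<notin> \<int>"
  proof
    assume "1 / x \<in> \<int>"
    then have "inverse (1 / x) \<in> \<rat>" using Ints_subset_Rats by (intro Rats_inverse) auto
    then show False using x by simp
  qed
  then have k: "of_int k < 1 / x" "1 / x < of_int k + 1"
    unfolding k_def by (metis Ints_of_int floor_correct order_le_less, linarith)
  have "\<forall>\<^sub>F y in nhds x. 1 / y - of_int k = gauss_map y"
  proof -
    have lim: "((\<lambda>y. 1 / y) \<longlongrightarrow> 1 / x) (nhds x)" using x by (intro tendsto_intros) (auto simp: filterlim_ident)
    have "\<forall>\<^sub>F y in nhds x. of_int k < 1 / y" "\<forall>\<^sub>F y in nhds x. 1 / y < of_int k + 1"
      using order_tendstoD[OF lim] k by auto
    then show ?thesis
    proof eventually_elim
      case (elim y)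
      then have "\<lfloor>1 / y\<rfloor> = k" by linarith
      \<comment> \<open>Since \<open>1 / 0 = 0\<close>, the point y = 0 would give k = 0 and violate
        \<open>of_int k < 1 / y\<close>; it has to be excluded because \<open>gauss_map\<close>
        treats 0 separately.\<close>
      moreover have "y \<noteq> 0"
      proof
        assume "y = 0"
        then have "k = 0" using \<open>\<lfloor>1 / y\<rfloor> = k\<close> by simp
        then show False using elim(1) \<open>y = 0\<close> by simp
      qed
      ultimately show ?case by (simp add: gauss_map_def frac_def)
    qed
  qed
  moreover have "((\<lambda>y. 1 / y - of_int k) has_real_derivative - 1 / x\<^sup>2) (at x)"
    using x by (auto intro!: derivative_eq_intros simp: power2_eq_square)
  ultimately show "(gauss_map has_real_derivative - 1 / x\<^sup>2) (at x)"
    by (subst DERIV_cong_ev[OF refl _ refl, symmetric]) (auto simp: eventually_mono)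
qed

text \<open>The chain rule in logarithmic form: the points of the orbit multiply to the inverse of
  the denominator.\<close>

lemma sum_ln_cf_branch:
  assumes "pos_word w" "x \<in> irrationals01"
  shows "(\<Sum>i<length w. ln (cf_branch (drop i w) x)) = - ln (cf_den w x)"
  using assms(1)
proof (induction w)
  case (Cons a w)
  have "cf_branch (a # w) x \<in> irrationals01" using Cons assms by (intro cf_branch_irrational) auto
  then have p: "0 < cf_branch (a # w) x" by (simp add: irrationals01_iff)
  then have p': "0 < real a + cf_branch w x" by (simp add: zero_less_divide_iff)
  have q: "1 \<le> cf_den w x" using Cons assms by (intro cf_den_ge_1) (auto simp: irrationals01_iff)
  have "(\<Sum>i<length (a # w). ln (cf_branch (drop i (a # w)) x)) = ln (cf_branch (a # w) x) + - ln (cf_den w x)"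
    using Cons by (simp add: lessThan_Suc_eq_insert_0 sum.reindex del: cf_branch.simps)
  then show ?case using p' q by (simp add: ln_div ln_mult)
qed simp

lemma exp_birkhoff_sum:
  assumes "w \<in> words n" "x \<in> irrationals01"
  shows "exp (birkhoff_sum gauss_map (\<lambda>x. - c * L - s * ln \<bar>deriv gauss_map x\<bar>) n (cf_branch w x))
    = exp (- real n * (c * L)) * cf_den w x powr (-2 * s)"
proof -
  have w: "pos_word w" "length w = n" using assms by (auto simp: words_def)
  have x: "0 < x" "x < 1" using assms by (auto simp: irrationals01_iff)
  have "birkhoff_sum gauss_map (\<lambda>x. - c * L - s * ln \<bar>deriv gauss_map x\<bar>) n (cf_branch w x)
    = (\<Sum>i<n. - c * L + 2 * s * ln (cf_branch (drop i w) x))"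
    unfolding birkhoff_sum_def
  proof (rule sum.cong)
    fix i assume "i \<in> {..<n}"
    then have i: "i \<le> length w" using w by simp
    have "pos_word (drop i w)" using w by (auto simp: pos_word_def dest: in_set_dropD)
    then have irr: "cf_branch (drop i w) x \<in> irrationals01" using assms by (intro cf_branch_irrational)
    then have "ln \<bar>deriv gauss_map (cf_branch (drop i w) x)\<bar> = - 2 * ln (cf_branch (drop i w) x)"
      by (simp add: deriv_gauss_map ln_div irrationals01_iff ln_realpow)
    then show "- c * L - s * ln \<bar>deriv gauss_map ((gauss_map ^^ i) (cf_branch w x))\<bar>
      = - c * L + 2 * s * ln (cf_branch (drop i w) x)"
      unfolding gauss_iterate_cf_branch[OF w(1) x i] by simp
  qed simp
  also have "\<dots> = - real n * (c * L) + 2 * s * (\<Sum>i<length w. ln (cf_branch (drop i w) x))"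
    by (simp add: sum_subtractf sum_distrib_left w)
  also have "\<dots> = - real n * (c * L) + - 2 * s * ln (cf_den w x)"
    unfolding sum_ln_cf_branch[OF w(1) assms(2)] by simp
  finally show ?thesis
    using cf_den_ge_1[of w x] w x by (simp only: exp_add powr_def) auto
qed

lemma irrationals01_nonempty: "irrationals01 \<noteq> {}"
proof -
  have "uncountable ({0<..<1::real})" by (simp add: uncountable_open_interval)
  then have "\<not> {0<..<1::real} \<subseteq> \<rat>" using countable_rat countable_subset by blast
  then obtain x :: real where "x \<in> {0<..<1}" "x \<notin> \<rat>" by blast
  then have "x \<in> irrationals01" by (auto simp: irrationals01_iff)
  then show ?thesis by blast
qed

text \<open>Within a cylinder the denominators differ at most by a factor 2, so the supremum over x
  may be replaced by x = 0 at the cost of \<open>4 powr (-s)\<close>, which disappears in the limit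
  of logarithms over n.\<close>

lemma gauss_partition_bounds:
  fixes c L s :: real
  assumes "0 \<le> s"
  defines "S \<equiv> \<lambda>n. (\<Sum>\<^sub>\<infinity>as\<in>{as :: nat list. length as = n \<and> (\<forall>a\<in>set as. 1 \<le> a)}.
          SUP x\<in>irrationals01. ennreal (exp (birkhoff_sum gauss_map
             (\<lambda>x. - c * L - s * ln \<bar>deriv gauss_map x\<bar>) n (cf_branch as x))))"
  shows "S n \<le> ennreal (exp (- real n * (c * L))) * word_sum s n"
    and "ennreal (4 powr (-s)) * (ennreal (exp (- real n * (c * L))) * word_sum s n) \<le> S n"
proof -
  define E where "E = exp (- real n * (c * L))"
  have S: "S n = (\<integral>\<^sup>+ w. (SUP x\<in>irrationals01. ennreal (E * cf_den w x powr (-2 * s))) \<partial>count_space (words n))"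
  proof -
    have "{as :: nat list. length as = n \<and> (\<forall>a\<in>set as. 1 \<le> a)} = words n"
      by (auto simp: words_def pos_word_def)
    then show ?thesis
      unfolding S_def E_def infsum_ennreal_eq_nn_integral[OF countable_nat_list_set]
      by (auto intro!: nn_integral_cong SUP_cong simp only: exp_birkhoff_sum space_count_space)
  qed
  obtain x0 where x0: "x0 \<in> irrationals01" using irrationals01_nonempty by blast
  have b: "E * cf_den w x powr (-2 * s) \<le> E * cf_den w 0 powr (-2 * s)"
     "4 powr (-s) * (E * cf_den w 0 powr (-2 * s)) \<le> E * cf_den w x powr (-2 * s)"
    if "w \<in> words n" "x \<in> irrationals01" for w x
  proof -
    have x: "0 \<le> x" "x \<le> 1" "pos_word w" using that by (auto simp: irrationals01_iff words_def)
    have q: "1 \<le> cf_den w 0" "1 \<le> cf_den w x" using cf_den_ge_1 x by auto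
    show "E * cf_den w x powr (-2 * s) \<le> E * cf_den w 0 powr (-2 * s)"
      using cf_den_bounds(1)[OF x(3,1,2)] q assms(1)
      by (intro mult_left_mono powr_mono2') (auto simp: E_def)
    have "(2 * cf_den w 0) powr (-2 * s) \<le> cf_den w x powr (-2 * s)"
      using cf_den_bounds(2)[OF x(3,1,2)] q assms(1) by (intro powr_mono2') auto
    moreover have "(2::real) powr (-2 * s) = 4 powr (-s)"
      using powr_powr[of 2 2 "-s"] by simp
    ultimately have "4 powr (-s) * cf_den w 0 powr (-2 * s) \<le> cf_den w x powr (-2 * s)"
      by (simp add: powr_mult)
    then have "E * (4 powr (-s) * cf_den w 0 powr (-2 * s)) \<le> E * cf_den w x powr (-2 * s)"
      by (intro mult_left_mono) (auto simp: E_def)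
    then show "4 powr (-s) * (E * cf_den w 0 powr (-2 * s)) \<le> E * cf_den w x powr (-2 * s)"
      by (simp add: mult_ac)
  qed
  have W: "ennreal E * word_sum s n = (\<integral>\<^sup>+ w. ennreal (E * cf_den w 0 powr (-2 * s)) \<partial>count_space (words n))"
    unfolding word_sum_def by (subst nn_integral_cmult[symmetric]) (auto simp: ennreal_mult E_def)
  show "S n \<le> ennreal (exp (- real n * (c * L))) * word_sum s n"
    unfolding E_def[symmetric] S W using b(1) by (intro nn_integral_mono SUP_least ennreal_leI) auto
  have "ennreal (4 powr (-s)) * (\<integral>\<^sup>+ w. ennreal (E * cf_den w 0 powr (-2 * s)) \<partial>count_space (words n))
     = (\<integral>\<^sup>+ w. ennreal (4 powr (-s) * (E * cf_den w 0 powr (-2 * s))) \<partial>count_space (words n))"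
    by (subst nn_integral_cmult[symmetric]) (auto simp: ennreal_mult E_def)
  also have "\<dots> \<le> S n"
    unfolding S using b(2)[OF _ x0] x0 by (intro nn_integral_mono SUP_upper2[OF x0] ennreal_leI) auto
  finally show "ennreal (4 powr (-s)) * (ennreal (exp (- real n * (c * L))) * word_sum s n) \<le> S n"
    unfolding E_def[symmetric] W .
qed

lemma gauss_pressure_finite:
  assumes "1/2 < s"
  shows "gauss_pressure (\<lambda>x. - c * L - s * ln \<bar>deriv gauss_map x\<bar>) = ereal (cf_pressure s - c * L)"
  unfolding gauss_pressure_def
proof (rule limI)
  define S where "S n = (\<Sum>\<^sub>\<infinity>as\<in>{as :: nat list. length as = n \<and> (\<forall>a\<in>set as. 1 \<le> a)}.
          SUP x\<in>irrationals01. ennreal (exp (birkhoff_sum gauss_map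
             (\<lambda>x. - c * L - s * ln \<bar>deriv gauss_map x\<bar>) n (cf_branch as x))))" for n
  define z where "z n = enn2real (word_sum s n)" for n
  have z: "word_sum s n = ennreal (z n)" "0 < z n" for n
    using word_sum_finite[OF assms, of n] word_sum_pos[of s n]
    by (auto simp: z_def enn2real_positive_iff)
  define E where "E n = exp (- real n * (c * L))" for n
  have E: "0 < E n" for n by (simp add: E_def)
  have b: "S n \<le> ennreal (E n * z n)" "ennreal (4 powr (-s) * (E n * z n)) \<le> S n" for n
  proof -
    have "S n \<le> ennreal (E n) * word_sum s n"
      "ennreal (4 powr (-s)) * (ennreal (E n) * word_sum s n) \<le> S n"
      unfolding S_def E_def using assms by (intro gauss_partition_bounds; simp)+
    then show "S n \<le> ennreal (E n * z n)" "ennreal (4 powr (-s) * (E n * z n)) \<le> S n"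
      using z(2)[of n] E[of n] by (simp_all add: z(1) ennreal_mult)
  qed
  define t where "t n = enn2real (S n)" for n
  have t: "S n = ennreal (t n)" "0 < t n" "t n \<le> E n * z n" "4 powr (-s) * (E n * z n) \<le> t n" for n
  proof -
    have fin: "S n < \<top>" using b(1)[of n] by (rule order.strict_trans1) simp
    then show S: "S n = ennreal (t n)" by (simp add: t_def)
    have pos: "0 < 4 powr (-s) * (E n * z n)" using E[of n] z(2)[of n] by simp
    show le: "4 powr (-s) * (E n * z n) \<le> t n"
      using b(2)[of n] pos unfolding S by (simp add: t_def ennreal_le_iff)
    with pos show "0 < t n" by linarith
    show "t n \<le> E n * z n" using b(1)[of n] E[of n] z(2)[of n] unfolding S by (simp add: ennreal_le_iff)
  qed
  have ln_t: "ln (z n) / real n - c * L + - s * ln 4 / real n \<le> ln (t n) / real n"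
      "ln (t n) / real n \<le> ln (z n) / real n - c * L" if "1 \<le> n" for n
  proof -
    have "ln (t n) \<le> ln (E n * z n)" using t(2)[of n] t(3)[of n] by (intro ln_mono) auto
    then have 1: "ln (t n) \<le> - real n * (c * L) + ln (z n)"
      using E z(2)[of n] by (simp add: ln_mult E_def)
    have "ln (4 powr (-s) * (E n * z n)) \<le> ln (t n)" using t(2)[of n] t(4)[of n] E[of n] z(2)[of n] by (subst ln_le_cancel_iff) auto
    then have 2: "- s * ln 4 - real n * (c * L) + ln (z n) \<le> ln (t n)"
      using E z(2)[of n] by (simp add: ln_mult E_def ln_powr)
    show "ln (t n) / real n \<le> ln (z n) / real n - c * L"
      "ln (z n) / real n - c * L + - s * ln 4 / real n \<le> ln (t n) / real n"
    proof -
      have n: "real n \<noteq> 0" using that by simp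
      have "ln (z n) / real n - c * L = (- real n * (c * L) + ln (z n)) / real n"
        using n by (simp add: add_divide_distrib diff_divide_distrib)
      then show "ln (t n) / real n \<le> ln (z n) / real n - c * L"
        using divide_right_mono[OF 1, of "real n"] by simp
      have "ln (z n) / real n - c * L + - s * ln 4 / real n
        = (- s * ln 4 - real n * (c * L) + ln (z n)) / real n"
        using n by (simp add: add_divide_distrib diff_divide_distrib)
      then show "ln (z n) / real n - c * L + - s * ln 4 / real n \<le> ln (t n) / real n"
        using divide_right_mono[OF 2, of "real n"] by simp
    qed
  qed
  have zl: "(\<lambda>n. ln (z n) / real n) \<longlonglongrightarrow> cf_pressure s"
    using cf_pressure(1)[OF assms] by (simp add: z_def)
  have "(\<lambda>n. ln (t n) / real n) \<longlonglongrightarrow> cf_pressure s - c * L"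
  proof (rule tendsto_sandwich)
    show "\<forall>\<^sub>F n in sequentially. ln (z n) / real n - c * L + - s * ln 4 / real n \<le> ln (t n) / real n"
      using ln_t by (intro eventually_sequentiallyI[of 1])
    show "\<forall>\<^sub>F n in sequentially. ln (t n) / real n \<le> ln (z n) / real n - c * L"
      using ln_t by (intro eventually_sequentiallyI[of 1])
    have "(\<lambda>n. - s * ln 4 / real n) \<longlonglongrightarrow> 0" by real_asymp
    from tendsto_add[OF tendsto_diff[OF zl tendsto_const[of "c * L"]] this]
    show "(\<lambda>n. ln (z n) / real n - c * L + - s * ln 4 / real n) \<longlonglongrightarrow> cf_pressure s - c * L" by simp
    show "(\<lambda>n. ln (z n) / real n - c * L) \<longlonglongrightarrow> cf_pressure s - c * L"
      by (intro tendsto_intros zl)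
  qed
  then have lim: "(\<lambda>n. ereal (ln (t n) / real n)) \<longlonglongrightarrow> ereal (cf_pressure s - c * L)" by simp
  have eq: "ln_ennreal (S n) / ereal (real n) = ereal (ln (t n) / real n)" if "1 \<le> n" for n
    using t(1,2)[of n] that by (simp add: ln_ennreal_def)
  show "(\<lambda>n. ln_ennreal (S n) / ereal (real n)) \<longlonglongrightarrow> ereal (cf_pressure s - c * L)"
    by (rule Lim_transform_eventually[OF lim], rule eventually_sequentiallyI[of 1]) (simp only: eq)
qed

lemma gauss_pressure_infinite:
  assumes "0 \<le> s" "s \<le> 1/2"
  shows "gauss_pressure (\<lambda>x. - c * L - s * ln \<bar>deriv gauss_map x\<bar>) = \<infinity>"
  unfolding gauss_pressure_def
proof (rule limI)
  define S where "S n = (\<Sum>\<^sub>\<infinity>as\<in>{as :: nat list. length as = n \<and> (\<forall>a\<in>set as. 1 \<le> a)}.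
          SUP x\<in>irrationals01. ennreal (exp (birkhoff_sum gauss_map
             (\<lambda>x. - c * L - s * ln \<bar>deriv gauss_map x\<bar>) n (cf_branch as x))))" for n
  have "ln_ennreal (S n) / ereal (real n) = \<infinity>" if "1 \<le> n" for n
  proof -
    have "ennreal (4 powr (-s)) * (ennreal (exp (- real n * (c * L))) * word_sum s n) \<le> S n"
      using gauss_partition_bounds(2)[where s = s and n = n and c = c and L = L] assms by (simp add: S_def)
    then have "S n = \<top>"
      using word_sum_infinite[OF assms that] by (simp add: ennreal_mult_top top_unique)
    then show ?thesis using that by (simp add: ln_ennreal_def)
  qed
  then show "(\<lambda>n. ln_ennreal (S n) / ereal (real n)) \<longlonglongrightarrow> \<infinity>"
    by (intro tendsto_eventually eventually_sequentiallyI[of 1])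
qed

text \<open>For s \<le> 1/2 the pressure is \<infinity>, so such s are never admissible; beyond 1/2
  the condition is an inequality between real numbers.\<close>

lemma s_B_eq:
  "s_B B = Inf {ereal s | s. 1/2 < s \<and> cf_pressure s \<le> (3 * s - 1 - s\<^sup>2) * ln B}"
proof -
  have "0 \<le> s \<and> gauss_pressure (\<lambda>x. - (3 * s - 1 - s\<^sup>2) * ln B - s * ln \<bar>deriv gauss_map x\<bar>) \<le> 0
     \<longleftrightarrow> 1/2 < s \<and> cf_pressure s \<le> (3 * s - 1 - s\<^sup>2) * ln B" for s
    using gauss_pressure_infinite[of s "3 * s - 1 - s\<^sup>2" "ln B"] gauss_pressure_finite[of s "3 * s - 1 - s\<^sup>2" "ln B"]
    by (cases "s \<le> 1/2") auto
  then show ?thesis unfolding s_B_def by simp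
qed

section \<open>Covers for rapidly growing thresholds\<close>

definition tail_cylinder :: "nat list \<Rightarrow> real \<Rightarrow> real set" where
  "tail_cylinder w t = {x \<in> irrationals01. cf_digits (length w) x = w \<and>
     t \<le> real (partial_quotient (Suc (length w)) x)}"

lemma tail_cylinderI:
  assumes "x \<in> irrationals01" "w = cf_digits n x" "t \<le> real (partial_quotient (Suc n) x)"
  shows "x \<in> tail_cylinder w t"
  using assms by (auto simp: tail_cylinder_def)

text \<open>After removal of w the points lie in an interval of length 1 / t at 0, which the branch
  of w contracts by at least q^2.\<close>

lemma content_tail_cylinder:
  assumes "0 < s" "0 < t" "pos_word w"
  shows "hausdorff_content s (tail_cylinder w t) \<le> ennreal (cf_den w 0 powr (-2 * s) * t powr (-s))"
proof -
  define q where "q = cf_den w 0"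
  have q: "1 \<le> q" using cf_den_ge_1[of w 0] assms by (simp add: q_def)
  have "hausdorff_content s (tail_cylinder w t) \<le> ennreal ((1 / t / q\<^sup>2) powr s)"
  proof (rule hausdorff_content_diam)
    fix x y assume xy: "x \<in> tail_cylinder w t" "y \<in> tail_cylinder w t"
    define n where "n = length w"
    have irr: "x \<in> irrationals01" "y \<in> irrationals01" and w: "cf_digits n x = w" "cf_digits n y = w"
      using xy by (auto simp: tail_cylinder_def n_def)
    define x' y' where "x' = (gauss_map ^^ n) x" and "y' = (gauss_map ^^ n) y"
    have b: "0 < x'" "x' < 1" "0 < y'" "y' < 1"
      using gauss_iterate_irrational irr by (auto simp: irrationals01_iff x'_def y'_def)
    have "1 / real a \<le> 1 / t" if "t \<le> real a" for a
      using that assms(2) by (intro divide_left_mono) auto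
    then have "x' \<le> 1 / t" "y' \<le> 1 / t"
      using gauss_iterate_le[OF irr(1), of n] gauss_iterate_le[OF irr(2), of n] xy
      unfolding tail_cylinder_def n_def x'_def y'_def by (blast intro: order_trans)+
    then have "\<bar>x' - y'\<bar> \<le> 1 / t" using b by linarith
    then have "\<bar>x' - y'\<bar> / q\<^sup>2 \<le> 1 / t / q\<^sup>2" by (rule divide_right_mono) simp
    moreover have "dist x y = \<bar>cf_branch w x' - cf_branch w y'\<bar>"
      using cf_branch_cf_digits[OF irr(1), of n] cf_branch_cf_digits[OF irr(2), of n]
      by (simp add: w x'_def y'_def dist_real_def)
    moreover have "\<bar>cf_branch w x' - cf_branch w y'\<bar> \<le> \<bar>x' - y'\<bar> / q\<^sup>2"
      unfolding q_def using b assms by (intro cf_branch_diff_le) auto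
    ultimately show "dist x y \<le> 1 / t / q\<^sup>2"
      by linarith
  qed (use assms q in auto)
  also have "(1 / t / q\<^sup>2) powr s = q powr (-2 * s) * t powr (-s)"
  proof -
    have "1 / t / q\<^sup>2 = q powr (-2) * t powr (-1)"
    proof -
      have "q powr (-2) = inverse (q powr 2)" by (rule powr_minus)
      then have "q powr (-2) = 1 / q\<^sup>2" using q by (simp add: inverse_eq_divide)
      moreover have "t powr (-1) = 1 / t" using assms by (simp add: powr_neg_one)
      ultimately show ?thesis by simp
    qed
    then show ?thesis by (simp only: powr_mult powr_powr) simp
  qed
  finally show ?thesis by (simp add: q_def)
qed

text \<open>The prefix keeps its continuant, needed for the pressure, while p enters only through
  the product of its digits, so that sums over p factorise.\<close>

lemma content_tail_cylinder_append:
  assumes "0 < s" "0 < t" "pos_word w" "pos_word p"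
  shows "hausdorff_content s (tail_cylinder (w @ p) t)
     \<le> ennreal (cf_den w 0 powr (-2 * s) * (real (prod_list p) powr (-2 * s) * t powr (-s)))"
proof -
  have "1 \<le> prod_list p" using assms(4) by (induction p) auto
  then have p: "1 \<le> real (prod_list p)" by simp
  have q: "1 \<le> cf_den w 0" using cf_den_ge_1[of w 0] assms by simp
  have "cf_den w 0 * real (prod_list p) \<le> cf_den w 0 * cf_den p 0"
    using prod_list_le_cf_den[OF assms(4)] q by (intro mult_left_mono) auto
  also have "\<dots> \<le> cf_den (w @ p) 0" using assms by (intro cf_den_append_bounds)
  finally have "cf_den (w @ p) 0 powr (-2 * s) \<le> (cf_den w 0 * real (prod_list p)) powr (-2 * s)"
    using p q assms by (intro powr_mono2') auto
  from mult_right_mono[OF this, of "t powr (-s)"]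
  have "cf_den (w @ p) 0 powr (-2 * s) * t powr (-s)
     \<le> cf_den w 0 powr (-2 * s) * (real (prod_list p) powr (-2 * s) * t powr (-s))"
    by (simp add: powr_mult mult.assoc)
  then show ?thesis
    using content_tail_cylinder[of s t "w @ p"] assms by (auto intro: order_trans ennreal_leI)
qed

lemma cf_digits_words: "x \<in> irrationals01 \<Longrightarrow> cf_digits n x \<in> words n"
  using pos_word_cf_digits by (simp add: words_def)

lemma content_words_le:
  assumes "\<And>x. x \<in> A \<Longrightarrow> x \<in> irrationals01" "\<And>x. x \<in> A \<Longrightarrow> x \<in> S (cf_digits n x)"
  shows "hausdorff_content s A \<le> (\<integral>\<^sup>+ w. hausdorff_content s (S w) \<partial>count_space (words n))"
proof -
  have "A \<subseteq> (\<Union>w\<in>words n. S w)" using assms cf_digits_words by blast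
  then have "hausdorff_content s A \<le> hausdorff_content s (\<Union>w\<in>words n. S w)"
    by (rule hausdorff_content_mono)
  also have "\<dots> \<le> (\<integral>\<^sup>+ w. hausdorff_content s (S w) \<partial>count_space (words n))"
    by (rule hausdorff_content_UN_count_space_le) simp
  finally show ?thesis .
qed

lemma prod_list_ge_1: "pos_word w \<Longrightarrow> 1 \<le> prod_list w"
  by (induction w) auto

lemma prod_list_cf_digits_pos: "x \<in> irrationals01 \<Longrightarrow> 1 \<le> prod_list (cf_digits n x)"
  by (intro prod_list_ge_1 pos_word_cf_digits)

text \<open>The sum of \<open>(a\<^sub>1 \<cdots> a\<^sub>n) powr -(s (1 + c))\<close> over all words of length \<open>n\<close> grows only exponentially
  in \<open>n\<close>, hence is beaten by the factor \<open>G powr (-s n)\<close> for large \<open>G\<close>.\<close>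

lemma content_superexponential_jumps:
  assumes s: "0 < s" "1 < s * (1 + c)"
    and E: "\<And>x. x \<in> E \<Longrightarrow> x \<in> irrationals01"
    and jump: "\<And>x G. x \<in> E \<Longrightarrow> 1 \<le> G \<Longrightarrow>
       \<exists>\<^sub>\<infinity>n. G ^ n * real (prod_list (cf_digits n x)) powr (c - 1) \<le> real (partial_quotient (Suc n) x)"
  shows "hausdorff_content s E = 0"
proof -
  define z where "z = enn2real (digit_sum (s * (1 + c)))"
  have z: "digit_sum (s * (1 + c)) = ennreal z" using digit_sum_finite[OF s(2)] by (simp add: z_def)
  have z1: "1 \<le> z" using digit_sum_ge_1[of "s * (1 + c)"] unfolding z by simp
  \<comment> \<open>Chosen so that \<open>G powr (-s) = 1 / (2 * z)\<close>: against the z^n of the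
    digit sums the n-th cover then costs at most 2^(-n).\<close>
  define G where "G = (2 * z) powr (1 / s)"
  have G1: "1 \<le> G" unfolding G_def using z1 s by (intro ge_one_powr_ge_zero) auto
  have Gs: "G powr (-s) = 1 / (2 * z)" using z1 s by (simp add: G_def powr_powr powr_minus divide_simps)
  define t where "t n w = G ^ n * real (prod_list w) powr (c - 1)" for n and w :: "nat list"
  define A where "A n = {x \<in> irrationals01. t n (cf_digits n x) \<le> real (partial_quotient (Suc n) x)}" for n
  have "hausdorff_content s (A n) \<le> ennreal ((1/2) ^ n)" for n
  proof -
    have "hausdorff_content s (A n) \<le> (\<integral>\<^sup>+ w. hausdorff_content s (tail_cylinder w (t n w)) \<partial>count_space (words n))"
      by (rule content_words_le) (auto simp: A_def intro: tail_cylinderI)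
    also have "\<dots> \<le> (\<integral>\<^sup>+ w. ennreal ((G powr (-s)) ^ n) * ennreal (real (prod_list w) powr (- (s * (1 + c)))) \<partial>count_space (words n))"
    proof (intro nn_integral_mono)
      fix w assume "w \<in> space (count_space (words n))"
      then have w: "pos_word w" "length w = n" by (auto simp: words_def)
      have p: "1 \<le> real (prod_list w)" using prod_list_ge_1[OF w(1)] by simp
      have t: "0 < t n w" using G1 p by (auto simp: t_def)
      have "hausdorff_content s (tail_cylinder ([] @ w) (t n w))
        \<le> ennreal (cf_den [] 0 powr (-2 * s) * (real (prod_list w) powr (-2 * s) * t n w powr (-s)))"
        using s t w by (intro content_tail_cylinder_append) auto
      also have "cf_den [] 0 powr (-2 * s) * (real (prod_list w) powr (-2 * s) * t n w powr (-s))
          = (G powr (-s)) ^ n * real (prod_list w) powr (- (s * (1 + c)))"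
      proof -
        have "(G ^ n) powr (-s) = (G powr (-s)) ^ n"
        proof -
          have "(G ^ n) powr (-s) = (G powr real n) powr (-s)" using G1 by (simp add: powr_realpow)
          also have "\<dots> = (G powr (-s)) powr real n" by (simp add: powr_powr mult.commute)
          also have "\<dots> = (G powr (-s)) ^ n" using G1 by (intro powr_realpow) auto
          finally show ?thesis .
        qed
        \<comment> \<open>The cylinder contributes -2 s and the threshold -s (c - 1); the total -s
          (1 + c) is below -1, hence summable over each digit.\<close>
        moreover have "real (prod_list w) powr (-2 * s) * (real (prod_list w) powr (c - 1)) powr (-s)
           = real (prod_list w) powr (- (s * (1 + c)))"
          by (simp add: powr_powr powr_add[symmetric] algebra_simps)
        ultimately show ?thesis by (simp add: t_def powr_mult mult_ac)
      qed
      finally show "hausdorff_content s (tail_cylinder w (t n w))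
         \<le> ennreal ((G powr (-s)) ^ n) * ennreal (real (prod_list w) powr (- (s * (1 + c))))"
        by (simp add: ennreal_mult)
    qed
    also have "\<dots> = ennreal ((G powr (-s)) ^ n) * ennreal z ^ n"
      by (simp add: nn_integral_cmult nn_integral_prod_list_words z)
    also have "\<dots> = ennreal ((1/2) ^ n)"
      using z1 by (simp add: Gs ennreal_power ennreal_mult[symmetric] power_mult_distrib[symmetric])
    finally show ?thesis .
  qed
  then have "(\<Sum>n. hausdorff_content s (A n)) \<le> (\<Sum>n. ennreal ((1/2) ^ n))"
    by (intro suminf_le) auto
  also have "\<dots> = ennreal (\<Sum>n. (1/2) ^ n)" by (intro suminf_ennreal2) auto
  also have "\<dots> < \<top>" by simp
  finally have fin: "(\<Sum>n. hausdorff_content s (A n)) < \<top>" .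
  have "E \<subseteq> {x. \<exists>\<^sub>\<infinity>n. x \<in> A n}"
    using jump[OF _ G1] E by (auto simp: A_def t_def)
  then show ?thesis using fin by (rule hausdorff_content_limsup)
qed

lemma prod_list_cf_digits_mono:
  assumes "x \<in> irrationals01" "m \<le> n"
  shows "prod_list (cf_digits m x) \<le> prod_list (cf_digits n x)"
  using assms(2)
proof (induction rule: dec_induct)
  case (step n)
  have "prod_list (cf_digits n x) * 1 \<le> prod_list (cf_digits n x) * partial_quotient (Suc n) x"
    by (intro mult_le_mono2 partial_quotient_pos assms)
  then have "prod_list (cf_digits n x) \<le> prod_list (cf_digits (Suc n) x)"
    unfolding cf_digits_Suc by (simp only: prod_list.append prod_list.Cons prod_list.Nil mult_1_right)
  with step show ?case by simp
qed simp

lemma prod_two_digits_le: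
  assumes "x \<in> irrationals01" "1 \<le> k"
  shows "partial_quotient k x * partial_quotient (k + 1) x \<le> prod_list (cf_digits (k + 1) x)"
proof -
  obtain j where j: "k = Suc j" using assms(2) by (cases k) auto
  have "1 * (partial_quotient k x * partial_quotient (k + 1) x)
      \<le> prod_list (cf_digits j x) * (partial_quotient k x * partial_quotient (k + 1) x)"
    using prod_list_cf_digits_pos[OF assms(1)] by (intro mult_right_mono) auto
  then show ?thesis by (simp add: j cf_digits_Suc mult.assoc)
qed

text \<open>Suppose the jumps stop after N. The logarithms of the digit products then satisfy u(n +
  1) \<le> c u(n) + n ln G and stay below every supersolution h that starts above them. A product of
  two adjacent digits is at most the full digit product, hence at most exp (h (n + 1)) < \<phi> n,
  which contradicts membership.\<close>

lemma content_F2_superexponential: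
  assumes s: "0 < s" "1 < s * (1 + c)"  and c: "0 < c"
    and h: "\<And>G N K. 1 \<le> G \<Longrightarrow> \<exists>h::nat \<Rightarrow> real. K \<le> h N \<and> (\<forall>n\<ge>N. c * h n + real n * ln G \<le> h (Suc n)) \<and>
       (\<forall>\<^sub>F n in sequentially. exp (h (Suc n)) < \<phi> n)"
  shows "hausdorff_content s (F2_set \<phi>) = 0"
proof (rule content_superexponential_jumps[OF s])
  show "x \<in> F2_set \<phi> \<Longrightarrow> x \<in> irrationals01" for x by (simp add: F2_set_def)
  fix x G assume x: "x \<in> F2_set \<phi>" and G: "1 \<le> (G::real)"
  define p where "p n = real (prod_list (cf_digits n x))" for n
  have irr: "x \<in> irrationals01" using x by (simp add: F2_set_def)
  have p1: "1 \<le> p n" for n using prod_list_cf_digits_pos[OF irr, of n] by (simp add: p_def)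
  show "\<exists>\<^sub>\<infinity>n. G ^ n * real (prod_list (cf_digits n x)) powr (c - 1) \<le> real (partial_quotient (Suc n) x)"
  proof (rule ccontr)
    assume "\<not> ?thesis"
    then have "\<forall>\<^sub>\<infinity>n. real (partial_quotient (Suc n) x) < G ^ n * p n powr (c - 1)"
      by (simp add: not_INFM not_le p_def)
    then obtain N where N: "\<And>n. N \<le> n \<Longrightarrow> real (partial_quotient (Suc n) x) < G ^ n * p n powr (c - 1)"
      by (auto simp: MOST_nat_le)
    obtain h where h: "ln (p N) \<le> h N" "\<And>n. N \<le> n \<Longrightarrow> c * h n + real n * ln G \<le> h (Suc n)"
       "\<forall>\<^sub>F n in sequentially. exp (h (Suc n)) < \<phi> n"
      using h[OF G, of "ln (p N)" N] by auto
    have le: "ln (p n) \<le> h n" if "N \<le> n" for n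
      using that
    proof (induction rule: dec_induct)
      case (step n)
      have pos: "0 < partial_quotient (Suc n) x" using partial_quotient_pos[OF irr, of "Suc n"] by simp
      have "p (Suc n) = p n * real (partial_quotient (Suc n) x)" by (simp add: p_def cf_digits_Suc)
      also have "\<dots> \<le> p n * (G ^ n * p n powr (c - 1))"
        using N[OF step(1)] p1[of n] by (intro mult_left_mono) auto
      also have "\<dots> = G ^ n * p n powr c"
        using p1[of n] powr_add[of "p n" 1 "c - 1"] by simp
      finally have "ln (p (Suc n)) \<le> ln (G ^ n * p n powr c)" using p1[of "Suc n"] by (intro ln_mono) auto
      also have "\<dots> = real n * ln G + c * ln (p n)"
        using G p1[of n] by (simp add: ln_mult ln_realpow ln_powr)
      also have "\<dots> \<le> c * h n + real n * ln G" using step c by simp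
      also have "\<dots> \<le> h (Suc n)" using step by (intro h(2)) auto
      finally show ?case .
    qed (use h in auto)
    have "\<forall>\<^sub>F n in sequentially. N \<le> n \<and> exp (h (Suc n)) < \<phi> n"
      using h(3) eventually_ge_at_top[of N] by eventually_elim auto
    then obtain N' where N': "\<And>n. N' \<le> n \<Longrightarrow> N \<le> n \<and> exp (h (Suc n)) < \<phi> n"
      by (auto simp: eventually_sequentially)
    from x have "\<exists>n\<ge>N'. \<exists>k\<in>{1..n}. \<exists>l\<in>{1..n}. k \<noteq> l \<and>
       \<phi> n \<le> real (partial_quotient k x * partial_quotient (k + 1) x) \<and>
       \<phi> n \<le> real (partial_quotient l x * partial_quotient (l + 1) x)"
      unfolding F2_set_def INFM_nat_le by blast
    then obtain n k where n: "N' \<le> n" "k \<in> {1..n}"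
       "\<phi> n \<le> real (partial_quotient k x * partial_quotient (k + 1) x)"
      by blast
    have "partial_quotient k x * partial_quotient (k + 1) x \<le> prod_list (cf_digits (k + 1) x)"
      using irr n by (intro prod_two_digits_le) auto
    also have "\<dots> \<le> prod_list (cf_digits (Suc n) x)" using irr n by (intro prod_list_cf_digits_mono) auto
    finally have "real (partial_quotient k x * partial_quotient (k + 1) x) \<le> p (Suc n)"
      unfolding p_def by (rule of_nat_mono)
    also have "\<dots> = exp (ln (p (Suc n)))" using p1[of "Suc n"] by simp
    also have "\<dots> \<le> exp (h (Suc n))" using le[of "Suc n"] N'[OF n(1)] by simp
    also have "\<dots> < \<phi> n" using N'[OF n(1)] by simp
    finally show False using n(3) by simp
  qed
qed

section \<open>Upper bound for B = infinity\<close>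

lemma growth_B_infinite_iff:
  "growth_B \<phi> = \<infinity> \<longleftrightarrow> ((\<lambda>n. ereal (ln (\<phi> n) / real n)) \<longlonglongrightarrow> \<infinity>)"
proof -
  have "exp_ereal x = \<infinity> \<longleftrightarrow> x = \<infinity>" for x by (cases x) (auto simp: exp_ereal_def)
  then have "growth_B \<phi> = \<infinity> \<longleftrightarrow> liminf (\<lambda>n. ereal (ln (\<phi> n) / real n)) = \<infinity>"
    by (simp add: growth_B_def)
  also have "\<dots> \<longleftrightarrow> ((\<lambda>n. ereal (ln (\<phi> n) / real n)) \<longlonglongrightarrow> \<infinity>)"
    by (metis Liminf_PInfty trivial_limit_sequentially infinity_ereal_def)
  finally show ?thesis .
qed

lemma growth_B_infinite_eventually:
  assumes "growth_B \<phi> = \<infinity>"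
  shows "\<forall>\<^sub>F n in sequentially. K * real n < ln (\<phi> n)"
proof -
  have "\<forall>\<^sub>F n in sequentially. ereal K < ereal (ln (\<phi> n) / real n)"
    using assms unfolding growth_B_infinite_iff by (intro order_tendstoD(1)) auto
  then show ?thesis
    using eventually_gt_at_top[of 0]
    by eventually_elim (simp add: pos_less_divide_eq)
qed

text \<open>For c < 1 the comparison recursion has linear supersolutions, and B = \<infinity> makes
  ln (\<phi> n) superlinear. This treats b = 1, where no c with 1 < c < b exists.\<close>

lemma content_F2_half:
  assumes "growth_B \<phi> = \<infinity>" "1/2 < s" "\<And>n. 1 \<le> n \<Longrightarrow> 0 < \<phi> n"
  shows "hausdorff_content s (F2_set \<phi>) = 0"
proof -
  obtain c where c: "0 < c" "c < 1" "1 < s * (1 + c)"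
  proof
    \<comment> \<open>From c \<ge> 1 / (2 s) follows s (1 + c) \<ge> s + 1/2 > 1, and s > 1/2 keeps
      c below 1.\<close>
    define c where "c = max (1/2) (1 / (2 * s))"
    show "0 < c" "c < 1" using assms by (auto simp: c_def divide_simps)
    have "s * (1 + 1 / (2 * s)) \<le> s * (1 + c)" using assms by (intro mult_left_mono) (auto simp: c_def)
    moreover have "s * (1 + 1 / (2 * s)) = s + 1/2" using assms by (simp add: field_simps)
    ultimately show "1 < s * (1 + c)" using assms by linarith
  qed
  show ?thesis
  proof (rule content_F2_superexponential)
    fix G K :: real and N :: nat assume G: "1 \<le> G"
    \<comment> \<open>Fixed point of \<open>D = c * D + ln G\<close>: the slope D reproduces itself
      under the recursion.\<close>
    define D where "D = ln G / (1 - c)"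
    define K' where "K' = \<bar>K\<bar>"
    have D: "0 \<le> D" "c * D + ln G = D" using G c by (auto simp: D_def field_simps)
    define h where "h n = K' + real n * D" for n
    have "K \<le> h N" using D by (simp add: h_def K'_def) (smt (verit) mult_nonneg_nonneg of_nat_0_le_iff)
    moreover have "c * h n + real n * ln G \<le> h (Suc n)" for n
    proof -
      have "c * h n + real n * ln G = c * K' + real n * (c * D + ln G)" by (simp add: h_def algebra_simps)
      also have "\<dots> \<le> K' + real n * D" using c D(2) by (simp add: K'_def mult_left_le_one_le)
      also have "\<dots> \<le> h (Suc n)" using D by (simp add: h_def algebra_simps)
      finally show ?thesis .
    qed
    moreover have "\<forall>\<^sub>F n in sequentially. exp (h (Suc n)) < \<phi> n"
      using growth_B_infinite_eventually[OF assms(1), of "K' + 2 * D"] eventually_ge_at_top[of 1]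
    proof eventually_elim
      case (elim n)
      have "K' * 1 \<le> K' * real n" "D * 1 \<le> D * real n" by (intro mult_left_mono; use elim D in \<open>simp add: K'_def\<close>)+
      then have "h (Suc n) < ln (\<phi> n)" using elim by (simp add: h_def algebra_simps)
      then have "exp (h (Suc n)) < exp (ln (\<phi> n))" by simp
      then show ?case using assms(3)[of n] elim by simp
    qed
    ultimately show "\<exists>h::nat \<Rightarrow> real. K \<le> h N \<and> (\<forall>n\<ge>N. c * h n + real n * ln G \<le> h (Suc n)) \<and>
       (\<forall>\<^sub>F n in sequentially. exp (h (Suc n)) < \<phi> n)" by blast
  qed (use c assms in auto)
qed

lemma ereal_less_exp_ereal_iff:
  assumes "0 < r"
  shows "ereal r < exp_ereal x \<longleftrightarrow> ereal (ln r) < x"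
proof (cases x)
  case (real y)
  have "r < exp y \<longleftrightarrow> ln r < y" using assms by (metis exp_less_cancel_iff exp_ln)
  then show ?thesis by (simp add: real exp_ereal_def)
qed (use assms in \<open>auto simp: exp_ereal_def\<close>)

text \<open>For d strictly between c and b the sequence L d^n is a supersolution as soon as L
  dominates the bounded sequence n ln G / ((d - c) d^n), and d < b keeps it below b^n < ln (\<phi>
  n).\<close>

lemma content_F2_doubly_exponential:
  assumes "growth_B \<phi> = \<infinity>" "1 < c" "ereal c < growth_b \<phi>" "0 < s" "1 < s * (1 + c)"
    "\<And>n. 1 \<le> n \<Longrightarrow> 0 < \<phi> n"
  shows "hausdorff_content s (F2_set \<phi>) = 0"
proof -
  obtain b where b: "c < b" "ereal b < growth_b \<phi>"
    using ereal_dense2[OF assms(3)] by auto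
  define d where "d = (c + b) / 2"
  have d: "1 < d" "c < d" "d < b" using b assms by (auto simp: d_def)
  have "ereal (ln b) < liminf (\<lambda>n. ereal (ln (ln (\<phi> n)) / real n))"
    using b assms by (simp add: growth_b_def ereal_less_exp_ereal_iff)
  then have "\<forall>\<^sub>F n in sequentially. ereal (ln b) < ereal (ln (ln (\<phi> n)) / real n)"
    by (rule less_LiminfD)
  then have ev: "\<forall>\<^sub>F n in sequentially. b ^ n < ln (\<phi> n)"
    using growth_B_infinite_eventually[OF assms(1), of 1] eventually_gt_at_top[of 0]
  proof eventually_elim
    case (elim n)
    then have "real n * ln b < ln (ln (\<phi> n))" by (simp add: pos_less_divide_eq mult.commute)
    then have "exp (real n * ln b) < exp (ln (ln (\<phi> n)))" by simp
    then have "exp (real n * ln b) < ln (\<phi> n)" using elim by simp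
    moreover have "exp (real n * ln b) = b ^ n" using b assms by (simp add: exp_of_nat_mult)
    ultimately show ?case by simp
  qed
  show ?thesis
  proof (rule content_F2_superexponential)
    fix G K :: real and N :: nat assume G: "1 \<le> G"
    have "(\<lambda>n. real n * ln G / ((d - c) * d ^ n)) \<longlonglongrightarrow> 0"
      using d by real_asymp
    then have "Bseq (\<lambda>n. real n * ln G / ((d - c) * d ^ n))" by (rule convergent_imp_Bseq[OF convergentI])
    then obtain M where M: "0 < M" "\<And>n. norm (real n * ln G / ((d - c) * d ^ n)) \<le> M"
      by (auto elim: BseqE)
    define L where "L = M + \<bar>K\<bar>"
    define h where "h n = L * d ^ n" for n
    have "\<bar>K\<bar> * 1 \<le> L * d ^ N" using M d by (intro mult_mono one_le_power) (auto simp: L_def)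
    then have "K \<le> h N" by (simp add: h_def)
    moreover have "c * h n + real n * ln G \<le> h (Suc n)" for n
    proof -
      have "real n * ln G / ((d - c) * d ^ n) \<le> L" using M(2)[of n] unfolding real_norm_def L_def by linarith
      then have "real n * ln G \<le> L * ((d - c) * d ^ n)" using d by (simp add: pos_divide_le_eq)
      then show ?thesis by (simp add: h_def algebra_simps)
    qed
    moreover have "\<forall>\<^sub>F n in sequentially. exp (h (Suc n)) < \<phi> n"
    proof -
      have "\<forall>\<^sub>F n in sequentially. L * d * d ^ n < b ^ n" using d by real_asymp
      then show ?thesis
        using ev eventually_ge_at_top[of 1]
      proof eventually_elim
        case (elim n)
        then have "exp (h (Suc n)) < exp (ln (\<phi> n))" by (simp add: h_def mult_ac)
        then show ?case using assms(6)[of n] elim by simp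
      qed
    qed
    ultimately show "\<exists>h::nat \<Rightarrow> real. K \<le> h N \<and> (\<forall>n\<ge>N. c * h n + real n * ln G \<le> h (Suc n)) \<and>
       (\<forall>\<^sub>F n in sequentially. exp (h (Suc n)) < \<phi> n)" by blast
  qed (use assms in auto)
qed

lemma growth_b_ge_1:
  assumes "growth_B \<phi> = \<infinity>"
  shows "1 \<le> growth_b \<phi>"
proof -
  have "\<forall>\<^sub>F n in sequentially. 0 \<le> ereal (ln (ln (\<phi> n)) / real n)"
    using growth_B_infinite_eventually[OF assms, of 1] eventually_gt_at_top[of 0]
    by eventually_elim simp
  then have "0 \<le> liminf (\<lambda>n. ereal (ln (ln (\<phi> n)) / real n))" by (rule Liminf_bounded)
  then show ?thesis
    unfolding growth_b_def by (cases "liminf (\<lambda>n. ereal (ln (ln (\<phi> n)) / real n))") (auto simp: exp_ereal_def one_ereal_def)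
qed

lemma dim_F2_infinite_le:
  assumes "growth_B \<phi> = \<infinity>" "\<And>n. 1 \<le> n \<Longrightarrow> 0 < \<phi> n"
  shows "hausdorff_dim (F2_set \<phi>) \<le> 1 / (1 + growth_b \<phi>)"
proof (cases "growth_b \<phi>")
  case (real b)
  have b: "1 \<le> b" using growth_b_ge_1[OF assms(1)] real by simp
  have "hausdorff_dim (F2_set \<phi>) \<le> ereal (1 / (1 + b))"
  proof (rule hausdorff_dim_le)
    fix t assume t: "1 / (1 + b) < t"
    have t0: "0 < t" using t b by (meson add_nonneg_nonneg divide_nonneg_nonneg le_less_trans zero_le_one order_trans)
    then have tb: "1 < t * (1 + b)" using t b by (simp add: pos_divide_less_eq)
    show "hausdorff_content t (F2_set \<phi>) = 0"
    proof (cases "b = 1")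
      case True
      then show ?thesis using assms tb by (intro content_F2_half) auto
    next
      case False
      \<comment> \<open>The larger of two midpoints, so that c lies below b but above both 1 and 1 /
        t - 1.\<close>
      define c where "c = max ((1 + b) / 2) ((1 / t - 1 + b) / 2)"
      have "1 / t - 1 < b" using tb t0 by (simp add: field_simps)
      then have c: "1 < c" "c < b" "1 / t - 1 < c" using b False by (auto simp: c_def less_max_iff_disj max_less_iff_conj)
      then have "1 < t * (1 + c)" using t0 by (simp add: field_simps)
      then show ?thesis using assms c real t0 by (intro content_F2_doubly_exponential[of \<phi> c]) auto
    qed
  qed (use b in auto)
  also have "ereal (1 / (1 + b)) = 1 / (1 + growth_b \<phi>)"
    using b real by (simp add: one_ereal_def)
  finally show ?thesis .
next
  case PInf
  have "hausdorff_dim (F2_set \<phi>) \<le> ereal 0"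
  proof (rule hausdorff_dim_le)
    fix t :: real assume t: "0 < t"
    define c where "c = 2 + 1 / t"
    have "1 < c" "1 < t * (1 + c)" using t by (auto simp: c_def field_simps)
    then show "hausdorff_content t (F2_set \<phi>) = 0"
      using assms PInf t by (intro content_F2_doubly_exponential[of \<phi> c]) auto
  qed simp
  then show ?thesis using PInf by (simp add: zero_ereal_def)
next
  case MInf
  then show ?thesis using growth_b_ge_1[OF assms(1)] by simp
qed

section \<open>Covers for exponential thresholds\<close>

text \<open>Comparison with \<open>prod_list p powr (-\<sigma>)\<close> decouples the digits of p,
  and their sum becomes a power of zeta(\<sigma>). With \<sigma> = 1 + e, logarithmic factors of
  sharper digit sums are traded for \<Phi>^e.\<close>

lemma content_tail_family:
  assumes "0 < s" "digit_sum \<sigma> = ennreal z" "0 \<le> z" "0 \<le> K" "pos_word w"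
    and tK: "\<And>p. p \<in> words j \<Longrightarrow> Q p \<Longrightarrow> 0 < t p \<and>
        real (prod_list p) powr (-2 * s) * t p powr (-s) \<le> K * real (prod_list p) powr (-\<sigma>)"
  shows "hausdorff_content s (\<Union>p\<in>{p \<in> words j. Q p}. tail_cylinder (w @ p) (t p))
     \<le> ennreal (cf_den w 0 powr (-2 * s) * (K * z ^ j))"
proof -
  define q where "q = cf_den w 0 powr (-2 * s)"
  have q: "0 \<le> q" by (simp add: q_def)
  have "(\<Union>p\<in>{p \<in> words j. Q p}. tail_cylinder (w @ p) (t p))
     = (\<Union>p\<in>words j. if Q p then tail_cylinder (w @ p) (t p) else {})"
    by (auto split: if_splits)
  then have "hausdorff_content s (\<Union>p\<in>{p \<in> words j. Q p}. tail_cylinder (w @ p) (t p))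
     \<le> (\<integral>\<^sup>+ p. hausdorff_content s (if Q p then tail_cylinder (w @ p) (t p) else {}) \<partial>count_space (words j))"
    by (simp only:) (rule hausdorff_content_UN_count_space_le, simp)
  also have "\<dots> \<le> (\<integral>\<^sup>+ p. ennreal (q * K) * ennreal (real (prod_list p) powr (-\<sigma>)) \<partial>count_space (words j))"
  proof (intro nn_integral_mono)
    fix p assume p: "p \<in> space (count_space (words j))"
    show "hausdorff_content s (if Q p then tail_cylinder (w @ p) (t p) else {})
       \<le> ennreal (q * K) * ennreal (real (prod_list p) powr (-\<sigma>))"
    proof (cases "Q p")
      case True
      then have tp: "0 < t p" "real (prod_list p) powr (-2 * s) * t p powr (-s) \<le> K * real (prod_list p) powr (-\<sigma>)"
        using tK[of p] p by auto
      have "hausdorff_content s (tail_cylinder (w @ p) (t p))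
         \<le> ennreal (q * (real (prod_list p) powr (-2 * s) * t p powr (-s)))"
        unfolding q_def using assms tp p by (intro content_tail_cylinder_append) (auto simp: words_def)
      also have "\<dots> \<le> ennreal (q * (K * real (prod_list p) powr (-\<sigma>)))"
        using tp q by (intro ennreal_leI mult_left_mono) auto
      also have "\<dots> = ennreal (q * K) * ennreal (real (prod_list p) powr (-\<sigma>))"
        using q assms by (simp add: ennreal_mult[symmetric] mult.assoc)
      finally show ?thesis using True by simp
    qed simp
  qed
  also have "\<dots> = ennreal (q * K) * ennreal z ^ j"
    by (simp add: nn_integral_cmult nn_integral_prod_list_words assms(2))
  also have "\<dots> = ennreal (q * (K * z ^ j))"
    using q assms by (simp add: ennreal_power ennreal_mult[symmetric] mult.assoc)
  finally show ?thesis by (simp add: q_def)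
qed

definition pair_cylinder :: "nat list \<Rightarrow> real \<Rightarrow> real set" where
  "pair_cylinder w \<Phi> = {x \<in> irrationals01. cf_digits (length w) x = w \<and>
     \<Phi> \<le> real (partial_quotient (length w + 1) x * partial_quotient (length w + 2) x)}"

definition triple_cylinder :: "nat list \<Rightarrow> real \<Rightarrow> real set" where
  "triple_cylinder w \<Phi> = {x \<in> irrationals01. cf_digits (length w) x = w \<and>
     \<Phi> \<le> real (partial_quotient (length w + 1) x * partial_quotient (length w + 2) x) \<and>
     \<Phi> \<le> real (partial_quotient (length w + 2) x * partial_quotient (length w + 3) x)}"

text \<open>The weight a^(-s) with s < 1 is not summable over the digits. The bound a \<le>
  \<Phi>^\<alpha> turns the surplus a^(1 + e - s) into a power of \<Phi> and leaves the summable
  a^(-(1 + e)).\<close>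

lemma powr_split_le:
  fixes a e s \<alpha> \<Phi> :: real
  assumes "1 \<le> a" "a \<le> \<Phi> powr \<alpha>" "0 \<le> 1 + e - s" "1 \<le> \<Phi>" "\<alpha> * (1 + e - s) - s \<le> \<beta>"
  shows "a powr (-s) * \<Phi> powr (-s) \<le> \<Phi> powr \<beta> * a powr (- (1 + e))"
proof -
  have "a powr (-s) = a powr (1 + e - s) * a powr (- (1 + e))"
    using assms by (simp add: powr_add[symmetric])
  also have "a powr (1 + e - s) \<le> (\<Phi> powr \<alpha>) powr (1 + e - s)"
    using assms by (intro powr_mono2) auto
  also have "(\<Phi> powr \<alpha>) powr (1 + e - s) = \<Phi> powr (\<alpha> * (1 + e - s))" by (simp add: powr_powr)
  finally have "a powr (-s) * \<Phi> powr (-s) \<le> \<Phi> powr (\<alpha> * (1 + e - s)) * a powr (- (1 + e)) * \<Phi> powr (-s)"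
    by (simp add: mult_right_mono)
  also have "\<dots> = \<Phi> powr (\<alpha> * (1 + e - s) - s) * a powr (- (1 + e))"
    using powr_add[of \<Phi> "\<alpha> * (1 + e - s)" "-s"] by (simp add: mult_ac)
  also have "\<dots> \<le> \<Phi> powr \<beta> * a powr (- (1 + e))"
    using assms by (intro mult_right_mono powr_mono) auto
  finally show ?thesis .
qed

lemma powr_divide_split:
  fixes a s \<Phi> :: real
  assumes "0 < a" "0 < \<Phi>"
  shows "a powr (-2 * s) * (\<Phi> / a) powr (-s) = a powr (-s) * \<Phi> powr (-s)"
proof -
  have "(\<Phi> / a) powr (-s) = \<Phi> powr (-s) * a powr s"
    using assms by (simp add: powr_divide powr_minus divide_simps)
  moreover have "a powr (-2 * s) * a powr s = a powr (-s)"
    by (simp add: powr_add[symmetric])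
  ultimately show ?thesis by (simp add: mult_ac)
qed

text \<open>The threshold \<open>\<Phi> powr s\<close> balances the two ways to cover: by one long interval where the first
  digit is large, and by the intervals given by a small first digit.\<close>

lemma content_pair_cylinder:
  assumes s: "1/2 < s" "s < 1" and e: "0 < e"
    and z: "digit_sum (1 + e) = ennreal z" "1 \<le> z" and \<Phi>: "1 \<le> \<Phi>" and w: "pos_word w"
  shows "hausdorff_content s (pair_cylinder w \<Phi>)
    \<le> ennreal (cf_den w 0 powr (-2 * s) * (2 * z * \<Phi> powr (- (s\<^sup>2 - e))))"
proof -
  define q where "q = cf_den w 0 powr (-2 * s)"
  define K where "K = \<Phi> powr (- (s\<^sup>2 - e))"
  define M where "M = \<Phi> powr s"
  define X where "X = (\<Union>p\<in>{p \<in> words 0. True}. tail_cylinder (w @ p) M)"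
  define Y where "Y = (\<Union>p\<in>{p \<in> words 1. real (prod_list p) \<le> M}. tail_cylinder (w @ p) (\<Phi> / real (prod_list p)))"
  have "pair_cylinder w \<Phi> \<subseteq> X \<union> Y"
  proof
    fix x assume "x \<in> pair_cylinder w \<Phi>"
    then have x: "x \<in> irrationals01" "cf_digits (length w) x = w"
        "\<Phi> \<le> real (partial_quotient (length w + 1) x * partial_quotient (length w + 2) x)"
      by (auto simp: pair_cylinder_def)
    define a where "a = partial_quotient (length w + 1) x"
    have a: "1 \<le> a" using partial_quotient_pos[OF x(1)] by (simp add: a_def)
    have d: "cf_digits (length w + 1) x = w @ [a]" using x by (simp add: cf_digits_Suc a_def)
    show "x \<in> X \<union> Y"
    proof (cases "M \<le> real a")
      case True
      then have "x \<in> tail_cylinder w M" using x by (intro tail_cylinderI[where n = "length w"]) (auto simp: a_def)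
      then show ?thesis by (simp add: X_def)
    next
      case False
      have "\<Phi> / real a \<le> real (partial_quotient (length w + 2) x)"
        using x(3)[folded a_def] a by (simp add: pos_divide_le_eq mult.commute)
      then have "x \<in> tail_cylinder (w @ [a]) (\<Phi> / real a)"
        using x d by (intro tail_cylinderI[where n = "length w + 1"]) auto
      moreover have "[a] \<in> {p \<in> words 1. real (prod_list p) \<le> M}" using a False by (auto simp: words_def)
      ultimately show ?thesis unfolding Y_def by (intro UnI2 UN_I[of "[a]"]) auto
    qed
  qed
  then have "hausdorff_content s (pair_cylinder w \<Phi>) \<le> hausdorff_content s X + hausdorff_content s Y"
    using hausdorff_content_mono hausdorff_content_Un_le order_trans by blast
  also have "hausdorff_content s X \<le> ennreal (q * (K * z ^ 0))"
    unfolding X_def q_def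
  proof (rule content_tail_family[OF _ z(1)])
    fix p assume "p \<in> words 0"
    then have "p = []" by simp
    moreover have "M powr (-s) \<le> K"
      unfolding M_def K_def powr_powr using \<Phi> e by (intro powr_mono) (auto simp: power2_eq_square)
    ultimately show "0 < M \<and> real (prod_list p) powr (-2 * s) * M powr (-s) \<le> K * real (prod_list p) powr (- (1 + e))"
      using \<Phi> by (auto simp: M_def)
  qed (use s z w in \<open>auto simp: K_def\<close>)
  also have "hausdorff_content s Y \<le> ennreal (q * (K * z ^ 1))"
    unfolding Y_def q_def
  proof (rule content_tail_family[OF _ z(1)])
    fix p assume p: "p \<in> words 1" "real (prod_list p) \<le> M"
    have p1: "1 \<le> real (prod_list p)" using prod_list_ge_1[of p] p by (auto simp: words_def)
    have "s * (1 + e - s) - s \<le> - (s\<^sup>2 - e)"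
    proof -
      have "s * e \<le> 1 * e" using s e by (intro mult_right_mono) auto
      then show ?thesis by (simp add: power2_eq_square algebra_simps)
    qed
    then have "real (prod_list p) powr (-s) * \<Phi> powr (-s) \<le> K * real (prod_list p) powr (- (1 + e))"
      unfolding K_def using p p1 s e \<Phi> by (intro powr_split_le[of _ _ s]) (auto simp: M_def)
    then show "0 < \<Phi> / real (prod_list p) \<and>
       real (prod_list p) powr (-2 * s) * (\<Phi> / real (prod_list p)) powr (-s) \<le> K * real (prod_list p) powr (- (1 + e))"
      using p1 \<Phi> powr_divide_split[of "real (prod_list p)" \<Phi> s] by auto
  qed (use s z w in \<open>auto simp: K_def\<close>)
  also have "ennreal (q * (K * z ^ 0)) + ennreal (q * (K * z ^ 1)) = ennreal (q * K * (1 + z))"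
    using z by (subst ennreal_plus[symmetric]) (auto simp: q_def K_def algebra_simps)
  also have "\<dots> \<le> ennreal (q * K * (2 * z))"
    using z by (intro ennreal_leI mult_left_mono) (auto simp: q_def K_def)
  finally show ?thesis by (simp add: q_def K_def mult_ac add_mono)
qed

text \<open>With digits a, b, d after w and e dropped, three pieces cost the same. X (b \<le>
  \<Phi>^s): the words a b with product at least \<Phi> give \<Phi>^(1 - 2 s), the tail d \<ge>
  \<Phi> / b at most \<Phi>^(s^2 - s). Y (a \<ge> \<Phi>^(1 - s), b \<ge> \<Phi>^s): \<Phi>^((1 - s)
  (1 - 2 s)) times \<Phi>^(-s^2). Z (a \<le> \<Phi>^(1 - s), b \<ge> \<Phi> / a): \<Phi>^((1 - s)^2
  - s). Each exponent is 1 - 3 s + s^2.\<close>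

lemma content_triple_cylinder:
  assumes s: "1/2 < s" "s < 1" and e: "0 < e" "e \<le> 2 * s - 1"
    and z: "digit_sum (1 + e) = ennreal z" "1 \<le> z" and \<Phi>: "1 \<le> \<Phi>" and w: "pos_word w"
  shows "hausdorff_content s (triple_cylinder w \<Phi>)
    \<le> ennreal (cf_den w 0 powr (-2 * s) * (3 * z\<^sup>2 * \<Phi> powr (- (3 * s - 1 - s\<^sup>2 - e))))"
proof -
  define q where "q = cf_den w 0 powr (-2 * s)"
  define K where "K = \<Phi> powr (- (3 * s - 1 - s\<^sup>2 - e))"
  define M where "M = \<Phi> powr s"
  define N where "N = \<Phi> powr (1 - s)"
  define X where "X = (\<Union>p\<in>{p \<in> words 2. real (p ! 1) \<le> M \<and> \<Phi> \<le> real (prod_list p)}. tail_cylinder (w @ p) (\<Phi> / real (p ! 1)))"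
  define Y where "Y = (\<Union>p\<in>{p \<in> words 1. N \<le> real (prod_list p)}. tail_cylinder (w @ p) M)"
  define Z where "Z = (\<Union>p\<in>{p \<in> words 1. real (prod_list p) \<le> N}. tail_cylinder (w @ p) (\<Phi> / real (prod_list p)))"
  have M: "1 \<le> M" using \<Phi> s by (auto simp: M_def ge_one_powr_ge_zero)
  have "triple_cylinder w \<Phi> \<subseteq> X \<union> (Y \<union> Z)"
  proof
    fix x assume "x \<in> triple_cylinder w \<Phi>"
    then have x: "x \<in> irrationals01" "cf_digits (length w) x = w"
        "\<Phi> \<le> real (partial_quotient (length w + 1) x * partial_quotient (length w + 2) x)"
        "\<Phi> \<le> real (partial_quotient (length w + 2) x * partial_quotient (length w + 3) x)"
      by (auto simp: triple_cylinder_def)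
    define a where "a = partial_quotient (length w + 1) x"
    define b where "b = partial_quotient (length w + 2) x"
    have ab: "1 \<le> a" "1 \<le> b" using partial_quotient_pos[OF x(1)] by (auto simp: a_def b_def)
    have d: "cf_digits (length w + 1) x = w @ [a]" "cf_digits (length w + 2) x = w @ [a, b]"
      using x by (simp_all add: cf_digits_Suc a_def b_def)
    have wa: "[a] \<in> words 1" "[a, b] \<in> words 2" using ab by (auto simp: words_def)
    consider "real b \<le> M" | "M \<le> real b" "N \<le> real a" | "real a \<le> N" by linarith
    then show "x \<in> X \<union> (Y \<union> Z)"
    proof cases
      case 1
      have "\<Phi> / real b \<le> real (partial_quotient (length w + 3) x)"
        using x(4)[folded b_def] ab by (simp add: pos_divide_le_eq mult.commute)
      then have "x \<in> tail_cylinder (w @ [a, b]) (\<Phi> / real b)"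
        using x d by (intro tail_cylinderI[where n = "length w + 2"]) (auto simp: eval_nat_numeral)
      then show ?thesis using 1 wa x(3) unfolding X_def
        by (intro UnI1 UN_I[of "[a, b]"]) (auto simp: a_def b_def)
    next
      case 2
      then have "x \<in> tail_cylinder (w @ [a]) M"
        using x d by (intro tail_cylinderI[where n = "length w + 1"]) (auto simp: b_def)
      then show ?thesis using 2 wa unfolding Y_def
        by (intro UnI2 UnI1 UN_I[of "[a]"]) auto
    next
      case 3
      have "\<Phi> / real a \<le> real b"
        using x(3)[folded a_def b_def] ab by (simp add: pos_divide_le_eq mult.commute)
      then have "x \<in> tail_cylinder (w @ [a]) (\<Phi> / real a)"
        using x d by (intro tail_cylinderI[where n = "length w + 1"]) (auto simp: b_def)
      then show ?thesis using 3 wa unfolding Z_def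
        by (intro UnI2 UN_I[of "[a]"]) auto
    qed
  qed
  then have "hausdorff_content s (triple_cylinder w \<Phi>) \<le> hausdorff_content s (X \<union> (Y \<union> Z))"
    by (rule hausdorff_content_mono)
  also have "\<dots> \<le> hausdorff_content s X + (hausdorff_content s Y + hausdorff_content s Z)"
    by (meson add_left_mono hausdorff_content_Un_le order_trans)
  also have "hausdorff_content s X \<le> ennreal (q * (K * z ^ 2))"
    unfolding X_def q_def
  proof (rule content_tail_family[OF _ z(1)])
    fix p assume p: "p \<in> words 2" "real (p ! 1) \<le> M \<and> \<Phi> \<le> real (prod_list p)"
    define P where "P = real (prod_list p)"
    define b where "b = real (p ! 1)"
    have "pos_word p" "length p = 2" using p by (auto simp: words_def)
    then have "1 \<le> p ! 1" by (simp add: pos_word_def)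
    then have b: "1 \<le> b" "b \<le> M" using p by (auto simp: b_def)
    have P: "\<Phi> \<le> P" "1 \<le> P" using p \<Phi> by (auto simp: P_def)
    have "(\<Phi> / b) powr (-s) = b powr s * \<Phi> powr (-s)"
      using b \<Phi> by (simp add: powr_divide powr_minus divide_simps)
    also have "\<dots> \<le> M powr s * \<Phi> powr (-s)"
      using b s by (intro mult_right_mono powr_mono2) auto
    also have "\<dots> = \<Phi> powr (s\<^sup>2 - s)"
      using \<Phi> by (simp add: M_def powr_powr powr_diff powr_minus divide_simps power2_eq_square)
    finally have 1: "(\<Phi> / b) powr (-s) \<le> \<Phi> powr (s\<^sup>2 - s)" .
    have "P powr (-2 * s) = P powr (1 + e - 2 * s) * P powr (- (1 + e))"
      by (simp add: powr_add[symmetric])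
    \<comment> \<open>By e \<le> 2 s - 1 the exponent is nonpositive, so the lower bound \<Phi>
      \<le> P may be inserted.\<close>
    also have "\<dots> \<le> \<Phi> powr (1 + e - 2 * s) * P powr (- (1 + e))"
      using P e \<Phi> by (intro mult_right_mono powr_mono2') auto
    finally have "P powr (-2 * s) * (\<Phi> / b) powr (-s)
        \<le> (\<Phi> powr (1 + e - 2 * s) * P powr (- (1 + e))) * \<Phi> powr (s\<^sup>2 - s)"
      using 1 by (intro mult_mono) auto
    also have "\<dots> = (\<Phi> powr (1 + e - 2 * s) * \<Phi> powr (s\<^sup>2 - s)) * P powr (- (1 + e))"
      by (simp add: mult_ac)
    also have "\<Phi> powr (1 + e - 2 * s) * \<Phi> powr (s\<^sup>2 - s) = K"
      unfolding K_def powr_add[symmetric] by (simp add: algebra_simps)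
    finally show "0 < \<Phi> / real (p ! 1) \<and>
       real (prod_list p) powr (-2 * s) * (\<Phi> / real (p ! 1)) powr (-s) \<le> K * real (prod_list p) powr (- (1 + e))"
      using b \<Phi> by (simp add: P_def b_def)
  qed (use s z w in \<open>auto simp: K_def\<close>)
  also have "hausdorff_content s Y \<le> ennreal (q * (K * z ^ 1))"
    unfolding Y_def q_def
  proof (rule content_tail_family[OF _ z(1)])
    fix p assume p: "p \<in> words 1" "N \<le> real (prod_list p)"
    define P where "P = real (prod_list p)"
    have P: "N \<le> P" using p by (simp add: P_def)
    have N: "0 < N" using \<Phi> by (simp add: N_def)
    have "P powr (-2 * s) = P powr (1 + e - 2 * s) * P powr (- (1 + e))"
      by (simp add: powr_add[symmetric])
    also have "\<dots> \<le> N powr (1 + e - 2 * s) * P powr (- (1 + e))"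
      using P N e by (intro mult_right_mono powr_mono2') auto
    finally have "P powr (-2 * s) * M powr (-s) \<le> (N powr (1 + e - 2 * s) * P powr (- (1 + e))) * M powr (-s)"
      by (intro mult_right_mono) auto
    \<comment> \<open>The exponent equals 1 - 3 s + s^2 + e (1 - s), which exceeds the target by at
      most 0 because e (1 - s) \<le> e.\<close>
    also have "\<dots> = \<Phi> powr ((1 - s) * (1 + e - 2 * s) + s * (-s)) * P powr (- (1 + e))"
      unfolding N_def M_def powr_powr powr_add by (simp add: mult_ac)
    also have "\<dots> \<le> K * P powr (- (1 + e))"
    proof -
      have "0 \<le> e * s" using e s by simp
      then show ?thesis
        unfolding K_def using \<Phi> by (intro mult_right_mono powr_mono) (auto simp: algebra_simps power2_eq_square)
    qed
    finally show "0 < M \<and> real (prod_list p) powr (-2 * s) * M powr (-s) \<le> K * real (prod_list p) powr (- (1 + e))"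
      using M by (simp add: P_def)
  qed (use s z w in \<open>auto simp: K_def\<close>)
  also have "hausdorff_content s Z \<le> ennreal (q * (K * z ^ 1))"
    unfolding Z_def q_def
  proof (rule content_tail_family[OF _ z(1)])
    fix p assume p: "p \<in> words 1" "real (prod_list p) \<le> N"
    have p1: "1 \<le> real (prod_list p)" using prod_list_ge_1[of p] p by (auto simp: words_def)
    have "0 \<le> s * e" using s e by simp
    then have "(1 - s) * (1 + e - s) - s \<le> - (3 * s - 1 - s\<^sup>2 - e)"
      by (simp add: power2_eq_square algebra_simps)
    then have "real (prod_list p) powr (-s) * \<Phi> powr (-s) \<le> K * real (prod_list p) powr (- (1 + e))"
      unfolding K_def using p p1 s e \<Phi> by (intro powr_split_le[of _ _ "1 - s"]) (auto simp: N_def)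
    then show "0 < \<Phi> / real (prod_list p) \<and>
       real (prod_list p) powr (-2 * s) * (\<Phi> / real (prod_list p)) powr (-s) \<le> K * real (prod_list p) powr (- (1 + e))"
      using p1 \<Phi> powr_divide_split[of "real (prod_list p)" \<Phi> s] by auto
  qed (use s z w in \<open>auto simp: K_def\<close>)
  also have "ennreal (q * (K * z ^ 2)) + (ennreal (q * (K * z ^ 1)) + ennreal (q * (K * z ^ 1)))
     = ennreal (q * K * (z\<^sup>2 + 2 * z))"
    using z by (subst ennreal_plus[symmetric], simp_all add: q_def K_def ennreal_plus[symmetric] algebra_simps del: ennreal_plus)
  also have "\<dots> \<le> ennreal (q * K * (3 * z\<^sup>2))"
    using z mult_left_mono[of 1 z z] by (intro ennreal_leI mult_left_mono) (auto simp: q_def K_def power2_eq_square)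
  finally show ?thesis by (simp add: q_def K_def mult_ac add_mono)
qed

definition adjacent_set :: "real \<Rightarrow> nat \<Rightarrow> real set" where
  "adjacent_set \<Phi> k = {x \<in> irrationals01.
     \<Phi> \<le> real (partial_quotient (k + 1) x * partial_quotient (k + 2) x) \<and>
     \<Phi> \<le> real (partial_quotient (k + 2) x * partial_quotient (k + 3) x)}"

text \<open>Here m counts the digits strictly between the two pairs; m = 0 means pairs that touch
  without sharing a digit.\<close>

definition separated_set :: "real \<Rightarrow> nat \<Rightarrow> nat \<Rightarrow> real set" where
  "separated_set \<Phi> k m = {x \<in> irrationals01.
     \<Phi> \<le> real (partial_quotient (k + 1) x * partial_quotient (k + 2) x) \<and>
     \<Phi> \<le> real (partial_quotient (k + m + 3) x * partial_quotient (k + m + 4) x)}"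

lemma content_adjacent_set:
  assumes s: "1/2 < s" "s < 1" and e: "0 < e" "e \<le> 2 * s - 1"
    and z: "digit_sum (1 + e) = ennreal z" "1 \<le> z" and \<Phi>: "1 \<le> \<Phi>"
  shows "hausdorff_content s (adjacent_set \<Phi> k)
    \<le> word_sum s k * ennreal (3 * z\<^sup>2 * \<Phi> powr (- (3 * s - 1 - s\<^sup>2 - e)))"
proof -
  have "hausdorff_content s (adjacent_set \<Phi> k)
     \<le> (\<integral>\<^sup>+ w. hausdorff_content s (triple_cylinder w \<Phi>) \<partial>count_space (words k))"
    by (rule content_words_le) (auto simp: adjacent_set_def triple_cylinder_def)
  also have "\<dots> \<le> (\<integral>\<^sup>+ w. ennreal (cf_den w 0 powr (-2 * s)) *
      ennreal (3 * z\<^sup>2 * \<Phi> powr (- (3 * s - 1 - s\<^sup>2 - e))) \<partial>count_space (words k))"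
    using content_triple_cylinder[OF assms]
    by (intro nn_integral_mono) (auto simp: words_def ennreal_mult[symmetric])
  also have "\<dots> = word_sum s k * ennreal (3 * z\<^sup>2 * \<Phi> powr (- (3 * s - 1 - s\<^sup>2 - e)))"
    by (simp add: nn_integral_multc word_sum_def)
  finally show ?thesis .
qed

text \<open>The earlier pair must be spelled out, since a word follows it: summing P^(-2 s) over
  two-digit products P \<ge> \<Phi> gives \<Phi>^(1 - 2 s). The later pair is covered by
  \<open>content_pair_cylinder\<close> at the cheaper rate \<Phi>^(-s^2).\<close>

lemma content_separated_set:
  assumes s: "1/2 < s" "s < 1" and e: "0 < e" "e \<le> 2 * s - 1"
    and z: "digit_sum (1 + e) = ennreal z" "1 \<le> z" and \<Phi>: "1 \<le> \<Phi>"
  shows "hausdorff_content s (separated_set \<Phi> k m)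
    \<le> word_sum s k * word_sum s m * ennreal (2 * z ^ 3 * \<Phi> powr (- (2 * s - 1 + s\<^sup>2 - 2 * e)))"
proof -
  define C where "C = 2 * z * \<Phi> powr (- (s\<^sup>2 - e))"
  define D where "D = \<Phi> powr (1 + e - 2 * s)"
  have CD: "0 \<le> C" "0 \<le> D" using z by (auto simp: C_def D_def)
  define S where "S w = (if \<Phi> \<le> real (prod_list (take 2 (drop k w))) then pair_cylinder w \<Phi> else {})" for w
  have "hausdorff_content s (separated_set \<Phi> k m)
     \<le> (\<integral>\<^sup>+ w. hausdorff_content s (S w) \<partial>count_space (words (k + (2 + m))))"
  proof (rule content_words_le)
    fix x assume x: "x \<in> separated_set \<Phi> k m"
    have "take 2 (drop k (cf_digits (k + (2 + m)) x)) = [partial_quotient (k + 1) x, partial_quotient (k + 2) x]"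
    proof -
      have "take 2 (drop k [0..<k + (2 + m)]) = [k..<k + 2]"
        unfolding drop_upt add_0 by (rule take_upt) simp
      also have "\<dots> = [k, k + 1]" by (simp add: upt_rec)
      finally show ?thesis unfolding cf_digits_def drop_map take_map by (simp only:) simp
    qed
    then show "x \<in> S (cf_digits (k + (2 + m)) x)"
      using x by (auto simp: S_def pair_cylinder_def separated_set_def eval_nat_numeral)
  qed (auto simp: separated_set_def)
  also have "\<dots> \<le> (\<integral>\<^sup>+ u. \<integral>\<^sup>+ p. \<integral>\<^sup>+ v. ennreal (cf_den u 0 powr (-2 * s)) *
       (ennreal (D * C) * ennreal (real (prod_list p) powr (- (1 + e))) * ennreal (cf_den v 0 powr (-2 * s)))
       \<partial>count_space (words m) \<partial>count_space (words 2) \<partial>count_space (words k))"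
    unfolding nn_integral_words_add
  proof (intro nn_integral_mono)
    fix u p v
    assume "u \<in> space (count_space (words k))" "p \<in> space (count_space (words 2))" "v \<in> space (count_space (words m))"
    then have w: "pos_word u" "pos_word p" "pos_word v" "length u = k" "length p = 2"
      by (auto simp: words_def)
    define P where "P = real (prod_list p)"
    have P: "1 \<le> P" using prod_list_ge_1[OF w(2)] by (simp add: P_def)
    have q: "1 \<le> cf_den u 0" "1 \<le> cf_den v 0" using cf_den_ge_1 w by auto
    have S: "S (u @ p @ v) = (if \<Phi> \<le> P then pair_cylinder (u @ p @ v) \<Phi> else {})"
      using w by (simp add: S_def P_def)
    show "hausdorff_content s (S (u @ p @ v)) \<le> ennreal (cf_den u 0 powr (-2 * s)) *
       (ennreal (D * C) * ennreal (real (prod_list p) powr (- (1 + e))) * ennreal (cf_den v 0 powr (-2 * s)))"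
    proof (cases "\<Phi> \<le> P")
      case True
      have "cf_den u 0 * (P * cf_den v 0) \<le> cf_den u 0 * (cf_den p 0 * cf_den v 0)"
        using prod_list_le_cf_den[OF w(2)] q by (intro mult_left_mono mult_right_mono) (auto simp: P_def)
      also have "\<dots> \<le> cf_den u 0 * cf_den (p @ v) 0"
        using q w by (intro mult_left_mono cf_den_append_bounds) auto
      also have "\<dots> \<le> cf_den (u @ p @ v) 0" using w by (intro cf_den_append_bounds) auto
      finally have "cf_den (u @ p @ v) 0 powr (-2 * s) \<le> (cf_den u 0 * (P * cf_den v 0)) powr (-2 * s)"
        using P q s by (intro powr_mono2') auto
      also have "\<dots> = cf_den u 0 powr (-2 * s) * (P powr (-2 * s) * cf_den v 0 powr (-2 * s))"
        by (simp add: powr_mult)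
      also have "\<dots> \<le> cf_den u 0 powr (-2 * s) * ((D * P powr (- (1 + e))) * cf_den v 0 powr (-2 * s))"
      proof -
        have "P powr (-2 * s) = P powr (1 + e - 2 * s) * P powr (- (1 + e))"
          by (simp add: powr_add[symmetric])
        also have "\<dots> \<le> D * P powr (- (1 + e))"
          unfolding D_def using P e \<Phi> True by (intro mult_right_mono powr_mono2') auto
        finally show ?thesis by (intro mult_left_mono mult_right_mono) auto
      qed
      finally have "cf_den (u @ p @ v) 0 powr (-2 * s) * C
         \<le> (cf_den u 0 powr (-2 * s) * ((D * P powr (- (1 + e))) * cf_den v 0 powr (-2 * s))) * C"
        using CD by (intro mult_right_mono) auto
      also have "\<dots> = cf_den u 0 powr (-2 * s) * (D * C * P powr (- (1 + e)) * cf_den v 0 powr (-2 * s))"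
        by (simp add: mult_ac)
      finally have le: "ennreal (cf_den (u @ p @ v) 0 powr (-2 * s) * C)
         \<le> ennreal (cf_den u 0 powr (-2 * s) * (D * C * P powr (- (1 + e)) * cf_den v 0 powr (-2 * s)))"
        by (rule ennreal_leI)
      have "hausdorff_content s (S (u @ p @ v)) \<le> ennreal (cf_den (u @ p @ v) 0 powr (-2 * s) * C)"
        using content_pair_cylinder[OF s e(1) z \<Phi>, of "u @ p @ v"] w True by (simp add: S C_def)
      also note le
      finally show ?thesis using CD by (simp add: P_def ennreal_mult)
    qed (simp add: S)
  qed
  also have "\<dots> = word_sum s k * (ennreal (D * C) * ennreal z ^ 2 * word_sum s m)"
    using nn_integral_prod_list_words[where \<sigma> = "1 + e" and n = 2]
    by (simp add: nn_integral_cmult nn_integral_multc word_sum_def z(1))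
  also have "\<dots> = word_sum s k * word_sum s m * (ennreal (D * C) * ennreal z ^ 2)"
    by (simp add: mult_ac)
  also have "ennreal (D * C) * ennreal z ^ 2 = ennreal (D * C * z ^ 2)"
    using z CD by (simp add: ennreal_power ennreal_mult[symmetric])
  also have "D * C * z ^ 2 = 2 * z ^ 3 * (\<Phi> powr (1 + e - 2 * s) * \<Phi> powr (- (s\<^sup>2 - e)))"
    by (simp add: C_def D_def power2_eq_square power3_eq_cube)
  also have "\<Phi> powr (1 + e - 2 * s) * \<Phi> powr (- (s\<^sup>2 - e)) = \<Phi> powr (- (2 * s - 1 + s\<^sup>2 - 2 * e))"
    unfolding powr_add[symmetric] by (simp add: algebra_simps)
  finally show ?thesis .
qed

text \<open>Two pairs either share a digit and form a triple, or have m = l - k - 2 digits between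
  them. For each n there are only quadratically many pieces, so a union bound loses a polynomial
  factor.\<close>

lemma F2_set_subset:
  assumes "\<forall>\<^sub>F n in sequentially. \<Psi> n \<le> \<phi> n"
  shows "F2_set \<phi> \<subseteq> {x. \<exists>\<^sub>\<infinity>n. x \<in> (\<Union>k\<in>{..<n}. adjacent_set (\<Psi> n) k) \<union>
     (\<Union>(k, m)\<in>{(k, m). k + m \<le> n}. separated_set (\<Psi> n) k m)}"
proof
  fix x assume x: "x \<in> F2_set \<phi>"
  then have irr: "x \<in> irrationals01" by (simp add: F2_set_def)
  define a where "a k = partial_quotient k x" for k
  have "\<exists>\<^sub>\<infinity>n. \<exists>k\<in>{1..n}. \<exists>l\<in>{1..n}. k \<noteq> l \<and> \<phi> n \<le> real (a k * a (k + 1)) \<and> \<phi> n \<le> real (a l * a (l + 1))"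
    using x by (simp add: F2_set_def a_def)
  then have "\<exists>\<^sub>\<infinity>n. (\<exists>k\<in>{1..n}. \<exists>l\<in>{1..n}. k \<noteq> l \<and> \<phi> n \<le> real (a k * a (k + 1)) \<and> \<phi> n \<le> real (a l * a (l + 1)))
      \<and> \<Psi> n \<le> \<phi> n"
    using assms by (intro INFM_conjI) (simp_all add: cofinite_eq_sequentially)
  then show "x \<in> {x. \<exists>\<^sub>\<infinity>n. x \<in> (\<Union>k\<in>{..<n}. adjacent_set (\<Psi> n) k) \<union>
     (\<Union>(k, m)\<in>{(k, m). k + m \<le> n}. separated_set (\<Psi> n) k m)}"
  proof (simp only: mem_Collect_eq, elim INFM_mono)
    fix n
    assume n: "(\<exists>k\<in>{1..n}. \<exists>l\<in>{1..n}. k \<noteq> l \<and> \<phi> n \<le> real (a k * a (k + 1)) \<and> \<phi> n \<le> real (a l * a (l + 1)))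
      \<and> \<Psi> n \<le> \<phi> n"
    then obtain k l where kl: "k \<in> {1..n}" "l \<in> {1..n}" "k < l" "\<Psi> n \<le> real (a k * a (k + 1))" "\<Psi> n \<le> real (a l * a (l + 1))"
      by (metis linorder_neqE_nat order_trans)
    define j where "j = k - 1"
    have j: "k = j + 1" using kl by (simp add: j_def)
    show "x \<in> (\<Union>k\<in>{..<n}. adjacent_set (\<Psi> n) k) \<union>
     (\<Union>(k, m)\<in>{(k, m). k + m \<le> n}. separated_set (\<Psi> n) k m)"
    proof (cases "l = k + 1")
      case True
      then have "x \<in> adjacent_set (\<Psi> n) j"
        using kl irr by (auto simp: adjacent_set_def a_def j eval_nat_numeral)
      moreover have "j < n" using kl j by auto
      ultimately show ?thesis by blast
    next
      case False
      define m where "m = l - k - 2"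
      have l: "l = j + m + 3" using False kl j by (simp add: m_def)
      have "x \<in> separated_set (\<Psi> n) j m"
        using kl irr by (auto simp: separated_set_def a_def j l eval_nat_numeral)
      moreover have "j + m \<le> n" using kl l by auto
      ultimately show ?thesis by blast
    qed
  qed
qed

lemma cost_exponent_pos:
  fixes s :: real
  assumes "1/2 < s" "s < 1"
  shows "0 < 3 * s - 1 - s\<^sup>2"
proof -
  have "0 < (2 * s - 1) + s * (1 - s)" using assms by (simp add: add_pos_pos)
  then show ?thesis by (simp add: power2_eq_square algebra_simps)
qed

text \<open>The words outside the special digits contribute about exp (n P') and the special digits
  cost B^(-n (c - e)). The quotient decays like x^n with x < 1, which beats the number of
  pieces.\<close>

lemma content_F2_exponential:
  assumes s: "1/2 < s" "s < 1" and B: "1 < B"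
    and ev: "\<forall>\<^sub>F n in sequentially. B ^ n \<le> \<phi> n"
    and P: "cf_pressure s < (3 * s - 1 - s\<^sup>2) * ln B"
  shows "hausdorff_content s (F2_set \<phi>) = 0"
proof -
  define c where "c = 3 * s - 1 - s\<^sup>2"
  have c: "0 < c" unfolding c_def using s by (rule cost_exponent_pos)
  \<comment> \<open>Prefixes of all lengths up to n occur. Cutting the pressure off at 0 bounds them
    all by \<open>exp (real n * P')\<close>, also when the pressure is negative.\<close>
  define P' where "P' = max 0 (cf_pressure s)"
  have lB: "0 < ln B" using B by simp
  have "0 < c * ln B - P'" using P c lB by (auto simp: P'_def c_def)
  \<comment> \<open>The first bound says that 2 s - 1 + s^2 - 2 e is at least c - e, so separated
    pairs are no worse than triples; the second keeps (c - e) ln B above P'.\<close>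
  define e where "e = min (s * (2 * s - 1)) ((c * ln B - P') / (2 * ln B))"
  have e: "0 < e" "e \<le> s * (2 * s - 1)" "e \<le> (c * ln B - P') / (2 * ln B)"
    using s lB \<open>0 < c * ln B - P'\<close> by (auto simp: e_def)
  have "s * (2 * s - 1) \<le> 1 * (2 * s - 1)" using s by (intro mult_right_mono) auto
  from order_trans[OF e(2) this] have e2: "e \<le> 2 * s - 1" by simp
  have "e * ln B \<le> (c * ln B - P') / 2" using e(3) lB by (simp add: field_simps)
  then have Pe: "P' < (c - e) * ln B" using \<open>0 < c * ln B - P'\<close> by (simp add: algebra_simps)
  define z where "z = enn2real (digit_sum (1 + e))"
  have z: "digit_sum (1 + e) = ennreal z" using digit_sum_finite[of "1 + e"] e by (simp add: z_def)
  have z1: "1 \<le> z" using digit_sum_ge_1[of "1 + e"] unfolding z by simp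
  define \<Psi> where "\<Psi> n = B ^ n" for n
  have \<Psi>: "1 \<le> \<Psi> n" for n using B by (simp add: \<Psi>_def)
  define x where "x = exp (P' - (c - e) * ln B)"
  have x: "0 < x" "x < 1" using Pe by (auto simp: x_def)
  have xn: "exp (real n * P') * \<Psi> n powr (- (c - e)) = x ^ n" for n
  proof -
    have "\<Psi> n powr (- (c - e)) = exp (real n * (- (c - e) * ln B))"
      using B by (simp add: powr_def \<Psi>_def ln_realpow)
    then show ?thesis by (simp add: x_def exp_of_nat_mult[symmetric] exp_add[symmetric] algebra_simps)
  qed
  have ws: "word_sum s k \<le> ennreal (4 * exp (real k * P'))" for k
  proof -
    have "(4::real) powr s \<le> 4 powr 1" using s by (intro powr_mono) auto
    moreover have "exp (real k * cf_pressure s) \<le> exp (real k * P')" by (auto simp: P'_def intro: mult_left_mono)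
    ultimately have "4 powr s * exp (real k * cf_pressure s) \<le> 4 * exp (real k * P')"
      by (intro mult_mono) auto
    then show ?thesis using word_sum_pressure_bounds(1)[OF s(1), of k] ennreal_leI order_trans by blast
  qed
  define A where "A n = (\<Union>k\<in>{..<n}. adjacent_set (\<Psi> n) k) \<union>
     (\<Union>(k, m)\<in>{(k, m). k + m \<le> n}. separated_set (\<Psi> n) k m)" for n
  have adj: "hausdorff_content s (adjacent_set (\<Psi> n) k) \<le> ennreal (12 * z ^ 2 * x ^ n)" if "k \<le> n" for n k
  proof -
    have "hausdorff_content s (adjacent_set (\<Psi> n) k) \<le> word_sum s k * ennreal (3 * z\<^sup>2 * \<Psi> n powr (- (c - e)))"
      unfolding c_def using s e(1) e2 z z1 \<Psi> by (intro content_adjacent_set)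
    also have "\<dots> \<le> ennreal (4 * exp (real n * P')) * ennreal (3 * z\<^sup>2 * \<Psi> n powr (- (c - e)))"
    proof (intro mult_right_mono order_trans[OF ws])
      show "ennreal (4 * exp (real k * P')) \<le> ennreal (4 * exp (real n * P'))"
        using that by (intro ennreal_leI) (auto simp: P'_def intro: mult_right_mono)
    qed simp
    also have "\<dots> = ennreal (12 * z ^ 2 * (exp (real n * P') * \<Psi> n powr (- (c - e))))"
      by (simp add: ennreal_mult[symmetric] mult_ac)
    finally show ?thesis by (simp only: xn)
  qed
  have sep: "hausdorff_content s (separated_set (\<Psi> n) k m) \<le> ennreal (32 * z ^ 3 * x ^ n)" if "k + m \<le> n" for n k m
  proof -
    have "hausdorff_content s (separated_set (\<Psi> n) k m)
       \<le> word_sum s k * word_sum s m * ennreal (2 * z ^ 3 * \<Psi> n powr (- (2 * s - 1 + s\<^sup>2 - 2 * e)))"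
      using s e(1) e2 z z1 \<Psi> by (intro content_separated_set)
    also have "\<dots> \<le> ennreal (4 * exp (real k * P')) * ennreal (4 * exp (real m * P')) * ennreal (2 * z ^ 3 * \<Psi> n powr (- (c - e)))"
    proof (intro mult_mono ws ennreal_leI powr_mono)
      show "- (2 * s - 1 + s\<^sup>2 - 2 * e) \<le> - (c - e)"
        using e(2) by (simp add: c_def power2_eq_square algebra_simps)
    qed (use \<Psi>[of n] z1 in auto)
    also have "\<dots> = ennreal (32 * z ^ 3 * (exp (real k * P' + real m * P') * \<Psi> n powr (- (c - e))))"
      using z1 by (simp add: ennreal_mult[symmetric] exp_add mult_ac)
    also have "\<dots> \<le> ennreal (32 * z ^ 3 * (exp (real n * P') * \<Psi> n powr (- (c - e))))"
    proof -
      have "real k * P' + real m * P' = real (k + m) * P'" by (simp add: algebra_simps)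
      also have "\<dots> \<le> real n * P'" using that by (intro mult_right_mono) (auto simp: P'_def)
      finally show ?thesis using z1 by (intro ennreal_leI mult_left_mono mult_right_mono) auto
    qed
    finally show ?thesis by (simp only: xn)
  qed
  have An: "hausdorff_content s (A n) \<le> ennreal (44 * z ^ 3 * ((real n + 1)\<^sup>2 * x ^ n))" for n
  proof -
    have fin: "finite {(k, m). k + m \<le> n}" by (rule finite_subset[of _ "{..n} \<times> {..n}"]) auto
    have card: "card {(k, m). k + m \<le> n} \<le> (n + 1)\<^sup>2"
    proof -
      have "card {(k, m). k + m \<le> n} \<le> card ({..n} \<times> {..n})" by (rule card_mono) auto
      then show ?thesis by (simp add: card_cartesian_product power2_eq_square)
    qed
    have "hausdorff_content s (A n) \<le> (\<Sum>k\<in>{..<n}. hausdorff_content s (adjacent_set (\<Psi> n) k)) +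
       (\<Sum>(k, m)\<in>{(k, m). k + m \<le> n}. hausdorff_content s (separated_set (\<Psi> n) k m))"
      unfolding A_def case_prod_unfold using fin[unfolded case_prod_unfold]
      by (intro order_trans[OF hausdorff_content_Un_le] add_mono hausdorff_content_UN_finite_le) auto
    also have "\<dots> \<le> (\<Sum>k\<in>{..<n}. ennreal (12 * z ^ 2 * x ^ n)) + (\<Sum>(k, m)\<in>{(k, m). k + m \<le> n}. ennreal (32 * z ^ 3 * x ^ n))"
      using adj sep by (intro add_mono sum_mono) auto
    also have "\<dots> = ennreal (real n * (12 * z ^ 2 * x ^ n) + real (card {(k, m). k + m \<le> n}) * (32 * z ^ 3 * x ^ n))"
      using x z1 by (simp add: ennreal_mult' ennreal_of_nat_eq_real_of_nat case_prod_unfold)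
    also have "\<dots> \<le> ennreal (44 * z ^ 3 * ((real n + 1)\<^sup>2 * x ^ n))"
    proof (intro ennreal_leI)
      have "real (card {(k, m). k + m \<le> n}) \<le> real ((n + 1)\<^sup>2)" using card by (rule of_nat_mono)
      then have "real (card {(k, m). k + m \<le> n}) * (32 * z ^ 3 * x ^ n) \<le> (real n + 1)\<^sup>2 * (32 * z ^ 3 * x ^ n)"
        using x z1 by (intro mult_right_mono) (auto simp: add.commute)
      moreover have "real n * (12 * z ^ 2 * x ^ n) \<le> (real n + 1)\<^sup>2 * (12 * z ^ 3 * x ^ n)"
      proof (intro mult_mono)
        show "real n \<le> (real n + 1)\<^sup>2" by (simp add: power2_eq_square algebra_simps)
        show "z\<^sup>2 \<le> z ^ 3" using z1 by (intro power_increasing) auto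
      qed (use x z1 in auto)
      ultimately show "real n * (12 * z ^ 2 * x ^ n) + real (card {(k, m). k + m \<le> n}) * (32 * z ^ 3 * x ^ n)
         \<le> 44 * z ^ 3 * ((real n + 1)\<^sup>2 * x ^ n)" by (simp add: algebra_simps)
    qed
    finally show ?thesis .
  qed
  obtain y where y: "x < y" "y < 1" using x dense by blast
  have "summable (\<lambda>n. (real n + 1)\<^sup>2 * x ^ n)"
  proof (rule summable_comparison_test_bigo)
    show "summable (\<lambda>n. norm (y ^ n))" using x y by (simp add: summable_geometric norm_power)
    show "(\<lambda>n. (real n + 1)\<^sup>2 * x ^ n) \<in> O(\<lambda>n. y ^ n)" using x y by real_asymp
  qed
  then have sm: "summable (\<lambda>n. 44 * z ^ 3 * ((real n + 1)\<^sup>2 * x ^ n))" by (rule summable_mult)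
  have "(\<Sum>n. hausdorff_content s (A n)) \<le> (\<Sum>n. ennreal (44 * z ^ 3 * ((real n + 1)\<^sup>2 * x ^ n)))"
    using An by (intro suminf_le) auto
  also have "\<dots> = ennreal (\<Sum>n. 44 * z ^ 3 * ((real n + 1)\<^sup>2 * x ^ n))"
    using x z1 sm by (intro suminf_ennreal2) auto
  also have "\<dots> < \<top>" by simp
  finally have "(\<Sum>n. hausdorff_content s (A n)) < \<top>" .
  moreover have "F2_set \<phi> \<subseteq> {x. \<exists>\<^sub>\<infinity>n. x \<in> A n}"
    unfolding A_def using ev by (intro F2_set_subset) (simp add: \<Psi>_def)
  ultimately show ?thesis by (intro hausdorff_content_limsup)
qed

section \<open>Upper bound for finite B > 1\<close>

lemma hausdorff_dim_le_1:
  assumes "E \<subseteq> {0..1::real}"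
  shows "hausdorff_dim E \<le> 1"
proof -
  have "hausdorff_dim E \<le> ereal 1"
  proof (rule hausdorff_dim_le)
    fix t :: real assume t: "1 < t"
    have le: "hausdorff_content t E \<le> ennreal (real (n + 2) * (1 / real (Suc n)) powr t)" for n
    proof -
      define I where "I i = {real i / real (Suc n)..(real i + 1) / real (Suc n)}" for i
      have "E \<subseteq> (\<Union>i\<in>{..Suc n}. I i)"
      proof
        fix x assume "x \<in> E"
        then have x: "0 \<le> x" "x \<le> 1" using assms by auto
        define i where "i = nat \<lfloor>x * real (Suc n)\<rfloor>"
        have "0 \<le> x * real (Suc n)" "x * real (Suc n) \<le> 1 * real (Suc n)"
          using x by (auto intro!: mult_right_mono)
        moreover from this have "\<lfloor>x * real (Suc n)\<rfloor> \<le> \<lfloor>real (Suc n)\<rfloor>" by (intro floor_mono) simp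
        then have "i \<le> Suc n" unfolding floor_of_nat i_def by linarith
        ultimately have "real i \<le> x * real (Suc n)" "x * real (Suc n) \<le> real i + 1" "i \<le> Suc n"
          unfolding i_def by linarith+
        then show "x \<in> (\<Union>i\<in>{..Suc n}. I i)"
          by (auto simp: I_def pos_divide_le_eq pos_le_divide_eq simp del: of_nat_Suc)
      qed
      then have "hausdorff_content t E \<le> hausdorff_content t (\<Union>i\<in>{..Suc n}. I i)"
        by (rule hausdorff_content_mono)
      also have "\<dots> \<le> (\<Sum>i\<in>{..Suc n}. hausdorff_content t (I i))"
        by (rule hausdorff_content_UN_finite_le) simp
      also have "\<dots> \<le> (\<Sum>i\<in>{..Suc n}. ennreal ((1 / real (Suc n)) powr t))"
      proof (intro sum_mono hausdorff_content_diam)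
        fix i x y assume "x \<in> I i" "y \<in> I i"
        then have "real i / real (Suc n) \<le> x" "x \<le> real i / real (Suc n) + 1 / real (Suc n)"
          "real i / real (Suc n) \<le> y" "y \<le> real i / real (Suc n) + 1 / real (Suc n)"
          unfolding I_def by (auto simp only: atLeastAtMost_iff add_divide_distrib)
        then show "dist x y \<le> 1 / real (Suc n)" unfolding dist_real_def by linarith
      qed (use t in auto)
      also have "\<dots> = ennreal (real (n + 2) * (1 / real (Suc n)) powr t)"
        by (simp only: sum_constant card_atMost ennreal_of_nat_eq_real_of_nat) (simp add: ennreal_mult)
      finally show ?thesis .
    qed
    have "(\<lambda>n. real (n + 2) * (1 / real (Suc n)) powr t) \<longlonglongrightarrow> 0" using t by real_asymp
    then have "(\<lambda>n. ennreal (real (n + 2) * (1 / real (Suc n)) powr t)) \<longlonglongrightarrow> ennreal 0"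
      by (rule tendsto_ennrealI)
    then have "hausdorff_content t E \<le> ennreal 0" by (rule LIMSEQ_le_const) (use le in blast)
    then show "hausdorff_content t E = 0" by simp
  qed simp
  then show ?thesis by (simp add: one_ereal_def)
qed

lemma growth_B_eventually:
  assumes "ereal r < growth_B \<phi>" "0 < r" "\<And>n. 1 \<le> n \<Longrightarrow> 0 < \<phi> n"
  shows "\<forall>\<^sub>F n in sequentially. r ^ n \<le> \<phi> n"
proof -
  have "ereal (ln r) < liminf (\<lambda>n. ereal (ln (\<phi> n) / real n))"
    using assms by (simp add: growth_B_def ereal_less_exp_ereal_iff)
  then have "\<forall>\<^sub>F n in sequentially. ereal (ln r) < ereal (ln (\<phi> n) / real n)"
    by (rule less_LiminfD)
  then show ?thesis
    using eventually_ge_at_top[of 1]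
  proof eventually_elim
    case (elim n)
    then have "real n * ln r < ln (\<phi> n)" by (simp add: pos_less_divide_eq mult.commute)
    then have "exp (real n * ln r) < exp (ln (\<phi> n))" by simp
    then show ?case using assms elim by (simp add: exp_of_nat_mult)
  qed
qed

text \<open>An admissible s may give equality. Passing to t > s makes the inequality strict, because
  3 s - 1 - s^2 increases strictly and the pressure does not increase; the slack allows replacing B
  by some b < B with b^n \<le> \<phi> n for all large n.\<close>

lemma dim_F2_le_s_B:
  assumes B: "growth_B \<phi> = ereal B" "1 < B" and pos: "\<And>n. 1 \<le> n \<Longrightarrow> 0 < \<phi> n"
  shows "hausdorff_dim (F2_set \<phi>) \<le> s_B B"
  unfolding s_B_eq
proof (rule Inf_greatest)
  fix r assume "r \<in> {ereal s | s. 1/2 < s \<and> cf_pressure s \<le> (3 * s - 1 - s\<^sup>2) * ln B}"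
  then obtain s where s: "r = ereal s" "1/2 < s" "cf_pressure s \<le> (3 * s - 1 - s\<^sup>2) * ln B" by auto
  show "hausdorff_dim (F2_set \<phi>) \<le> r"
  proof (cases "s < 1")
    case False
    have "hausdorff_dim (F2_set \<phi>) \<le> 1"
      by (rule hausdorff_dim_le_1) (auto simp: F2_set_def irrationals01_iff)
    also have "\<dots> \<le> r" using False s by (simp add: one_ereal_def)
    finally show ?thesis .
  next
    case True
    have le: "hausdorff_dim (F2_set \<phi>) \<le> ereal t" if t: "s < t" "t < 1" for t
    proof -
      have "0 < (t - s) * (3 - (t + s))" using t s by (intro mult_pos_pos) auto
      then have "3 * s - 1 - s\<^sup>2 < 3 * t - 1 - t\<^sup>2" by (simp add: power2_eq_square algebra_simps)
      then have "(3 * s - 1 - s\<^sup>2) * ln B < (3 * t - 1 - t\<^sup>2) * ln B"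
        using B by (intro mult_strict_right_mono) auto
      moreover have "cf_pressure t \<le> cf_pressure s" using s t by (intro cf_pressure_antimono) auto
      ultimately have 1: "cf_pressure t < (3 * t - 1 - t\<^sup>2) * ln B" using s by linarith
      have "((\<lambda>b. (3 * t - 1 - t\<^sup>2) * ln b) \<longlongrightarrow> (3 * t - 1 - t\<^sup>2) * ln B) (at_left B)"
        using B by (intro tendsto_intros) auto
      then have "\<forall>\<^sub>F b in at_left B. cf_pressure t < (3 * t - 1 - t\<^sup>2) * ln b"
        using 1 by (rule order_tendstoD)
      moreover have "\<forall>\<^sub>F b in at_left B. b \<in> {1<..<B}"
        using B(2) by (rule eventually_at_left_real)
      ultimately have "\<forall>\<^sub>F b in at_left B. cf_pressure t < (3 * t - 1 - t\<^sup>2) * ln b \<and> b \<in> {1<..<B}"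
        by eventually_elim auto
      then obtain b where b: "cf_pressure t < (3 * t - 1 - t\<^sup>2) * ln b" "1 < b" "b < B"
        using eventually_happens[of _ "at_left B"] by (auto simp: trivial_limit_at_left_real)
      have "\<forall>\<^sub>F n in sequentially. b ^ n \<le> \<phi> n"
        using B b pos by (intro growth_B_eventually) auto
      then have "hausdorff_content t (F2_set \<phi>) = 0"
        using s t b by (intro content_F2_exponential[of t b]) auto
      then have "hausdorff_measure t (F2_set \<phi>) = 0"
        using s t by (intro hausdorff_measure_eq_0) auto
      then show ?thesis unfolding hausdorff_dim_def using s t by (intro Inf_lower) auto
    qed
    show ?thesis
      unfolding s(1)
    proof (rule ereal_le_epsilon2)
      fix d :: real assume "0 < d"
      define t where "t = min (s + d) ((s + 1) / 2)"
      have "s < t" "t < 1" "t \<le> s + d" using True \<open>0 < d\<close> by (auto simp: t_def min_less_iff_disj)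
      then show "hausdorff_dim (F2_set \<phi>) \<le> ereal s + ereal d"
        using le[of t] by (auto intro: order_trans)
    qed
  qed
qed

section \<open>Infinite concatenations of words\<close>

lemma gauss_map_fraction:
  assumes "0 < a" "a < b"
  shows "gauss_map (real a / real b) = real (b mod a) / real a"
proof -
  have "1 / (real a / real b) = real b / real a" by simp
  moreover have "frac (real b / real a) = real (b mod a) / real a"
  proof -
    have "real b = real a * real (b div a) + real (b mod a)"
      by (metis mult_div_mod_eq of_nat_add of_nat_mult)
    then have "real b / real a = real (b div a) + real (b mod a) / real a"
      using assms by (simp add: field_simps)
    moreover have "0 \<le> real (b mod a) / real a" "real (b mod a) / real a < 1" using assms by auto
    ultimately show ?thesis unfolding frac_unique_iff by auto
  qed
  ultimately show ?thesis using assms by (simp add: gauss_map_def)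
qed

text \<open>On fractions the Gauss map is one step of the Euclidean algorithm: the numerator becomes
  a remainder and decreases. Orbits that avoid 0 therefore certify irrationality.\<close>

lemma gauss_orbit_of_fraction:
  assumes "a < b"
  shows "\<exists>n. (gauss_map ^^ n) (real a / real b) = 0"
  using assms
proof (induction a arbitrary: b rule: less_induct)
  case (less a)
  show ?case
  proof (cases "a = 0")
    case True
    then show ?thesis by (intro exI[of _ 0]) simp
  next
    case False
    then have "b mod a < a" by simp
    from less.IH[OF this this] obtain n where "(gauss_map ^^ n) (real (b mod a) / real a) = 0" by blast
    then show ?thesis using gauss_map_fraction[of a b] False less.prems
      by (intro exI[of _ "Suc n"]) (simp add: funpow_Suc_right del: funpow.simps)
  qed
qed

lemma irrational_if_gauss_orbit_nonzero:
  assumes "0 < x" "x < 1" "\<And>n. (gauss_map ^^ n) x \<noteq> 0"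
  shows "x \<in> irrationals01"
proof -
  have "x \<notin> \<rat>"
  proof
    assume "x \<in> \<rat>"
    then obtain a b :: nat where ab: "b \<noteq> 0" "\<bar>x\<bar> = real a / real b" by (rule Rats_abs_nat_div_natE)
    then have "x = real a / real b" using assms by simp
    moreover from this have "a < b"
      using assms ab mult_strict_right_mono[of x 1 "real b"] by (simp add: field_simps)
    ultimately show False using gauss_orbit_of_fraction[of a b] assms by blast
  qed
  then show ?thesis using assms by (simp add: irrationals01_iff)
qed

lemma cf_branch_mono:
  assumes "pos_word w" "0 \<le> x" "x \<le> y"
  shows "if even (length w) then cf_branch w x \<le> cf_branch w y else cf_branch w y \<le> cf_branch w x"
  using assms(1)
proof (induction w)
  case (Cons a w)
  have nn: "0 \<le> cf_branch w u" if "0 \<le> u" for u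
    using Cons(2) that
  proof (induction w)
    case (Cons b v)
    then show ?case by (auto intro!: divide_nonneg_nonneg add_nonneg_nonneg)
  qed auto
  have "0 < real a + cf_branch w x" "0 < real a + cf_branch w y"
    using nn[of x] nn[of y] Cons assms by (auto intro!: add_pos_nonneg)
  then show ?case using Cons by (auto intro!: divide_left_mono mult_pos_pos)
qed (use assms in auto)

lemma continuous_on_cf_branch:
  assumes "pos_word w"
  shows "continuous_on {0..1} (cf_branch w)"
proof (rule continuous_onI)
  fix x e :: real assume x: "x \<in> {0..1}" "0 < e"
  have q: "1 \<le> cf_den w 0" using cf_den_ge_1 assms by auto
  show "\<exists>d>0. \<forall>y\<in>{0..1}. dist y x < d \<longrightarrow> dist (cf_branch w y) (cf_branch w x) \<le> e"
  proof (intro exI conjI ballI impI)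
    fix y :: real assume y: "y \<in> {0..1}" "dist y x < e"
    have "\<bar>cf_branch w y - cf_branch w x\<bar> \<le> \<bar>y - x\<bar> / (cf_den w 0)\<^sup>2"
      using x y assms by (intro cf_branch_diff_le) auto
    also have "\<dots> \<le> \<bar>y - x\<bar> / 1" using q by (intro divide_left_mono) auto
    finally show "dist (cf_branch w y) (cf_branch w x) \<le> e" using y by (simp add: dist_real_def)
  qed fact
qed

text \<open>A point closer to \<open>cf_branch w y\<close> than both end values of the monotone
  branch lies in its image by the intermediate value theorem; strictness excludes the end points. So
  points that close share the digits w.\<close>

lemma cf_branch_ball:
  assumes w: "pos_word w" and y: "0 \<le> y" "y \<le> 1"
    and r: "\<bar>z - cf_branch w y\<bar> < \<bar>cf_branch w y - cf_branch w 0\<bar>"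
       "\<bar>z - cf_branch w y\<bar> < \<bar>cf_branch w y - cf_branch w 1\<bar>"
  shows "\<exists>u. 0 < u \<and> u < 1 \<and> cf_branch w u = z"
proof -
  note c = continuous_on_cf_branch[OF w]
  have "\<exists>u. 0 \<le> u \<and> u \<le> 1 \<and> cf_branch w u = z"
  proof (cases "even (length w)")
    case True
    then have "cf_branch w 0 \<le> cf_branch w y" "cf_branch w y \<le> cf_branch w 1"
      using cf_branch_mono[OF w, of 0 y] cf_branch_mono[OF w, of y 1] y by auto
    then have "cf_branch w 0 \<le> z" "z \<le> cf_branch w 1" using r by linarith+
    from IVT'[OF this _ c] show ?thesis by auto
  next
    case False
    then have "cf_branch w y \<le> cf_branch w 0" "cf_branch w 1 \<le> cf_branch w y"
      using cf_branch_mono[OF w, of 0 y] cf_branch_mono[OF w, of y 1] y by auto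
    then have "z \<le> cf_branch w 0" "cf_branch w 1 \<le> z" using r by linarith+
    from IVT2'[OF this(2,1) _ c] show ?thesis by auto
  qed
  then obtain u where u: "0 \<le> u" "u \<le> 1" "cf_branch w u = z" by blast
  moreover have "u \<noteq> 0" "u \<noteq> 1" using u r by (auto simp: abs_minus_commute)
  ultimately show ?thesis by (intro exI[of _ u]) auto
qed

section \<open>Points defined by infinite sequences of nonempty words\<close>

definition good_seq :: "(nat \<Rightarrow> nat list) \<Rightarrow> bool" where
  "good_seq \<omega> \<longleftrightarrow> (\<forall>j. pos_word (\<omega> j) \<and> \<omega> j \<noteq> [])"

definition prefix_word :: "(nat \<Rightarrow> nat list) \<Rightarrow> nat \<Rightarrow> nat list" where
  "prefix_word \<omega> j = concat (map \<omega> [0..<j])"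

definition shift_seq :: "nat \<Rightarrow> (nat \<Rightarrow> 'b) \<Rightarrow> nat \<Rightarrow> 'b" where
  "shift_seq j \<omega> i = \<omega> (j + i)"

definition cf_limit :: "(nat \<Rightarrow> nat list) \<Rightarrow> real" where
  "cf_limit \<omega> = lim (\<lambda>j. cf_branch (prefix_word \<omega> j) 0)"

lemma prefix_word_0 [simp]: "prefix_word \<omega> 0 = []"
  by (simp add: prefix_word_def)

lemma prefix_word_Suc: "prefix_word \<omega> (Suc j) = prefix_word \<omega> j @ \<omega> j"
  by (simp add: prefix_word_def)

lemma prefix_word_add: "prefix_word \<omega> (j + k) = prefix_word \<omega> j @ prefix_word (shift_seq j \<omega>) k"
  by (induction k) (auto simp: prefix_word_Suc shift_seq_def)

lemma good_seq_shift: "good_seq \<omega> \<Longrightarrow> good_seq (shift_seq j \<omega>)"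
  by (auto simp: good_seq_def shift_seq_def)

lemma pos_word_prefix: "good_seq \<omega> \<Longrightarrow> pos_word (prefix_word \<omega> j)"
  by (induction j) (auto simp: prefix_word_Suc good_seq_def)

lemma length_prefix_ge: "good_seq \<omega> \<Longrightarrow> j \<le> length (prefix_word \<omega> j)"
proof (induction j)
  case (Suc j)
  then have "1 \<le> length (\<omega> j)" by (auto simp: good_seq_def Suc_le_eq)
  then show ?case using Suc by (simp add: prefix_word_Suc)
qed simp

lemma cf_den_prefix_ge:
  assumes "good_seq \<omega>"
  shows "2 ^ (j div 2) \<le> cf_den (prefix_word \<omega> j) 0"
proof -
  have "(2::real) ^ (j div 2) \<le> 2 ^ (length (prefix_word \<omega> j) div 2)"
    using length_prefix_ge[OF assms, of j] by (intro power_increasing div_le_mono) auto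
  also have "\<dots> \<le> cf_den (prefix_word \<omega> j) 0" using pos_word_prefix[OF assms] by (rule cf_den_exp_growth)
  finally show ?thesis .
qed

lemma inverse_den_prefix_tendsto:
  assumes "good_seq \<omega>"
  shows "(\<lambda>j. 1 / (cf_den (prefix_word \<omega> j) 0)\<^sup>2) \<longlonglongrightarrow> 0"
proof (rule tendsto_sandwich[OF _ _ tendsto_const])
  have "filterlim (\<lambda>j. j div 2) sequentially sequentially"
    by (rule filterlim_at_top_div_const_nat) simp
  moreover have "(\<lambda>j. (1/2) ^ j :: real) \<longlonglongrightarrow> 0" by (rule LIMSEQ_power_zero) simp
  ultimately show "(\<lambda>j. (1/2) ^ (j div 2) :: real) \<longlonglongrightarrow> 0" by (rule filterlim_compose[rotated])
  have "1 / (cf_den (prefix_word \<omega> j) 0)\<^sup>2 \<le> (1/2) ^ (j div 2)" for j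
  proof -
    define q where "q = cf_den (prefix_word \<omega> j) 0"
    have q: "2 ^ (j div 2) \<le> q" unfolding q_def by (rule cf_den_prefix_ge[OF assms])
    have "(1::real) \<le> 2 ^ (j div 2)" by simp
    then have "1 \<le> q" using q by linarith
    then have "q * 1 \<le> q * q" by (intro mult_left_mono) auto
    then have "2 ^ (j div 2) \<le> q\<^sup>2" using q by (simp add: power2_eq_square)
    then have "1 / q\<^sup>2 \<le> 1 / 2 ^ (j div 2)" using \<open>1 \<le> q\<close> by (intro divide_left_mono) auto
    then show ?thesis by (simp add: q_def power_divide)
  qed
  then show "\<forall>\<^sub>F j in sequentially. 1 / (cf_den (prefix_word \<omega> j) 0)\<^sup>2 \<le> (1/2) ^ (j div 2)" by simp
qed simp

lemma cf_limit_tendsto: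
  assumes "good_seq \<omega>"
  shows "(\<lambda>j. cf_branch (prefix_word \<omega> j) 0) \<longlonglongrightarrow> cf_limit \<omega>"
proof -
  have step: "\<bar>cf_branch (prefix_word \<omega> (j + k)) 0 - cf_branch (prefix_word \<omega> j) 0\<bar>
       \<le> 1 / (cf_den (prefix_word \<omega> j) 0)\<^sup>2" for j k
  proof -
    define y where "y = cf_branch (prefix_word (shift_seq j \<omega>) k) 0"
    have y: "0 \<le> y" "y \<le> 1"
      unfolding y_def using assms by (auto intro!: cf_branch_range pos_word_prefix good_seq_shift)
    have "\<bar>cf_branch (prefix_word \<omega> (j + k)) 0 - cf_branch (prefix_word \<omega> j) 0\<bar>
      \<le> \<bar>y - 0\<bar> / (cf_den (prefix_word \<omega> j) 0)\<^sup>2"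
      unfolding prefix_word_add cf_branch_append y_def[symmetric]
      using y assms by (intro cf_branch_diff_le pos_word_prefix) auto
    also have "\<dots> \<le> 1 / (cf_den (prefix_word \<omega> j) 0)\<^sup>2"
      using y by (intro divide_right_mono) auto
    finally show ?thesis .
  qed
  have "Cauchy (\<lambda>j. cf_branch (prefix_word \<omega> j) 0)"
  proof (rule metric_CauchyI)
    fix e :: real assume "0 < e"
    then have "\<forall>\<^sub>F j in sequentially. 1 / (cf_den (prefix_word \<omega> j) 0)\<^sup>2 < e / 2"
      using inverse_den_prefix_tendsto[OF assms] by (intro order_tendstoD(2)) auto
    then obtain j where j: "1 / (cf_den (prefix_word \<omega> j) 0)\<^sup>2 < e / 2"
      by (auto simp: eventually_sequentially)
    show "\<exists>M. \<forall>m\<ge>M. \<forall>n\<ge>M. dist (cf_branch (prefix_word \<omega> m) 0) (cf_branch (prefix_word \<omega> n) 0) < e"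
    proof (intro exI allI impI)
      fix m n assume mn: "j \<le> m" "j \<le> n"
      show "dist (cf_branch (prefix_word \<omega> m) 0) (cf_branch (prefix_word \<omega> n) 0) < e"
        using step[of j "m - j"] step[of j "n - j"] mn j by (simp add: dist_real_def)
    qed
  qed
  then show ?thesis
    unfolding cf_limit_def by (simp add: Cauchy_convergent_iff convergent_LIMSEQ_iff)
qed

lemma cf_limit_range:
  assumes "good_seq \<omega>"
  shows "0 \<le> cf_limit \<omega>" "cf_limit \<omega> \<le> 1"
proof -
  have "0 \<le> cf_branch (prefix_word \<omega> j) 0" "cf_branch (prefix_word \<omega> j) 0 \<le> 1" for j
    using assms by (auto intro!: cf_branch_range pos_word_prefix)
  then show "0 \<le> cf_limit \<omega>" "cf_limit \<omega> \<le> 1"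
    using cf_limit_tendsto[OF assms] by (auto intro: LIMSEQ_le_const LIMSEQ_le_const2)
qed

lemma cf_limit_shift:
  assumes "good_seq \<omega>"
  shows "cf_limit \<omega> = cf_branch (prefix_word \<omega> j) (cf_limit (shift_seq j \<omega>))"
proof (rule LIMSEQ_unique)
  show "(\<lambda>k. cf_branch (prefix_word \<omega> (k + j)) 0) \<longlonglongrightarrow> cf_limit \<omega>"
    using cf_limit_tendsto[OF assms] by (rule LIMSEQ_ignore_initial_segment)
  have "(\<lambda>k. cf_branch (prefix_word \<omega> j) (cf_branch (prefix_word (shift_seq j \<omega>) k) 0))
      \<longlonglongrightarrow> cf_branch (prefix_word \<omega> j) (cf_limit (shift_seq j \<omega>))"
  proof (rule continuous_on_tendsto_compose[OF continuous_on_cf_branch[OF pos_word_prefix[OF assms]]])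
    show "(\<lambda>k. cf_branch (prefix_word (shift_seq j \<omega>) k) 0) \<longlonglongrightarrow> cf_limit (shift_seq j \<omega>)"
      using assms by (intro cf_limit_tendsto good_seq_shift)
    show "cf_limit (shift_seq j \<omega>) \<in> {0..1}"
      using cf_limit_range[OF good_seq_shift[OF assms]] by auto
    show "\<forall>\<^sub>F k in sequentially. cf_branch (prefix_word (shift_seq j \<omega>) k) 0 \<in> {0..1}"
      using assms by (auto intro!: always_eventually cf_branch_range pos_word_prefix good_seq_shift)
  qed
  then show "(\<lambda>k. cf_branch (prefix_word \<omega> (k + j)) 0) \<longlonglongrightarrow> cf_branch (prefix_word \<omega> j) (cf_limit (shift_seq j \<omega>))"
    by (simp add: add.commute[of _ j] prefix_word_add cf_branch_append)
qed

lemma cf_limit_strict: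
  assumes "good_seq \<omega>"
  shows "0 < cf_limit \<omega>" "cf_limit \<omega> < 1"
proof -
  have ex: "\<exists>a v. \<omega> 0 = a # v \<and> 1 \<le> a \<and> pos_word v" if "good_seq \<omega>" for \<omega>
  proof -
    have "pos_word (\<omega> 0)" "\<omega> 0 \<noteq> []" using that by (auto simp: good_seq_def)
    then show ?thesis by (cases "\<omega> 0") auto
  qed
  have eq: "cf_limit \<omega> = cf_branch (\<omega> 0) (cf_limit (shift_seq 1 \<omega>))" if "good_seq \<omega>" for \<omega>
    using cf_limit_shift[OF that, of 1] by (simp add: prefix_word_def)
  have pos: "0 < cf_limit \<omega>" if g: "good_seq \<omega>" for \<omega>
  proof -
    obtain a v where a: "\<omega> 0 = a # v" "1 \<le> a" "pos_word v" using ex[OF g] by blast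
    have "0 \<le> cf_branch v (cf_limit (shift_seq 1 \<omega>))"
      using cf_limit_range[OF good_seq_shift[OF g]] a by (intro cf_branch_range) auto
    then show ?thesis unfolding eq[OF g] a(1) using a(2) by (auto intro!: divide_pos_pos add_pos_nonneg)
  qed
  then show "0 < cf_limit \<omega>" using assms .
  obtain a v where a: "\<omega> 0 = a # v" "1 \<le> a" "pos_word v" using ex[OF assms] by blast
  have "0 < cf_branch v (cf_limit (shift_seq 1 \<omega>))"
    using a pos[OF good_seq_shift[OF assms]] by (intro cf_branch_pos)
  then show "cf_limit \<omega> < 1" unfolding eq[OF assms] a(1) using a(2) by (auto simp: divide_simps)
qed

text \<open>At arbitrarily late times the orbit equals the limit of a shifted sequence, which is
  positive; a zero of the orbit would persist because T fixes 0.\<close>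

lemma cf_limit_irrational:
  assumes "good_seq \<omega>"
  shows "cf_limit \<omega> \<in> irrationals01"
proof (rule irrational_if_gauss_orbit_nonzero)
  fix n
  define m where "m = length (prefix_word \<omega> n)"
  have m: "n \<le> m" unfolding m_def by (rule length_prefix_ge[OF assms])
  have s: "0 < cf_limit (shift_seq n \<omega>)" "cf_limit (shift_seq n \<omega>) < 1"
    using cf_limit_strict[OF good_seq_shift[OF assms]] by auto
  have "(gauss_map ^^ m) (cf_limit \<omega>) = cf_limit (shift_seq n \<omega>)"
    unfolding cf_limit_shift[OF assms, of n] m_def
    using s assms by (subst gauss_iterate_cf_branch) (auto intro: pos_word_prefix)
  then have ne: "(gauss_map ^^ m) (cf_limit \<omega>) \<noteq> 0" using s by simp
  show "(gauss_map ^^ n) (cf_limit \<omega>) \<noteq> 0"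
  proof
    assume 0: "(gauss_map ^^ n) (cf_limit \<omega>) = 0"
    have "(gauss_map ^^ k) 0 = 0" for k by (induction k) (auto simp: gauss_map_def)
    then have "(gauss_map ^^ (m - n)) ((gauss_map ^^ n) (cf_limit \<omega>)) = 0" using 0 by simp
    then show False using ne m funpow_add[of "m - n" n gauss_map] by simp
  qed
qed (use cf_limit_strict[OF assms] in auto)

lemma partial_quotient_cf_limit:
  assumes "good_seq \<omega>" "i < length (prefix_word \<omega> j)"
  shows "partial_quotient (Suc i) (cf_limit \<omega>) = prefix_word \<omega> j ! i"
  unfolding cf_limit_shift[OF assms(1), of j]
  using assms cf_limit_strict[OF good_seq_shift[OF assms(1)]]
  by (intro partial_quotient_cf_branch pos_word_prefix)

lemma cf_digits_cf_limit:
  assumes "good_seq \<omega>"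
  shows "cf_digits (length (prefix_word \<omega> j)) (cf_limit \<omega>) = prefix_word \<omega> j"
  by (rule nth_equalityI) (auto simp: cf_digits_def partial_quotient_cf_limit[OF assms])

lemma cf_digits_cf_branch:
  assumes "pos_word w" "0 < x" "x < 1"
  shows "cf_digits (length w) (cf_branch w x) = w"
  by (rule nth_equalityI) (auto simp: cf_digits_def partial_quotient_cf_branch[OF assms])

section \<open>Random continued fractions\<close>

text \<open>A random continued fraction built from independent words. A step either chooses among words
  of comparable probability or a single digit uniformly from \<open>{T..<2 * T}\<close>; \<open>t j\<close> is the size of
  the first digit chosen at step \<open>j\<close>.\<close>

locale random_cf =
  fixes p :: "nat \<Rightarrow> nat list pmf" and len :: "nat \<Rightarrow> nat" and t f :: "nat \<Rightarrow> real"
    and s A \<Lambda> C :: real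
  assumes s: "0 < s" "s \<le> 1"
    and A: "1 \<le> A" and \<Lambda>: "0 \<le> \<Lambda>" and C: "0 < C" and t: "\<And>j. 1 \<le> t j"
    and word: "\<And>j w. w \<in> set_pmf (p j) \<Longrightarrow> pos_word w \<and> length w = len j \<and> w \<noteq> []"
    and location: "\<And>j w y. w \<in> set_pmf (p j) \<Longrightarrow> 0 \<le> y \<Longrightarrow> y \<le> 1 \<Longrightarrow>
       1 / (A * t j) \<le> cf_branch w y \<and> cf_branch w y \<le> 1 - 1 / A"
    and step: "\<And>j. (\<forall>w\<in>set_pmf (p j). 1 \<le> \<Lambda> * pmf (p j) w) \<or>
       (\<exists>T\<ge>1. t j = real T \<and> p j = map_pmf (\<lambda>a. [a]) (pmf_of_set {T..<2 * T}))"
    and weight: "\<And>j w. w \<in> set_pmf (p j) \<Longrightarrow> pmf (p j) w * (2 * cf_den w 0) powr (2 * s) \<le> f j"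
    and budget: "\<And>j. (\<Prod>i<j. f i) * t j powr s \<le> C"
begin

definition M :: "(nat \<Rightarrow> nat list) measure" where
  "M = (\<Pi>\<^sub>M j\<in>UNIV. measure_pmf (p j))"

definition support :: "(nat \<Rightarrow> nat list) set" where
  "support = {\<omega>. \<forall>j. \<omega> j \<in> set_pmf (p j)}"

lemma prob_space_M: "prob_space M"
  unfolding M_def by (intro prob_space_PiM measure_pmf.prob_space_axioms)

lemma space_M [simp]: "space M = UNIV"
  by (simp add: M_def space_PiM)

lemma good_seq_support: "\<omega> \<in> support \<Longrightarrow> good_seq \<omega>"
  using word by (auto simp: support_def good_seq_def)

lemma AE_support: "AE \<omega> in M. \<omega> \<in> support"
proof -
  interpret product_prob_space "\<lambda>j. measure_pmf (p j)" UNIV by unfold_locales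
  have "AE \<omega> in M. \<omega> j \<in> set_pmf (p j)" for j
    unfolding M_def by (rule AE_component) (auto simp: AE_measure_pmf_iff)
  then show ?thesis unfolding support_def by (simp add: AE_all_countable)
qed

lemma component_measurable: "(\<lambda>\<omega>. g (\<omega> j)) \<in> M \<rightarrow>\<^sub>M count_space UNIV"
proof -
  have "(\<lambda>\<omega>. \<omega> j) \<in> M \<rightarrow>\<^sub>M measure_pmf (p j)"
    unfolding M_def by (rule measurable_component_singleton) simp
  then show ?thesis by (rule measurable_compose) simp
qed

lemma prefix_measurable: "(\<lambda>\<omega>. prefix_word \<omega> j) \<in> M \<rightarrow>\<^sub>M count_space UNIV"
proof (induction j)
  case (Suc j)
  show ?case
    unfolding prefix_word_Suc
    by (rule measurable_compose_countable[OF component_measurable[of _ j] Suc, of "\<lambda>u v. u @ v"])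
qed simp

lemma cf_limit_measurable: "cf_limit \<in> borel_measurable M"
proof -
  have "(\<lambda>\<omega>. cf_branch (prefix_word \<omega> j) 0) \<in> borel_measurable M" for j
    using prefix_measurable[of j] by (rule measurable_compose) simp
  then have "(\<lambda>\<omega>. lim (\<lambda>j. cf_branch (prefix_word \<omega> j) 0)) \<in> borel_measurable M"
    by (rule borel_measurable_lim_metric)
  then show ?thesis by (simp add: cf_limit_def[abs_def])
qed

definition mass :: "(nat \<Rightarrow> nat list) \<Rightarrow> nat \<Rightarrow> real" where
  "mass \<omega> j = (\<Prod>i<j. pmf (p i) (\<omega> i))"

lemma agree_event: "{\<omega>. \<forall>i<j. \<omega> i = v i} \<in> sets M"
proof -
  have "{\<omega>. \<omega> i = v i} \<in> sets M" for i
    using measurable_sets[OF component_measurable[of "\<lambda>w. w" i], of "{v i}"]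
    by (simp add: vimage_def)
  then have "(\<Inter>i\<in>{..<j}. {\<omega>. \<omega> i = v i}) \<inter> space M \<in> sets M"
    using sets.top[of M] by (cases "j = 0") (auto intro!: sets.finite_INT)
  moreover have "(\<Inter>i\<in>{..<j}. {\<omega>. \<omega> i = v i}) \<inter> space M = {\<omega>. \<forall>i<j. \<omega> i = v i}" by auto
  ultimately show ?thesis by simp
qed

lemma prob_agree: "measure M {\<omega>. \<forall>i<j. \<omega> i = v i} = mass v j"
proof -
  interpret product_prob_space "\<lambda>j. measure_pmf (p j)" UNIV by unfold_locales
  have "emeasure M {x \<in> space M. \<forall>i\<in>{..<j}. x i \<in> {v i}} = (\<Prod>i\<in>{..<j}. emeasure (measure_pmf (p i)) {v i})"
    unfolding M_def by (rule emeasure_PiM_Collect) auto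
  also have "\<dots> = ennreal (mass v j)"
    unfolding mass_def emeasure_pmf_single by (rule prod_ennreal) simp
  finally show ?thesis by (simp add: measure_def mass_def prod_nonneg lessThan_def)
qed

text \<open>Mass times q^(2 s) is multiplicative along the steps up to the constant 2 of
  quasi-multiplicativity. The 2 in \<open>weight\<close> pays for it at each step, so nothing
  accumulates beyond the factors f i.\<close>

lemma mass_le:
  assumes "\<omega> \<in> support"
  shows "mass \<omega> j * cf_den (prefix_word \<omega> j) 0 powr (2 * s) \<le> (\<Prod>i<j. f i)"
proof (induction j)
  case (Suc j)
  have w: "\<omega> j \<in> set_pmf (p j)" using assms by (auto simp: support_def)
  have pw: "pos_word (prefix_word \<omega> j)" "pos_word (\<omega> j)"
    using pos_word_prefix[OF good_seq_support[OF assms]] word[OF w] by auto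
  have q: "1 \<le> cf_den (prefix_word \<omega> j) 0" "1 \<le> cf_den (\<omega> j) 0" "1 \<le> cf_den (prefix_word \<omega> (Suc j)) 0"
    using pw pos_word_prefix[OF good_seq_support[OF assms], of "Suc j"] by (auto intro!: cf_den_ge_1)
  have "cf_den (prefix_word \<omega> (Suc j)) 0 \<le> cf_den (prefix_word \<omega> j) 0 * (2 * cf_den (\<omega> j) 0)"
    using cf_den_append_bounds(2)[OF pw] by (simp add: prefix_word_Suc mult_ac)
  then have "cf_den (prefix_word \<omega> (Suc j)) 0 powr (2 * s)
     \<le> (cf_den (prefix_word \<omega> j) 0 * (2 * cf_den (\<omega> j) 0)) powr (2 * s)"
    using s q by (intro powr_mono2) auto
  also have "\<dots> = cf_den (prefix_word \<omega> j) 0 powr (2 * s) * (2 * cf_den (\<omega> j) 0) powr (2 * s)"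
    by (rule powr_mult)
  finally have "mass \<omega> (Suc j) * cf_den (prefix_word \<omega> (Suc j)) 0 powr (2 * s)
     \<le> mass \<omega> (Suc j) * (cf_den (prefix_word \<omega> j) 0 powr (2 * s) * (2 * cf_den (\<omega> j) 0) powr (2 * s))"
    by (intro mult_left_mono) (auto simp: mass_def prod_nonneg)
  also have "\<dots> = (mass \<omega> j * cf_den (prefix_word \<omega> j) 0 powr (2 * s)) * (pmf (p j) (\<omega> j) * (2 * cf_den (\<omega> j) 0) powr (2 * s))"
    by (simp add: mass_def mult_ac)
  also have "\<dots> \<le> (\<Prod>i<j. f i) * f j"
  proof (intro mult_mono Suc.IH weight[OF w])
    have "0 \<le> mass \<omega> j * cf_den (prefix_word \<omega> j) 0 powr (2 * s)" by (auto simp: mass_def prod_nonneg)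
    then show "0 \<le> (\<Prod>i<j. f i)" using Suc.IH by linarith
  qed auto
  finally show ?case by simp
qed (simp add: mass_def)

text \<open>Within this distance two points of the construction share the words before step j:
  \<open>location\<close> keeps the continuation at least 1 / (A t) away from both ends of the unit
  interval, and the branch of the prefix shrinks distances at most by 4 q^2.\<close>

definition radius :: "(nat \<Rightarrow> nat list) \<Rightarrow> nat \<Rightarrow> real" where
  "radius \<omega> j = 1 / (4 * A * t j * (cf_den (prefix_word \<omega> j) 0)\<^sup>2)"

text \<open>The scale at which step j becomes visible is shorter than the prefix cylinder by a
  factor of order t j, as a digit of that size pushes the continuation towards 0. The factor
  \<open>t j powr s\<close> in \<open>budget\<close> is this loss.\<close>

lemma mass_le_radius:
  assumes "\<omega> \<in> support"
  shows "mass \<omega> j \<le> C * (4 * A) powr s * radius \<omega> j powr s"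
proof -
  define q where "q = cf_den (prefix_word \<omega> j) 0"
  have q: "1 \<le> q" unfolding q_def using pos_word_prefix[OF good_seq_support[OF assms]] by (auto intro!: cf_den_ge_1)
  have tj: "0 < t j" using t[of j] by simp
  have "mass \<omega> j * q powr (2 * s) * t j powr s \<le> (\<Prod>i<j. f i) * t j powr s"
    unfolding q_def using mass_le[OF assms] by (intro mult_right_mono) auto
  also have "\<dots> \<le> C" by (rule budget)
  finally have "mass \<omega> j * (q powr (2 * s) * t j powr s) \<le> C" by (simp add: mult_ac)
  then have "mass \<omega> j \<le> C / (q powr (2 * s) * t j powr s)" using q tj by (simp add: pos_le_divide_eq)
  also have "q powr (2 * s) * t j powr s = (q\<^sup>2 * t j) powr s"
  proof -
    have "(q\<^sup>2) powr s = q powr (2 * s)" using q by (simp add: powr_powr flip: powr_numeral)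
    then show ?thesis by (simp add: powr_mult)
  qed
  also have "C / (q\<^sup>2 * t j) powr s = C * ((4 * A) * radius \<omega> j) powr s"
  proof -
    have "(4 * A) * radius \<omega> j = 1 / (q\<^sup>2 * t j)" using A by (simp add: radius_def q_def)
    then show ?thesis by (simp add: powr_divide)
  qed
  finally show ?thesis by (simp add: powr_mult mult.assoc)
qed

lemma radius_tendsto: "\<omega> \<in> support \<Longrightarrow> radius \<omega> \<longlonglongrightarrow> 0"
proof -
  assume w: "\<omega> \<in> support"
  show ?thesis
  proof (rule tendsto_sandwich[OF _ _ tendsto_const inverse_den_prefix_tendsto[OF good_seq_support[OF w]]])
    have "0 \<le> radius \<omega> j \<and> radius \<omega> j \<le> 1 / (cf_den (prefix_word \<omega> j) 0)\<^sup>2" for j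
    proof -
      define q where "q = cf_den (prefix_word \<omega> j) 0"
      have q: "1 \<le> q" unfolding q_def using pos_word_prefix[OF good_seq_support[OF w]] by (auto intro!: cf_den_ge_1)
      have "1 \<le> 4 * A * t j" using mult_mono[of 1 "4 * A" 1 "t j"] A t[of j] by simp
      then have "1 * q\<^sup>2 \<le> 4 * A * t j * q\<^sup>2" by (intro mult_right_mono) auto
      then show ?thesis using q A t[of j] by (auto simp: radius_def q_def[symmetric] intro!: divide_left_mono mult_pos_pos)
    qed
    then show "\<forall>\<^sub>F j in sequentially. 0 \<le> radius \<omega> j"
      "\<forall>\<^sub>F j in sequentially. radius \<omega> j \<le> 1 / (cf_den (prefix_word \<omega> j) 0)\<^sup>2" by auto
  qed
qed

lemma length_prefix_word: "\<omega> \<in> support \<Longrightarrow> length (prefix_word \<omega> j) = (\<Sum>i<j. len i)"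
  by (induction j) (use word in \<open>auto simp: prefix_word_Suc support_def\<close>)

lemma prefix_word_eq_imp:
  assumes "\<omega> \<in> support" "\<omega>' \<in> support" "prefix_word \<omega> j = prefix_word \<omega>' j" "i < j"
  shows "\<omega> i = \<omega>' i"
  using assms(3,4)
proof (induction j)
  case (Suc j)
  have "length (prefix_word \<omega> j) = length (prefix_word \<omega>' j)" using assms by (simp add: length_prefix_word)
  then have "prefix_word \<omega> j = prefix_word \<omega>' j" "\<omega> j = \<omega>' j" using Suc.prems by (auto simp: prefix_word_Suc)
  then show ?case using Suc by (cases "i = j") auto
qed simp

lemma shift_location:
  assumes "\<omega> \<in> support"
  shows "cf_limit (shift_seq j \<omega>) = cf_branch (\<omega> j) (cf_limit (shift_seq (Suc j) \<omega>))"
    and "1 / (A * t j) \<le> cf_limit (shift_seq j \<omega>)" "cf_limit (shift_seq j \<omega>) \<le> 1 - 1 / A"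
proof -
  have g: "good_seq (shift_seq j \<omega>)" "good_seq (shift_seq (Suc j) \<omega>)"
    using good_seq_support[OF assms] good_seq_shift by auto
  have "shift_seq 1 (shift_seq j \<omega>) = shift_seq (Suc j) \<omega>" by (auto simp: shift_seq_def)
  then show eq: "cf_limit (shift_seq j \<omega>) = cf_branch (\<omega> j) (cf_limit (shift_seq (Suc j) \<omega>))"
    using cf_limit_shift[OF g(1), of 1] by (simp add: prefix_word_def shift_seq_def)
  have "\<omega> j \<in> set_pmf (p j)" using assms by (auto simp: support_def)
  from location[OF this cf_limit_range[OF g(2)]]
  show "1 / (A * t j) \<le> cf_limit (shift_seq j \<omega>)" "cf_limit (shift_seq j \<omega>) \<le> 1 - 1 / A"
    unfolding eq by auto
qed

text \<open>The other point stays in the image of the branch of the prefix and so has its digits.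
  Word lengths depend only on the step, hence equal digits are cut into equal words.\<close>

lemma close_imp_agree:
  assumes \<omega>: "\<omega> \<in> support" "\<omega>' \<in> support" and r: "\<bar>cf_limit \<omega>' - cf_limit \<omega>\<bar> < radius \<omega> j" and i: "i < j"
  shows "\<omega>' i = \<omega> i"
proof -
  define v where "v = prefix_word \<omega> j"
  define y where "y = cf_limit (shift_seq j \<omega>)"
  note g = good_seq_support[OF \<omega>(1)] good_seq_support[OF \<omega>(2)]
  have v: "pos_word v" using pos_word_prefix[OF g(1)] by (simp add: v_def)
  have q: "1 \<le> cf_den v 0" using v by (auto intro!: cf_den_ge_1)
  have y: "0 \<le> y" "y \<le> 1" using cf_limit_range[OF good_seq_shift[OF g(1)]] by (auto simp: y_def)
  have x: "cf_limit \<omega> = cf_branch v y" unfolding v_def y_def by (rule cf_limit_shift[OF g(1)])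
  have At: "A * 1 \<le> A * t j" using A t[of j] by (intro mult_left_mono) auto
  have "radius \<omega> j = 1 / (A * t j) / (4 * (cf_den v 0)\<^sup>2)" by (simp add: radius_def v_def)
  also have "\<dots> \<le> \<bar>y - 0\<bar> / (4 * (cf_den v 0)\<^sup>2)"
    using shift_location(2)[OF \<omega>(1), of j] y by (intro divide_right_mono) (auto simp: y_def)
  also have "\<dots> \<le> \<bar>cf_branch v y - cf_branch v 0\<bar>" using v y by (intro cf_branch_diff_ge) auto
  finally have 1: "\<bar>cf_limit \<omega>' - cf_branch v y\<bar> < \<bar>cf_branch v y - cf_branch v 0\<bar>" using r x by simp
  have "radius \<omega> j = 1 / (A * t j) / (4 * (cf_den v 0)\<^sup>2)" by (simp add: radius_def v_def)
  also have "\<dots> \<le> 1 / A / (4 * (cf_den v 0)\<^sup>2)"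
    using At A t[of j] by (intro divide_right_mono divide_left_mono) auto
  also have "\<dots> \<le> \<bar>y - 1\<bar> / (4 * (cf_den v 0)\<^sup>2)"
    using shift_location(3)[OF \<omega>(1), of j] y by (intro divide_right_mono) (auto simp: y_def)
  also have "\<dots> \<le> \<bar>cf_branch v y - cf_branch v 1\<bar>" using v y by (intro cf_branch_diff_ge) auto
  finally have 2: "\<bar>cf_limit \<omega>' - cf_branch v y\<bar> < \<bar>cf_branch v y - cf_branch v 1\<bar>" using r x by simp
  obtain u where u: "0 < u" "u < 1" "cf_branch v u = cf_limit \<omega>'"
    using cf_branch_ball[OF v y 1 2] by blast
  have "cf_digits (length v) (cf_limit \<omega>') = v" using cf_digits_cf_branch[OF v u(1,2)] u(3) by simp
  moreover have "length v = length (prefix_word \<omega>' j)" using \<omega> by (simp add: v_def length_prefix_word)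
  ultimately have "prefix_word \<omega>' j = prefix_word \<omega> j" using cf_digits_cf_limit[OF g(2), of j] by (simp add: v_def)
  then show ?thesis using prefix_word_eq_imp[OF \<omega>(2,1) _ i] by blast
qed

text \<open>The continuations 1 / (a + z) and 1 / (b + z') with digits below 2 T are at least (b - a
  - 1) / (2 T)^2 apart, where -1 allows for the tails, and the prefix divides this by at most 4 q^2;
  hence 16.\<close>

lemma digit_gap:
  assumes \<omega>: "\<omega> \<in> support" "\<omega>' \<in> support" and agree: "\<And>i. i < j \<Longrightarrow> \<omega> i = \<omega>' i"
    and ab: "\<omega> j = [a]" "\<omega>' j = [b]" "1 \<le> a" "a < b" "b < 2 * T"
    and d: "\<bar>cf_limit \<omega> - cf_limit \<omega>'\<bar> \<le> d"
  shows "real b - real a - 1 \<le> 16 * d * (real T)\<^sup>2 * (cf_den (prefix_word \<omega> j) 0)\<^sup>2"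
proof -
  define v where "v = prefix_word \<omega> j"
  have v': "prefix_word \<omega>' j = v"
  proof -
    have "map \<omega>' [0..<j] = map \<omega> [0..<j]" using agree by auto
    then show ?thesis by (simp only: v_def prefix_word_def)
  qed
  note g = good_seq_support[OF \<omega>(1)] good_seq_support[OF \<omega>(2)]
  have v: "pos_word v" using pos_word_prefix[OF g(1)] by (simp add: v_def)
  have q: "1 \<le> cf_den v 0" using v by (auto intro!: cf_den_ge_1)
  define y y' where "y = cf_limit (shift_seq j \<omega>)" and "y' = cf_limit (shift_seq j \<omega>')"
  define z z' where "z = cf_limit (shift_seq (Suc j) \<omega>)" and "z' = cf_limit (shift_seq (Suc j) \<omega>')"
  have r: "0 \<le> y" "y \<le> 1" "0 \<le> y'" "y' \<le> 1" "0 \<le> z" "z \<le> 1" "0 \<le> z'" "z' \<le> 1"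
    unfolding y_def y'_def z_def z'_def
    using cf_limit_range[OF good_seq_shift[OF g(1)]] cf_limit_range[OF good_seq_shift[OF g(2)]] by auto
  have x: "cf_limit \<omega> = cf_branch v y" "cf_limit \<omega>' = cf_branch v y'"
    using cf_limit_shift[OF g(1), of j] cf_limit_shift[OF g(2), of j] by (simp_all add: v' y_def y'_def v_def)
  have y: "y = 1 / (real a + z)" "y' = 1 / (real b + z')"
    using shift_location(1)[OF \<omega>(1), of j] shift_location(1)[OF \<omega>(2), of j] ab
    by (simp_all add: y_def y'_def z_def z'_def)
  have pos: "0 < real a + z" "0 < real b + z'" using ab r by auto
  have "real b \<le> 2 * real T - 1" using ab(5) by linarith
  then have le: "real a + z \<le> 2 * real T" "real b + z' \<le> 2 * real T" using ab r by auto
  have "y - y' = (real b + z' - (real a + z)) / ((real a + z) * (real b + z'))"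
    unfolding y using pos by (simp add: field_simps)
  then have gap: "real b + z' - (real a + z) = (y - y') * ((real a + z) * (real b + z'))"
    using pos by simp
  have "real b - real a - 1 \<le> real b + z' - (real a + z)" using r by simp
  also have "\<dots> \<le> \<bar>y - y'\<bar> * ((real a + z) * (real b + z'))"
    unfolding gap using pos by (intro mult_right_mono) auto
  also have "\<dots> \<le> \<bar>y - y'\<bar> * ((2 * real T) * (2 * real T))"
    using pos le by (intro mult_left_mono mult_mono) auto
  also have "\<bar>y - y'\<bar> \<le> 4 * (cf_den v 0)\<^sup>2 * d"
  proof -
    have "\<bar>y - y'\<bar> / (4 * (cf_den v 0)\<^sup>2) \<le> d"
      using cf_branch_diff_ge[OF v r(1-4)] d x by simp
    then show ?thesis using q by (simp add: pos_divide_le_eq mult.commute)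
  qed
  finally show ?thesis by (simp add: v_def power2_eq_square mult_ac mult_right_mono)
qed

text \<open>The ball fixes all words before j. \<open>digit_gap\<close> for the smallest and the
  largest digit met, whose points are at most 2 r apart, bounds the number of digits by 2 + X, and
  uniformity gives each of them the same mass.\<close>

lemma uniform_step_estimate:
  assumes \<omega>: "\<omega> \<in> support" and r: "0 < r" "r < radius \<omega> j"
    and T: "1 \<le> T" "t j = real T" "p j = map_pmf (\<lambda>a. [a]) (pmf_of_set {T..<2 * T})"
  shows "measure M {\<omega>'. \<bar>cf_limit \<omega>' - cf_limit \<omega>\<bar> \<le> r}
    \<le> (2 + 32 * r * (real T)\<^sup>2 * (cf_den (prefix_word \<omega> j) 0)\<^sup>2) * mass \<omega> (Suc j)"
proof -
  interpret M: prob_space M by (rule prob_space_M)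
  define X where "X = 32 * r * (real T)\<^sup>2 * (cf_den (prefix_word \<omega> j) 0)\<^sup>2"
  have X: "0 \<le> X" using r by (simp add: X_def)
  define Bs where "Bs = {\<omega>'. \<bar>cf_limit \<omega>' - cf_limit \<omega>\<bar> \<le> r}"
  define D where "D = {a \<in> {T..<2 * T}. \<exists>\<omega>'\<in>support \<inter> Bs. \<omega>' j = [a]}"
  have agree: "\<omega>' i = \<omega> i" if "\<omega>' \<in> support \<inter> Bs" "i < j" for \<omega>' i
    using that r by (intro close_imp_agree[OF \<omega>, of \<omega>' j i]) (auto simp: Bs_def)
  have setp: "set_pmf (p j) = (\<lambda>a. [a]) ` {T..<2 * T}" using T by (simp add: set_pmf_of_set)
  have pmfj: "pmf (p j) [a] = 1 / real T" if "a \<in> {T..<2 * T}" for a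
  proof -
    have "pmf (p j) [a] = pmf (pmf_of_set {T..<2 * T}) a"
      unfolding T(3) by (rule pmf_map_inj') (auto simp: inj_def)
    also have "\<dots> = 1 / real T" using that T by (simp add: indicator_def)
    finally show ?thesis .
  qed
  have finD: "finite D" by (auto simp: D_def)
  have cardD: "real (card D) \<le> 2 + X"
  proof (cases "D = {}")
    case False
    define a b where "a = Min D" and "b = Max D"
    have mem: "a \<in> D" "b \<in> D" using False finD by (auto simp: a_def b_def)
    have "D \<subseteq> {a..b}" using finD by (auto simp: a_def b_def)
    then have "card D \<le> card {a..b}" by (intro card_mono) auto
    then have c: "card D \<le> Suc b - a" by simp
    show ?thesis
    proof (cases "a < b")
      case True
      obtain \<omega>1 \<omega>2 where w: "\<omega>1 \<in> support \<inter> Bs" "\<omega>2 \<in> support \<inter> Bs" "\<omega>1 j = [a]" "\<omega>2 j = [b]"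
        using mem by (auto simp: D_def)
      have "map \<omega>1 [0..<j] = map \<omega> [0..<j]" using agree[OF w(1)] by auto
      then have pw: "prefix_word \<omega>1 j = prefix_word \<omega> j" by (simp only: prefix_word_def)
      have "real b - real a - 1 \<le> 16 * (2 * r) * (real T)\<^sup>2 * (cf_den (prefix_word \<omega>1 j) 0)\<^sup>2"
      proof (rule digit_gap)
        show "\<omega>1 \<in> support" "\<omega>2 \<in> support" using w by auto
        show "\<omega>1 i = \<omega>2 i" if "i < j" for i using agree[OF w(1) that] agree[OF w(2) that] by simp
        show "\<bar>cf_limit \<omega>1 - cf_limit \<omega>2\<bar> \<le> 2 * r" using w by (auto simp: Bs_def)
        show "1 \<le> a" "b < 2 * T" using mem T by (auto simp: D_def)
      qed (use w True in auto)
      then have "real b - real a - 1 \<le> X" by (simp add: pw X_def)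
      moreover have "real (card D) \<le> real b - real a + 1" using c True by linarith
      ultimately show ?thesis by linarith
    next
      case False
      then have "card D \<le> 1" using c by simp
      then show ?thesis using X by linarith
    qed
  qed (use X in auto)
  define V where "V a = {\<omega>'. \<forall>i<Suc j. \<omega>' i = (fun_upd \<omega> j [a]) i}" for a
  have Vm: "V a \<in> sets M" for a unfolding V_def by (rule agree_event)
  have Vp: "measure M (V a) = mass \<omega> (Suc j)" if "a \<in> {T..<2 * T}" for a
  proof -
    have "\<omega> j \<in> set_pmf (p j)" using \<omega> by (simp add: support_def)
    then obtain a0 where a0: "\<omega> j = [a0]" "a0 \<in> {T..<2 * T}" using setp by auto
    have "measure M (V a) = mass (fun_upd \<omega> j [a]) (Suc j)" unfolding V_def by (rule prob_agree)
    also have "\<dots> = mass \<omega> j * pmf (p j) [a]" by (simp add: mass_def)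
    also have "\<dots> = mass \<omega> (Suc j)" using pmfj[OF that] pmfj[OF a0(2)] a0(1) by (simp add: mass_def)
    finally show ?thesis .
  qed
  have "measure M Bs \<le> measure M (\<Union>a\<in>D. V a)"
  proof (rule M.finite_measure_mono_AE)
    show "AE \<omega>' in M. \<omega>' \<in> Bs \<longrightarrow> \<omega>' \<in> (\<Union>a\<in>D. V a)"
      using AE_support
    proof eventually_elim
      case (elim \<omega>')
      show ?case
      proof
        assume "\<omega>' \<in> Bs"
        then have w: "\<omega>' \<in> support \<inter> Bs" using elim by simp
        have "\<omega>' j \<in> set_pmf (p j)" using elim by (simp add: support_def)
        then obtain a where a: "\<omega>' j = [a]" "a \<in> {T..<2 * T}" using setp by auto
        then have "a \<in> D" using w by (auto simp: D_def)
        moreover have "\<omega>' \<in> V a" using agree[OF w] a by (auto simp: V_def less_Suc_eq)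
        ultimately show "\<omega>' \<in> (\<Union>a\<in>D. V a)" by blast
      qed
    qed
    show "(\<Union>a\<in>D. V a) \<in> sets M" using Vm finD by auto
  qed
  also have "\<dots> \<le> (\<Sum>a\<in>D. measure M (V a))"
    using Vm finD by (intro M.finite_measure_subadditive_finite) auto
  also have "\<dots> = real (card D) * mass \<omega> (Suc j)" using Vp by (simp add: D_def)
  also have "\<dots> \<le> (2 + X) * mass \<omega> (Suc j)"
    using cardD by (intro mult_right_mono) (auto simp: mass_def prod_nonneg)
  finally show ?thesis by (simp add: Bs_def X_def)
qed

text \<open>The radius r is placed between two consecutive scales. A step among comparable words
  loses only \<Lambda>; in a uniform step T is unbounded, and the count of digits met has to
  interpolate between the two scales. The 34 is 2 + 32.\<close>

lemma ball_estimate: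
  assumes \<omega>: "\<omega> \<in> support" and r: "0 < r" "r < radius \<omega> 0"
  shows "measure M {\<omega>'. \<bar>cf_limit \<omega>' - cf_limit \<omega>\<bar> \<le> r} \<le> (\<Lambda> + 34) * (C * (4 * A) powr s) * r powr s"
proof -
  interpret M: prob_space M by (rule prob_space_M)
  define K where "K = C * (4 * A) powr s"
  have K: "0 < K" using C A by (simp add: K_def)
  have "\<forall>\<^sub>F j in sequentially. radius \<omega> j < r"
    using radius_tendsto[OF \<omega>] r(1) by (intro order_tendstoD(2)) auto
  then obtain k where k: "\<And>j. k \<le> j \<Longrightarrow> radius \<omega> j < r" by (auto simp: eventually_sequentially)
  \<comment> \<open>Minimality yields \<open>r < radius \<omega> j\<close> directly, without
    comparing radii with each other.\<close>
  define j where "j = (LEAST j. radius \<omega> (Suc j) \<le> r)"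
  have "radius \<omega> (Suc k) \<le> r" using k[of "Suc k"] by simp
  then have j1: "radius \<omega> (Suc j) \<le> r" unfolding j_def by (rule LeastI)
  have j0: "r < radius \<omega> j"
  proof (cases j)
    case (Suc i)
    then have "\<not> radius \<omega> (Suc i) \<le> r" using not_less_Least[of i "\<lambda>j. radius \<omega> (Suc j) \<le> r"] by (simp add: j_def)
    then show ?thesis using Suc by simp
  qed (use r in simp)
  have rad_pos: "0 < radius \<omega> i" for i
  proof -
    have "1 \<le> cf_den (prefix_word \<omega> i) 0"
      using pos_word_prefix[OF good_seq_support[OF \<omega>]] by (auto intro!: cf_den_ge_1)
    then show ?thesis using A t[of i] by (auto simp: radius_def intro!: divide_pos_pos mult_pos_pos)
  qed
  have next_mass: "mass \<omega> (Suc j) \<le> K * r powr s"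
  proof -
    have "mass \<omega> (Suc j) \<le> K * radius \<omega> (Suc j) powr s" unfolding K_def by (rule mass_le_radius[OF \<omega>])
    also have "\<dots> \<le> K * r powr s" using K j1 s rad_pos[of "Suc j"] by (intro mult_left_mono powr_mono2) auto
    finally show ?thesis .
  qed
  define Bs where "Bs = {\<omega>'. \<bar>cf_limit \<omega>' - cf_limit \<omega>\<bar> \<le> r}"
  have Kr: "0 \<le> K * r powr s" using K by simp
  consider (comparable) "\<forall>w\<in>set_pmf (p j). 1 \<le> \<Lambda> * pmf (p j) w"
    | (uniform) T where "1 \<le> T" "t j = real T" "p j = map_pmf (\<lambda>a. [a]) (pmf_of_set {T..<2 * T})"
    using step[of j] by blast
  then have "measure M Bs \<le> (\<Lambda> + 34) * (K * r powr s)"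
  proof cases
    case comparable
    have "measure M Bs \<le> measure M {\<omega>'. \<forall>i<j. \<omega>' i = \<omega> i}"
    proof (rule M.finite_measure_mono_AE[OF _ agree_event])
      show "AE \<omega>' in M. \<omega>' \<in> Bs \<longrightarrow> \<omega>' \<in> {\<omega>'. \<forall>i<j. \<omega>' i = \<omega> i}"
        using AE_support
        by eventually_elim (use j0 close_imp_agree[OF \<omega>] in \<open>force simp: Bs_def\<close>)
    qed
    also have "\<dots> = mass \<omega> j" by (rule prob_agree)
    also have "\<dots> = mass \<omega> j * 1" by simp
    also have "\<dots> \<le> mass \<omega> j * (\<Lambda> * pmf (p j) (\<omega> j))"
      using comparable \<omega> by (intro mult_left_mono) (auto simp: support_def mass_def prod_nonneg)
    also have "\<dots> = \<Lambda> * mass \<omega> (Suc j)" by (simp add: mass_def)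
    also have "\<dots> \<le> \<Lambda> * (K * r powr s)" using \<Lambda> next_mass by (intro mult_left_mono) auto
    also have "\<dots> \<le> (\<Lambda> + 34) * (K * r powr s)" using Kr by (intro mult_right_mono) auto
    finally show ?thesis .
  next
    case uniform
    define q where "q = cf_den (prefix_word \<omega> j) 0"
    have q: "1 \<le> q" unfolding q_def using pos_word_prefix[OF good_seq_support[OF \<omega>]] by (auto intro!: cf_den_ge_1)
    define Y where "Y = r * (real T)\<^sup>2 * q\<^sup>2"
    have Y: "0 \<le> Y" using r by (simp add: Y_def)
    have m0: "0 \<le> mass \<omega> (Suc j)" by (auto simp: mass_def prod_nonneg)
    have "measure M Bs \<le> (2 + 32 * r * (real T)\<^sup>2 * q\<^sup>2) * mass \<omega> (Suc j)"
      unfolding Bs_def q_def using uniform_step_estimate[OF \<omega> r(1) j0 uniform] .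
    then have main: "measure M Bs \<le> (2 + 32 * Y) * mass \<omega> (Suc j)" by (simp add: Y_def mult.assoc)
    have "(2 + 32 * Y) * mass \<omega> (Suc j) \<le> 34 * (K * r powr s)"
    \<comment> \<open>For Y \<le> 1 boundedly many digits are met and the mass after step j
      suffices. Otherwise the bound is linear in r, a multiple of (r / radius) times the mass before
      step j; the ratio is below 1, so s \<le> 1 allows raising it to the power s.\<close>
    proof (cases "Y \<le> 1")
      case True
      then have "(2 + 32 * Y) * mass \<omega> (Suc j) \<le> 34 * mass \<omega> (Suc j)" using m0 by (intro mult_right_mono) auto
      then show ?thesis using next_mass by linarith
    next
      case False
      have "set_pmf (p j) = (\<lambda>a. [a]) ` {T..<2 * T}" using uniform by (simp add: set_pmf_of_set)
      moreover have "\<omega> j \<in> set_pmf (p j)" using \<omega> by (simp add: support_def)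
      ultimately obtain a where a: "\<omega> j = [a]" "a \<in> {T..<2 * T}" by auto
      have "pmf (p j) (\<omega> j) = pmf (pmf_of_set {T..<2 * T}) a"
        unfolding uniform(3) a(1) by (rule pmf_map_inj') (auto simp: inj_def)
      also have "\<dots> = 1 / real T" using a uniform(1) by (simp add: indicator_def)
      finally have mS: "mass \<omega> (Suc j) = mass \<omega> j / real T" by (simp add: mass_def)
      have "(2 + 32 * Y) * mass \<omega> (Suc j) \<le> (34 * Y) * mass \<omega> (Suc j)"
        using False m0 by (intro mult_right_mono) auto
      also have "\<dots> = 34 * (r * (real T * q\<^sup>2)) * mass \<omega> j"
        unfolding mS Y_def using uniform(1) by (simp add: power2_eq_square)
      also have "r * (real T * q\<^sup>2) = r / radius \<omega> j / (4 * A)"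
        using A uniform(2) by (simp add: radius_def q_def)
      also have "r / radius \<omega> j / (4 * A) \<le> r / radius \<omega> j"
        using A r(1) rad_pos[of j] by (simp add: pos_divide_le_eq)
      also have "r / radius \<omega> j = (r / radius \<omega> j) powr 1" using r(1) rad_pos[of j] by simp
      also have "\<dots> \<le> (r / radius \<omega> j) powr s"
        using s r(1) rad_pos[of j] j0 by (intro powr_mono') auto
      finally have "(2 + 32 * Y) * mass \<omega> (Suc j) \<le> 34 * (r / radius \<omega> j) powr s * mass \<omega> j"
        by (simp add: mult_right_mono mass_def prod_nonneg)
      also have "\<dots> \<le> 34 * (r / radius \<omega> j) powr s * (K * radius \<omega> j powr s)"
        using mass_le_radius[OF \<omega>, of j] by (intro mult_left_mono) (auto simp: K_def)
      also have "\<dots> = 34 * (K * r powr s)"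
        using rad_pos[of j] by (simp add: powr_divide)
      finally show ?thesis .
    qed
    also have "\<dots> \<le> (\<Lambda> + 34) * (K * r powr s)" using Kr \<Lambda> by (intro mult_right_mono) auto
    finally show ?thesis using main by linarith
  qed
  then show ?thesis by (simp add: Bs_def K_def mult.assoc)
qed

theorem hausdorff_dim_ge:
  assumes "\<And>\<omega>. \<omega> \<in> support \<Longrightarrow> cf_limit \<omega> \<in> E"
  shows "ereal s \<le> hausdorff_dim E"
proof -
  interpret M: prob_space M by (rule prob_space_M)
  \<comment> \<open>Half of \<open>radius \<omega> 0\<close>, which is the same for all \<omega>
    because the empty prefix has denominator 1.\<close>
  define r0 where "r0 = 1 / (8 * A * t 0)"
  have r0: "0 < r0" "r0 \<le> 1"
    using A t[of 0] mult_mono[of 1 "8 * A" 1 "t 0"] by (auto simp: r0_def)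
  show ?thesis
  proof (rule M.mass_distribution_principle[OF cf_limit_measurable AE_support _ assms s(1) r0])
    show "0 < (\<Lambda> + 34) * (C * (4 * A) powr s)" using \<Lambda> C A by (intro mult_pos_pos) auto
    fix \<omega> r assume "\<omega> \<in> support" "0 < r" "r \<le> r0"
    moreover have "r0 < radius \<omega> 0" using A t[of 0] by (auto simp: r0_def radius_def field_simps)
    ultimately show "M.prob {\<omega>' \<in> space M. \<bar>cf_limit \<omega>' - cf_limit \<omega>\<bar> \<le> r} \<le> (\<Lambda> + 34) * (C * (4 * A) powr s) * r powr s"
      using ball_estimate[of \<omega> r] by simp
  qed auto
qed

end

section \<open>Lower bounds\<close>

lemma uniform_digit_pmf:
  fixes T :: nat
  assumes "1 \<le> T"
  defines "P \<equiv> map_pmf (\<lambda>a. [a]) (pmf_of_set {T..<2 * T})"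
  shows "set_pmf P = (\<lambda>a. [a]) ` {T..<2 * T}"
    and "w \<in> set_pmf P \<Longrightarrow> pmf P w = 1 / real T"
proof -
  show set: "set_pmf P = (\<lambda>a. [a]) ` {T..<2 * T}" using assms by (simp add: set_pmf_of_set)
  assume "w \<in> set_pmf P"
  then obtain a where a: "w = [a]" "a \<in> {T..<2 * T}" using set by auto
  have "pmf P w = pmf (pmf_of_set {T..<2 * T}) a"
    unfolding P_def a(1) by (rule pmf_map_inj') (auto simp: inj_def)
  then show "pmf P w = 1 / real T" using a assms by (simp add: indicator_def)
qed

lemma uniform_digit_weight:
  assumes "1 \<le> T" "w \<in> set_pmf (map_pmf (\<lambda>a. [a]) (pmf_of_set {T..<2 * T}))" "0 < s"
  shows "pmf (map_pmf (\<lambda>a. [a]) (pmf_of_set {T..<2 * T})) w * (2 * cf_den w 0) powr (2 * s)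
    \<le> (4 * real T) powr (2 * s) / real T"
proof -
  obtain a where a: "w = [a]" "a \<in> {T..<2 * T}" using assms(2) uniform_digit_pmf(1)[OF assms(1)] by auto
  have "2 * cf_den w 0 \<le> 4 * real T" using a by simp
  then have "(2 * cf_den w 0) powr (2 * s) \<le> (4 * real T) powr (2 * s)"
    using a assms by (intro powr_mono2) auto
  then show ?thesis
    unfolding uniform_digit_pmf(2)[OF assms(1,2)] using assms(1) by (simp add: divide_right_mono)
qed

lemma uniform_digit_location:
  assumes "2 \<le> T" "w \<in> set_pmf (map_pmf (\<lambda>a. [a]) (pmf_of_set {T..<2 * T}))" "0 \<le> y" "y \<le> 1" "2 \<le> A"
  shows "1 / (A * real T) \<le> cf_branch w y \<and> cf_branch w y \<le> 1 - 1 / A"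
proof -
  obtain a where a: "w = [a]" "a \<in> {T..<2 * T}" using assms uniform_digit_pmf(1)[of T] by auto
  have "real a + 1 \<le> 2 * real T" using a by auto
  then have "real a + y \<le> 2 * real T" using assms by linarith
  also have "\<dots> \<le> A * real T" using assms by (intro mult_right_mono) auto
  finally have 1: "1 / (A * real T) \<le> 1 / (real a + y)" using a assms by (intro divide_left_mono) auto
  have "2 \<le> real a + y" using a assms by auto
  then have "1 / (real a + y) \<le> 1 / 2" by (intro divide_left_mono) auto
  moreover have "1 / A \<le> 1 / 2" using assms by (intro divide_left_mono) auto
  ultimately show ?thesis using 1 a by simp
qed

lemma uniform_digit_word:
  fixes T :: nat
  assumes "1 \<le> T" "w \<in> set_pmf (map_pmf (\<lambda>a. [a]) (pmf_of_set {T..<2 * T}))"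
  shows "\<exists>a\<ge>T. w = [a]"
  using assms uniform_digit_pmf(1)[OF assms(1)] by auto

text \<open>Every digit a_n has size at least exp (b^n), and this one digit lifts both pairs that
  contain it above \<phi> n whenever \<phi> n \<le> exp (b^n). Since steps count from 0,
  \<open>T j\<close> belongs to the digit j + 1.\<close>

lemma dim_F2_ge_doubly_exponential:
  assumes b: "1 < b" and fr: "\<exists>\<^sub>\<infinity>n. \<phi> n \<le> exp (b ^ n)" and s: "0 < s" "s < 1 / (1 + b)"
  shows "ereal s \<le> hausdorff_dim (F2_set \<phi>)"
proof -
  define T where "T j = nat \<lceil>exp (b ^ Suc j)\<rceil>" for j
  have Tb: "exp (b ^ Suc j) \<le> real (T j)" "real (T j) \<le> 2 * exp (b ^ Suc j)" "2 \<le> T j" for j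
  proof -
    have e: "1 \<le> exp (b ^ Suc j)" using b by simp
    have e1: "1 < exp (b ^ Suc j)" using b by simp
    show "exp (b ^ Suc j) \<le> real (T j)" unfolding T_def by linarith
    show "real (T j) \<le> 2 * exp (b ^ Suc j)" unfolding T_def using e by linarith
    show "2 \<le> T j" unfolding T_def using e1 by linarith
  qed
  have T1: "1 \<le> T j" for j using Tb(3)[of j] by linarith
  have s2: "2 * s < 1"
  proof -
    have "1 / (1 + b) < 1 / 2" using b by (intro divide_strict_left_mono) auto
    then show ?thesis using s by simp
  qed
  define f where "f j = (4 * real (T j)) powr (2 * s) / real (T j)" for j
  \<comment> \<open>The coefficient of -b^(j + 1) in the logarithm of the budget: the factors f i,
    of order T_i^(2 s - 1), sum geometrically to -(1 - 2 s) b^(j + 1) / (b - 1), and the current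
    digit adds s b^(j + 1). Positivity is equivalent to s (1 + b) < 1.\<close>
  define \<delta> where "\<delta> = (1 - 2 * s) / (b - 1) - s"
  have \<delta>: "0 < \<delta>"
  proof -
    have "s * (1 + b) < 1" using s b by (simp add: pos_less_divide_eq)
    then have "s * (b - 1) < 1 - 2 * s" by (simp add: algebra_simps)
    then have "s < (1 - 2 * s) / (b - 1)" using b by (simp add: pos_less_divide_eq)
    then show ?thesis by (simp add: \<delta>_def)
  qed
  define K where "K = (1 - 2 * s) * b / (b - 1) + s * ln 2"
  have est: "(\<Prod>i<j. f i) * real (T j) powr s \<le> exp (K + real j * (2 * s * ln 4) - \<delta> * (b * b ^ j))" for j
  proof -
    have f: "0 < f i" "ln (f i) \<le> 2 * s * ln 4 - (1 - 2 * s) * b ^ Suc i" for i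
    proof -
      have T0: "0 < real (T i)" using T1[of i] by simp
      show "0 < f i" using T0 by (simp add: f_def)
      have "ln (f i) = 2 * s * ln 4 - (1 - 2 * s) * ln (real (T i))"
        using T0 by (simp add: f_def ln_div ln_powr ln_mult algebra_simps)
      moreover have "b ^ Suc i \<le> ln (real (T i))" using ln_mono[OF Tb(1)[of i]] by simp
      then have "(1 - 2 * s) * b ^ Suc i \<le> (1 - 2 * s) * ln (real (T i))" using s2 by (intro mult_left_mono) auto
      ultimately show "ln (f i) \<le> 2 * s * ln 4 - (1 - 2 * s) * b ^ Suc i" by linarith
    qed
    define R where "R = (\<Prod>i<j. f i)"
    have P: "0 < R" unfolding R_def using f(1) by (intro prod_pos) auto
    have T0: "0 < real (T j)" using T1[of j] by simp
    have "ln R = (\<Sum>i<j. ln (f i))"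
      unfolding R_def
    proof (rule ln_prod)
      show "f i \<noteq> 0" for i using f(1)[of i] by simp
    qed simp
    also have "\<dots> \<le> (\<Sum>i<j. 2 * s * ln 4 - (1 - 2 * s) * b ^ Suc i)" by (intro sum_mono f(2))
    also have "\<dots> = (\<Sum>i<j. 2 * s * ln 4 - ((1 - 2 * s) * b) * b ^ i)" by (simp add: mult.assoc)
    also have "\<dots> = real j * (2 * s * ln 4) - ((1 - 2 * s) * b) * (\<Sum>i<j. b ^ i)"
      by (simp only: sum_subtractf sum_distrib_left[symmetric]) simp
    also have "(\<Sum>i<j. b ^ i) = (b ^ j - 1) / (b - 1)" using b by (simp add: geometric_sum)
    finally have 1: "ln R \<le> real j * (2 * s * ln 4) - (1 - 2 * s) * b * ((b ^ j - 1) / (b - 1))" .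
    have "ln (real (T j)) \<le> ln (2 * exp (b ^ Suc j))" using Tb(2)[of j] T0 by (intro ln_mono) auto
    then have "ln (real (T j)) \<le> ln 2 + b * b ^ j" by (simp add: ln_mult)
    then have "s * ln (real (T j)) \<le> s * (ln 2 + b * b ^ j)" using s by (intro mult_left_mono) auto
    then have "ln (R * real (T j) powr s)
       \<le> real j * (2 * s * ln 4) - (1 - 2 * s) * b * ((b ^ j - 1) / (b - 1)) + s * (ln 2 + b * b ^ j)"
      using 1 P T0 by (simp add: ln_mult ln_powr)
    also have "\<dots> = K + real j * (2 * s * ln 4) - \<delta> * (b * b ^ j)"
    proof -
      define d where "d = (1 - 2 * s) / (b - 1)"
      have "(1 - 2 * s) * b * ((b ^ j - 1) / (b - 1)) = d * b * (b ^ j - 1)" "(1 - 2 * s) * b / (b - 1) = d * b"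
        by (simp_all add: d_def)
      then show ?thesis unfolding K_def \<delta>_def d_def[symmetric] by (simp add: algebra_simps)
    qed
    finally have "exp (ln (R * real (T j) powr s)) \<le> exp (K + real j * (2 * s * ln 4) - \<delta> * (b * b ^ j))"
      by simp
    then show ?thesis using P T0 by (simp add: R_def[symmetric])
  qed
  have "(\<lambda>j. exp (K + real j * (2 * s * ln 4) - \<delta> * (b * b ^ j))) \<longlonglongrightarrow> 0"
    using b \<delta> by real_asymp
  then have "Bseq (\<lambda>j. exp (K + real j * (2 * s * ln 4) - \<delta> * (b * b ^ j)))"
    by (rule convergent_imp_Bseq[OF convergentI])
  then obtain C where C: "0 < C" "\<And>j. norm (exp (K + real j * (2 * s * ln 4) - \<delta> * (b * b ^ j))) \<le> C"
    by (auto elim: BseqE)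
  \<comment> \<open>All steps are uniform, so \<Lambda> = 0; digits between 2 and 2 T give the
    location constant A = 2.\<close>
  interpret random_cf "\<lambda>j. map_pmf (\<lambda>a. [a]) (pmf_of_set {T j..<2 * T j})" "\<lambda>_. 1" "\<lambda>j. real (T j)" f s 2 0 C
  proof
    show "(\<Prod>i<j. f i) * real (T j) powr s \<le> C" for j using est[of j] C(2)[of j] by simp
    show "pos_word w \<and> length w = 1 \<and> w \<noteq> []" if "w \<in> set_pmf (map_pmf (\<lambda>a. [a]) (pmf_of_set {T j..<2 * T j}))" for j w
      using uniform_digit_word[OF T1 that] T1[of j] by auto
    show "pmf (map_pmf (\<lambda>a. [a]) (pmf_of_set {T j..<2 * T j})) w * (2 * cf_den w 0) powr (2 * s) \<le> f j"
      if "w \<in> set_pmf (map_pmf (\<lambda>a. [a]) (pmf_of_set {T j..<2 * T j}))" for j w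
      unfolding f_def using T1 that s by (intro uniform_digit_weight) auto
    show "1 / (2 * real (T j)) \<le> cf_branch w y \<and> cf_branch w y \<le> 1 - 1 / 2"
      if "w \<in> set_pmf (map_pmf (\<lambda>a. [a]) (pmf_of_set {T j..<2 * T j}))" "0 \<le> y" "y \<le> 1" for j w y
      using uniform_digit_location[OF Tb(3) that, of 2] by simp
  qed (use s s2 C T1 in auto)
  show ?thesis
  proof (rule hausdorff_dim_ge)
    fix \<omega> assume w: "\<omega> \<in> support"
    note g = good_seq_support[OF w]
    have dig: "real (T j) \<le> real (partial_quotient (Suc j) (cf_limit \<omega>))" for j
    proof -
      have "\<omega> j \<in> set_pmf (map_pmf (\<lambda>a. [a]) (pmf_of_set {T j..<2 * T j}))" using w by (auto simp: support_def)
      then obtain a where a: "T j \<le> a" "\<omega> j = [a]" using uniform_digit_word[OF T1] by blast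
      have "length (prefix_word \<omega> j) = j" using length_prefix_word[OF w, of j] by simp
      then have "partial_quotient (Suc j) (cf_limit \<omega>) = a"
        using partial_quotient_cf_limit[OF g, of j "Suc j"] a by (simp add: prefix_word_Suc nth_append)
      then show ?thesis using a by simp
    qed
    define x where "x = cf_limit \<omega>"
    have irr: "x \<in> irrationals01" unfolding x_def by (rule cf_limit_irrational[OF g])
    have "\<exists>\<^sub>\<infinity>n. \<phi> n \<le> exp (b ^ n) \<and> 2 \<le> n"
      using fr by (intro INFM_conjI) (auto simp: MOST_nat_le)
    then have "\<exists>\<^sub>\<infinity>n. \<exists>k\<in>{1..n}. \<exists>l\<in>{1..n}. k \<noteq> l \<and>
       real (partial_quotient k x * partial_quotient (k + 1) x) \<ge> \<phi> n \<and>
       real (partial_quotient l x * partial_quotient (l + 1) x) \<ge> \<phi> n"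
    proof (rule INFM_mono)
      fix n assume n: "\<phi> n \<le> exp (b ^ n) \<and> 2 \<le> n"
      define j where "j = n - 1"
      have j: "n = Suc j" using n by (simp add: j_def)
      have "\<phi> n \<le> real (T j)" using n Tb(1)[of j] by (simp add: j)
      also have "\<dots> \<le> real (partial_quotient n x)" unfolding j x_def by (rule dig)
      finally have le: "\<phi> n \<le> real (partial_quotient n x)" .
      have pos: "1 \<le> partial_quotient k x" for k by (rule partial_quotient_pos[OF irr])
      have "real (partial_quotient n x) \<le> real (partial_quotient j x * partial_quotient n x)"
        "real (partial_quotient n x) \<le> real (partial_quotient n x * partial_quotient (n + 1) x)"
        using pos[of j] pos[of "n + 1"] by (intro of_nat_mono; simp)+
      then show "\<exists>k\<in>{1..n}. \<exists>l\<in>{1..n}. k \<noteq> l \<and>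
         real (partial_quotient k x * partial_quotient (k + 1) x) \<ge> \<phi> n \<and>
         real (partial_quotient l x * partial_quotient (l + 1) x) \<ge> \<phi> n"
        using le n j by (intro bexI[of _ j] bexI[of _ n]) auto
    qed
    then show "cf_limit \<omega> \<in> F2_set \<phi>" using irr by (simp add: F2_set_def x_def)
  qed
qed

lemma frequently_less_if_liminf_less:
  fixes u :: "nat \<Rightarrow> real"
  assumes "liminf (\<lambda>n. ereal (u n)) < ereal r"
  shows "\<exists>\<^sub>\<infinity>n. u n < r"
proof (rule ccontr)
  assume "\<not> ?thesis"
  then have "\<forall>\<^sub>F n in sequentially. ereal r \<le> ereal (u n)"
    by (simp add: not_frequently not_less cofinite_eq_sequentially)
  then have "ereal r \<le> liminf (\<lambda>n. ereal (u n))" by (rule Liminf_bounded)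
  then show False using assms by simp
qed

lemma exp_ereal_less_iff:
  assumes "0 < r"
  shows "exp_ereal x < ereal r \<longleftrightarrow> x < ereal (ln r)"
proof (cases x)
  case (real y)
  have "exp y < r \<longleftrightarrow> y < ln r" using assms by (metis exp_less_cancel_iff exp_ln)
  then show ?thesis by (simp add: real exp_ereal_def)
qed (use assms in \<open>auto simp: exp_ereal_def\<close>)

lemma dim_F2_infinite_ge:
  assumes "growth_B \<phi> = \<infinity>" "\<And>n. 1 \<le> n \<Longrightarrow> 0 < \<phi> n"
  shows "1 / (1 + growth_b \<phi>) \<le> hausdorff_dim (F2_set \<phi>)"
proof (cases "growth_b \<phi>")
  case (real b)
  have b: "1 \<le> b" using growth_b_ge_1[OF assms(1)] real by simp
  have le: "ereal r \<le> hausdorff_dim (F2_set \<phi>)" if r: "0 < r" "r < 1 / (1 + b)" for r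
  proof -
    define c where "c = (b + (1 / r - 1)) / 2"
    have "b < 1 / r - 1" using r b by (simp add: field_simps)
    then have c: "b < c" "c < 1 / r - 1" by (auto simp: c_def)
    then have rc: "r < 1 / (1 + c)" using r b by (simp add: field_simps)
    have "liminf (\<lambda>n. ereal (ln (ln (\<phi> n)) / real n)) < ereal (ln c)"
      using real b c by (simp add: growth_b_def flip: exp_ereal_less_iff)
    then have "\<exists>\<^sub>\<infinity>n. ln (ln (\<phi> n)) / real n < ln c" by (rule frequently_less_if_liminf_less)
    then have "\<exists>\<^sub>\<infinity>n. ln (ln (\<phi> n)) / real n < ln c \<and> (1 * real n < ln (\<phi> n) \<and> 1 \<le> n)"
      using growth_B_infinite_eventually[OF assms(1), of 1]
      by (intro INFM_conjI) (auto simp: cofinite_eq_sequentially eventually_conj_iff intro: eventually_ge_at_top)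
    then have "\<exists>\<^sub>\<infinity>n. \<phi> n \<le> exp (c ^ n)"
    proof (rule INFM_mono)
      fix n assume n: "ln (ln (\<phi> n)) / real n < ln c \<and> (1 * real n < ln (\<phi> n) \<and> 1 \<le> n)"
      then have "0 < real n" by simp
      then have "ln (ln (\<phi> n)) < real n * ln c" using n by (metis mult.commute pos_divide_less_eq)
      then have "exp (ln (ln (\<phi> n))) < exp (real n * ln c)" by simp
      moreover have "0 < ln (\<phi> n)" using n by linarith
      ultimately have "ln (\<phi> n) < c ^ n" using b c by (simp add: exp_of_nat_mult)
      then have "exp (ln (\<phi> n)) < exp (c ^ n)" by simp
      then show "\<phi> n \<le> exp (c ^ n)" using assms(2)[of n] n by simp
    qed
    then show ?thesis using b c rc r by (intro dim_F2_ge_doubly_exponential[of c]) auto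
  qed
  have "ereal (1 / (1 + b)) \<le> hausdorff_dim (F2_set \<phi>)"
  proof (rule dense_le)
    fix x assume x: "x < ereal (1 / (1 + b))"
    show "x \<le> hausdorff_dim (F2_set \<phi>)"
    proof (cases x)
      case (real r)
      then show ?thesis using le[of r] x hausdorff_dim_nonneg[of "F2_set \<phi>"]
        by (cases "0 < r") (auto intro: order_trans[of _ "0::ereal"])
    qed (use x in auto)
  qed
  also have "ereal (1 / (1 + b)) = 1 / (1 + growth_b \<phi>)" using b real by (simp add: one_ereal_def)
  finally show ?thesis .
next
  case PInf
  then show ?thesis by (simp add: hausdorff_dim_nonneg)
next
  case MInf
  then show ?thesis using growth_b_ge_1[OF assms(1)] by simp
qed

section \<open>Ordinary words interrupted by special triples\<close>

lemma finite_support_pmf: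
  fixes g :: "'a \<Rightarrow> real"
  assumes "finite W" "\<And>w. w \<in> W \<Longrightarrow> 0 < g w" "(\<Sum>w\<in>W. g w) = 1"
  obtains P where "set_pmf P = W" "\<And>w. w \<in> W \<Longrightarrow> pmf P w = g w"
proof -
  define h where "h w = (if w \<in> W then g w else 0)" for w
  have h: "0 \<le> h w" for w using assms(2)[of w] by (auto simp: h_def less_imp_le)
  have "(\<integral>\<^sup>+ w. ennreal (h w) \<partial>count_space UNIV) = (\<Sum>w\<in>W. ennreal (h w))"
    using assms(1) by (intro nn_integral_count_space') (auto simp: h_def)
  also have "\<dots> = ennreal (\<Sum>w\<in>W. g w)"
    using assms(2) by (subst sum_ennreal[symmetric]) (auto simp: h_def less_imp_le)
  finally have "(\<integral>\<^sup>+ w. ennreal (h w) \<partial>count_space UNIV) = 1" using assms(3) by simp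
  then have P: "pmf (embed_pmf h) w = h w" for w using h by (intro pmf_embed_pmf) auto
  show ?thesis
  proof
    show "set_pmf (embed_pmf h) = W"
      using assms(2) by (force simp: set_pmf_eq P h_def)
    show "pmf (embed_pmf h) w = g w" if "w \<in> W" for w using that by (simp add: P h_def)
  qed
qed

text \<open>A leading digit 1 alone would allow values arbitrarily near 1; the second digit, at most
  K, keeps the point away from 1. Hence words of length at least 2.\<close>

lemma cf_branch_location:
  assumes "pos_word w" "2 \<le> length w" "\<And>a. a \<in> set w \<Longrightarrow> real a \<le> K" "0 \<le> y" "y \<le> 1"
  shows "1 / (K + 2) \<le> cf_branch w y \<and> cf_branch w y \<le> 1 - 1 / (K + 2)"
proof -
  obtain a b v where w: "w = a # b # v"
    using assms(2) by (cases w; cases "tl w") auto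
  have ab: "1 \<le> real a" "real a \<le> K" "1 \<le> real b" "real b \<le> K" "pos_word v" "pos_word (b # v)"
    using assms w by auto
  define z where "z = cf_branch v y"
  define u where "u = 1 / (real b + z)"
  have z: "0 \<le> z" "z \<le> 1" using cf_branch_range[of v y] ab assms by (auto simp: z_def)
  have u: "1 / (K + 1) \<le> u" "u \<le> 1"
    unfolding u_def using z ab by (auto intro!: divide_left_mono)
  have u0: "0 \<le> u" using z ab by (simp add: u_def)
  have eq: "cf_branch w y = 1 / (real a + u)" by (simp add: w u_def z_def)
  have "1 / (K + 2) \<le> 1 / (real a + u)" using u u0 ab by (intro divide_left_mono) auto
  moreover have "1 / (real a + u) \<le> 1 / (1 + 1 / (K + 1))"
    using u u0 ab by (intro divide_left_mono add_mono mult_pos_pos add_pos_nonneg) auto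
  moreover have "1 / (1 + 1 / (K + 1)) = 1 - 1 / (K + 2)" using ab by (simp add: field_simps)
  ultimately show ?thesis unfolding eq by simp
qed

text \<open>The digits are taken in runs of words of length \<open>m\<close>; run number \<open>i\<close> occupies the steps from
  \<open>b i\<close> to \<open>h i - 1\<close> and is followed by three special digits, the first two of which end at most at
  position \<open>n i\<close>.\<close>

lemma special_steps_exist:
  fixes S :: "nat set" and Q :: "nat \<Rightarrow> nat"
  assumes "infinite S" "1 \<le> m"
  shows "\<exists>b h n :: nat \<Rightarrow> nat. b 0 = 0 \<and> (\<forall>i. b (Suc i) = h i + 3 \<and> 3 * i \<le> b i \<and> b i + Q (b i) \<le> h i \<and> n i \<in> S \<and>
     m * (h i - 3 * i) + 3 * i + 2 \<le> n i \<and> n i \<le> m * (h i - 3 * i) + 3 * i + 2 + m)"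
proof -
  define P where "P i x = (case x of (b, h, n) \<Rightarrow> (i = 0 \<longrightarrow> b = 0) \<and> 3 * i \<le> b \<and> b + Q b \<le> h \<and> n \<in> S \<and>
     m * (h - 3 * i) + 3 * i + 2 \<le> n \<and> n \<le> m * (h - 3 * i) + 3 * i + 2 + m)" for i :: nat and x :: "nat \<times> nat \<times> nat"
  have ex: "\<exists>h n. P i (b, h, n)" if b: "3 * i \<le> b" "i = 0 \<longrightarrow> b = 0" for i b
  proof -
    obtain n where n: "n \<in> S" "m * (b + Q b) + 3 * i + 2 \<le> n"
      using assms(1) by (metis infinite_nat_iff_unbounded_le)
    \<comment> \<open>The number of ordinary words placed before the i-th triple, next to the 3 i
      special digits used so far and the 2 reserved positions; the division leaves fewer than m
      positions over.\<close>
    define d where "d = (n - (3 * i + 2)) div m"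
    have "b + Q b \<le> d"
    proof -
      have "m * (b + Q b) div m \<le> (n - (3 * i + 2)) div m" using n by (intro div_le_mono) auto
      then show ?thesis using assms(2) by (simp add: d_def)
    qed
    moreover have "m * d \<le> n - (3 * i + 2)" by (simp add: d_def)
    moreover have "n - (3 * i + 2) \<le> m * d + m"
    proof -
      have "m * d + (n - (3 * i + 2)) mod m = n - (3 * i + 2)" by (simp add: d_def)
      moreover have "(n - (3 * i + 2)) mod m < m" using assms(2) by simp
      ultimately show ?thesis by linarith
    qed
    ultimately have "P i (b, d + 3 * i, n)" using b n by (auto simp: P_def)
    then show ?thesis by blast
  qed
  have "\<exists>x. \<forall>i. P i (x i) \<and> fst (x (Suc i)) = fst (snd (x i)) + 3"
  proof (rule dependent_nat_choice)
    show "\<exists>x. P 0 x" using ex[of 0 0] by auto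
    fix x i assume "P i x"
    then obtain b h n where x: "x = (b, h, n)" "3 * i \<le> b" "b \<le> h" by (cases x) (auto simp: P_def)
    then have "3 * Suc i \<le> h + 3" by simp
    from ex[OF this] obtain h' n' where "P (Suc i) (h + 3, h', n')" by auto
    then show "\<exists>y. P (Suc i) y \<and> fst y = fst (snd x) + 3" using x by (intro exI[of _ "(h + 3, h', n')"]) auto
  qed
  then obtain x where x: "\<And>i. P i (x i)" "\<And>i. fst (x (Suc i)) = fst (snd (x i)) + 3" by blast
  show ?thesis
    by (rule exI[of _ "\<lambda>i. fst (x i)"], rule exI[of _ "\<lambda>i. fst (snd (x i))"], rule exI[of _ "\<lambda>i. snd (snd (x i))"])
      (use x in \<open>auto simp: P_def case_prod_unfold\<close>)
qed

text \<open>Rounding up at most doubles y, and the exponents s and 2 s - 1 are below 1, so powers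
  lose at most 2; the 32 is 16 * 2 with \<open>4 powr (2 * s) \<le> 16\<close>.\<close>

lemma uniform_weight_bounds:
  fixes s y :: real
  assumes s: "1/2 < s" "s < 1" and y: "1 \<le> y"
  defines "N \<equiv> nat \<lceil>y\<rceil>"
  shows "real N powr s \<le> 2 * y powr s"
    "(4 * real N) powr (2 * s) / real N \<le> 32 * y powr (2 * s - 1)"
proof -
  have N: "1 \<le> N" using y unfolding N_def by linarith
  have N2: "real N \<le> 2 * y" using y unfolding N_def by linarith
  have "real N powr s \<le> (2 * y) powr s" using s N2 by (intro powr_mono2) auto
  also have "\<dots> = 2 powr s * y powr s" by (rule powr_mult)
  also have "2 powr s \<le> (2::real) powr 1" using s by (intro powr_mono) auto
  finally show "real N powr s \<le> 2 * y powr s" by (simp add: mult_right_mono)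
  have N0: "0 < real N" using N by simp
  have "(4 * real N) powr (2 * s) / real N = 4 powr (2 * s) * real N powr (2 * s - 1)"
    using N0 by (simp add: powr_mult powr_diff)
  also have "\<dots> \<le> 16 * (2 * y powr (2 * s - 1))"
  proof (intro mult_mono)
    have "(4::real) powr (2 * s) \<le> 4 powr 2" using s by (intro powr_mono) auto
    then show "(4::real) powr (2 * s) \<le> 16" by simp
    have "real N powr (2 * s - 1) \<le> (2 * y) powr (2 * s - 1)" using s N2 by (intro powr_mono2) auto
    also have "\<dots> = 2 powr (2 * s - 1) * y powr (2 * s - 1)" by (rule powr_mult)
    also have "2 powr (2 * s - 1) \<le> (2::real) powr 1" using s by (intro powr_mono) auto
    finally show "real N powr (2 * s - 1) \<le> 2 * y powr (2 * s - 1)" by (simp add: mult_right_mono)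
  qed auto
  finally show "(4 * real N) powr (2 * s) / real N \<le> 32 * y powr (2 * s - 1)" by simp
qed

text \<open>The three special digits have sizes \<open>\<Phi> powr (1 - s)\<close>, \<open>\<Phi> powr s\<close>, \<open>\<Phi> powr (1 - s)\<close>, the
  thresholds of the covering.\<close>

lemma dim_F2_ge_exponential:
  assumes s: "1/2 < s" "s < 1" and B: "1 < B" and fr: "\<exists>\<^sub>\<infinity>n. \<phi> n \<le> B ^ n"
    and m: "2 \<le> m" and W: "W \<subseteq> words m" "finite W"
    and Z: "2 * 4 powr s * B powr ((3 * s - 1 - s\<^sup>2) * real m) \<le> (\<Sum>w\<in>W. cf_den w 0 powr (-2 * s))"
  shows "ereal s \<le> hausdorff_dim (F2_set \<phi>)"
proof -
  define c where "c = 3 * s - 1 - s\<^sup>2"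
  have c0: "0 < c" unfolding c_def using s by (rule cost_exponent_pos)
  define Zs where "Zs = (\<Sum>w\<in>W. cf_den w 0 powr (-2 * s))"
  have Zs: "0 < Zs" "2 * 4 powr s * B powr (c * real m) \<le> Zs"
  proof -
    show "2 * 4 powr s * B powr (c * real m) \<le> Zs" using Z by (simp add: Zs_def c_def)
    moreover have "0 < 2 * 4 powr s * B powr (c * real m)" using B by simp
    ultimately show "0 < Zs" by linarith
  qed
  have Wq: "1 \<le> cf_den w 0" if "w \<in> W" for w
    using that W by (auto simp: words_def intro!: cf_den_ge_1)
  obtain P where P: "set_pmf P = W" "\<And>w. w \<in> W \<Longrightarrow> pmf P w = cf_den w 0 powr (-2 * s) / Zs"
  proof (rule finite_support_pmf[OF W(2)])
    show "0 < cf_den w 0 powr (-2 * s) / Zs" if "w \<in> W" for w using Wq[OF that] Zs by simp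
    show "(\<Sum>w\<in>W. cf_den w 0 powr (-2 * s) / Zs) = 1"
      unfolding sum_divide_distrib[symmetric] Zs_def[symmetric] using Zs by simp
  qed blast
  \<comment> \<open>The factor of one ordinary step. In the hypothesis on the weight sum, 4^s
    cancels the 2 inside (2 q)^(2 s), B^(c m) is the saving required of m digits, and the 2 leaves a
    spare 1/2 per word.\<close>
  define x where "x = B powr (- (c * real m)) / 2"
  have x: "0 < x" "x < 1"
  proof -
    have "B powr (- (c * real m)) \<le> B powr 0" using B c0 by (intro powr_mono) auto
    then show "x < 1" using B by (simp add: x_def)
  qed (use B in \<open>simp add: x_def\<close>)
  have ordinary_weight: "pmf P w * (2 * cf_den w 0) powr (2 * s) \<le> x" if "w \<in> W" for w
  proof -
    have q: "0 < cf_den w 0" using Wq[OF that] by simp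
    have "(2::real) powr (2 * s) = 4 powr s" using powr_powr[of 2 2 s] by simp
    then have "pmf P w * (2 * cf_den w 0) powr (2 * s) = 4 powr s / Zs"
      using q by (simp add: P(2)[OF that] powr_mult powr_minus)
    also have "\<dots> \<le> 4 powr s / (2 * 4 powr s * B powr (c * real m))"
      using Zs B by (intro divide_left_mono mult_pos_pos) auto
    also have "\<dots> = x" using B by (simp add: x_def powr_minus field_simps)
    finally show ?thesis .
  qed
  \<comment> \<open>32 cubed: each of the three special digits loses 32 in
    \<open>uniform_weight_bounds\<close>.\<close>
  define D where "D = (32768::real)"
  define S where "S = {n. 1 \<le> n \<and> \<phi> n \<le> B ^ n}"
  have "infinite S"
  proof -
    have "\<exists>\<^sub>\<infinity>n. \<phi> n \<le> B ^ n \<and> 1 \<le> n" using fr by (intro INFM_conjI) (auto simp: MOST_nat_le)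
    then show ?thesis unfolding S_def frequently_cofinite by (simp add: conj_commute)
  qed
  \<comment> \<open>A run of k words saves B^(-c m k), but \<Phi>^(-c) is wanted with n as large as
    m k + (m + 1) b + m + 2. The spare 2^(-k) pays for the difference and for D once k \<ge>
    Q.\<close>
  define Q where "Q j = nat \<lceil>log 2 (D * B powr (c * (real (m + 1) * real j + real m + 2)))\<rceil>" for j
  have Q: "D * B powr (c * (real (m + 1) * real j + real m + 2)) \<le> 2 ^ k" if "Q j \<le> k" for j k
  proof -
    define y where "y = D * B powr (c * (real (m + 1) * real j + real m + 2))"
    have y: "0 < y" using B by (simp add: y_def D_def)
    have "log 2 y \<le> real (Q j)" unfolding Q_def y_def[symmetric] by linarith
    then have "log 2 y \<le> real k" using that by linarith
    then have "2 powr log 2 y \<le> 2 powr real k" by (intro powr_mono) auto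
    then show ?thesis using y by (simp add: y_def powr_realpow)
  qed
  obtain b h n where b0: "b 0 = 0" and bh: "\<And>i. b (Suc i) = h i + 3" "\<And>i. 3 * i \<le> b i" "\<And>i. b i + Q (b i) \<le> h i"
     and n: "\<And>i. n i \<in> S" "\<And>i. m * (h i - 3 * i) + 3 * i + 2 \<le> n i" "\<And>i. n i \<le> m * (h i - 3 * i) + 3 * i + 2 + m"
    using special_steps_exist[OF \<open>infinite S\<close>, of m Q] m by auto
  define \<Phi> where "\<Phi> i = B ^ n i" for i
  have \<Phi>: "1 < \<Phi> i" for i
    unfolding \<Phi>_def using B n(1)[of i] by (intro one_less_power) (auto simp: S_def)
  have \<Phi>1: "1 < \<Phi> i powr a" if "0 < a" for i a using \<Phi>[of i] that by (simp add: gr_one_powr)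
  define N M where "N i = nat \<lceil>\<Phi> i powr (1 - s)\<rceil>" and "M i = nat \<lceil>\<Phi> i powr s\<rceil>" for i
  have NM2: "2 \<le> N i" "2 \<le> M i" for i
    unfolding N_def M_def using \<Phi>1[of "1 - s" i] \<Phi>1[of s i] s by linarith+
  have NM_ge: "\<Phi> i powr (1 - s) \<le> real (N i)" "\<Phi> i powr s \<le> real (M i)" for i
    unfolding N_def M_def by linarith+
  \<comment> \<open>Index of the run containing step j, its three special steps included.\<close>
  define \<iota> where "\<iota> j = (LEAST i. j \<le> h i + 2)" for j
  have hmono: "h i + 3 \<le> h (Suc i)" for i using bh(1)[of i] bh(3)[of "Suc i"] by linarith
  have h_ge: "i \<le> h i" for i
  proof (induction i)
    case (Suc i)
    then show ?case using hmono[of i] by linarith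
  qed simp
  have \<iota>: "b (\<iota> j) \<le> j" "j \<le> h (\<iota> j) + 2" for j
  proof -
    have ex: "j \<le> h j + 2" using h_ge[of j] by simp
    show "j \<le> h (\<iota> j) + 2" unfolding \<iota>_def by (rule LeastI[of "\<lambda>i. j \<le> h i + 2", OF ex])
    show "b (\<iota> j) \<le> j"
    proof (cases "\<iota> j")
      case (Suc i)
      then have "\<not> j \<le> h i + 2" using not_less_Least[of i "\<lambda>i. j \<le> h i + 2"] by (simp add: \<iota>_def)
      then show ?thesis using Suc bh(1)[of i] by simp
    qed (simp add: b0)
  qed
  have b_less: "b i < b (Suc i)" for i using bh(1)[of i] bh(3)[of i] by linarith
  have bmono: "b i \<le> b k" if "i \<le> k" for i k
    by (rule lift_Suc_mono_le[OF _ that]) (use b_less in \<open>simp add: less_imp_le\<close>)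
  have \<iota>_eq: "\<iota> j = i" if "b i \<le> j" "j \<le> h i + 2" for i j
  proof -
    have "\<iota> j \<le> i" unfolding \<iota>_def using that(2) by (rule Least_le)
    moreover have "\<not> \<iota> j < i"
    proof
      assume "\<iota> j < i"
      then have "b (Suc (\<iota> j)) \<le> b i" by (intro bmono) simp
      then show False using \<iota>(2)[of j] bh(1)[of "\<iota> j"] that(1) by simp
    qed
    ultimately show ?thesis by simp
  qed
  \<comment> \<open>The value 0 marks ordinary steps; at special steps T is at least 2.\<close>
  define T where "T j = (if j = h (\<iota> j) \<or> j = h (\<iota> j) + 2 then N (\<iota> j) else if j = h (\<iota> j) + 1 then M (\<iota> j) else 0)" for j
  have T_run: "T j = 0" if "b i \<le> j" "j < h i" for i j
    using \<iota>_eq[of i j] that by (simp add: T_def)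
  have b_le_h: "b i \<le> h i" for i using bh(3)[of i] by linarith
  have T_special: "T (h i) = N i" "T (h i + 1) = M i" "T (h i + 2) = N i" for i
    using \<iota>_eq[of i "h i"] \<iota>_eq[of i "h i + 1"] \<iota>_eq[of i "h i + 2"] b_le_h[of i] by (simp_all add: T_def)
  have T2: "2 \<le> T j" if "T j \<noteq> 0" for j using that NM2 by (auto simp: T_def split: if_splits)
  define p where "p j = (if T j = 0 then P else map_pmf (\<lambda>a. [a]) (pmf_of_set {T j..<2 * T j}))" for j
  have pU: "p j = map_pmf (\<lambda>a. [a]) (pmf_of_set {T j..<2 * T j})" if "T j \<noteq> 0" for j
    using that by (simp add: p_def)
  define len where "len j = (if T j = 0 then m else 1)" for j
  define t where "t j = (if T j = 0 then 1 else real (T j))" for j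
  define f where "f j = (if T j = 0 then x else (4 * real (T j)) powr (2 * s) / real (T j))" for j
  define \<rho> where "\<rho> j = (\<Prod>i<j. f i)" for j
  have f0: "0 \<le> f j" for j using x by (simp add: f_def)
  have \<rho>0: "0 \<le> \<rho> j" for j using f0 by (simp add: \<rho>_def prod_nonneg)
  have \<rho>_Suc: "\<rho> (Suc j) = \<rho> j * f j" for j by (simp add: \<rho>_def)
  have run: "\<rho> (b i + k) = \<rho> (b i) * x ^ k" if "b i + k \<le> h i" for i k
    using that
  proof (induction k)
    case (Suc k)
    then have "f (b i + k) = x" using T_run[of i "b i + k"] by (simp add: f_def)
    then show ?case using Suc by (simp add: \<rho>_Suc)
  qed simp
  \<comment> \<open>The run turns the bound D at its start into \<Phi>^(-c), the credit from which
    the triple is paid.\<close>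
  have special: "\<rho> (h i) \<le> \<Phi> i powr (-c)" if D: "\<rho> (b i) \<le> D" for i
  proof -
    define k where "k = h i - b i"
    have k: "h i = b i + k" "Q (b i) \<le> k" using bh(3)[of i] by (auto simp: k_def)
    have "\<rho> (h i) = \<rho> (b i) * x ^ k" using run[of i k] k by simp
    also have "\<dots> \<le> D * x ^ k" using D x by (intro mult_right_mono) auto
    also have "\<dots> = D * B powr (- (c * real m * real k)) / 2 ^ k"
      using B by (simp add: x_def power_divide powr_realpow[symmetric] powr_powr)
    also have "\<dots> \<le> D * B powr (- (c * real m * real k)) / (D * B powr (c * (real (m + 1) * real (b i) + real m + 2)))"
      using Q[OF k(2)] B by (intro divide_left_mono mult_pos_pos) (auto simp: D_def)
    also have "\<dots> = B powr (- (c * (real m * real k + real (m + 1) * real (b i) + real m + 2)))"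
    proof -
      have "- (c * real m * real k) - c * (real (m + 1) * real (b i) + real m + 2)
        = - (c * (real m * real k + real (m + 1) * real (b i) + real m + 2))"
        by (simp add: algebra_simps)
      then show ?thesis by (simp add: D_def powr_diff[symmetric])
    qed
    also have "\<dots> \<le> B powr (- (c * real (n i)))"
    proof -
      have "n i \<le> m * h i + b i + 2 + m"
      proof -
        have "m * (h i - 3 * i) \<le> m * h i" by simp
        then show ?thesis using n(3)[of i] bh(2)[of i] by linarith
      qed
      also have "m * h i + b i + 2 + m = m * k + (m + 1) * b i + m + 2" by (simp add: k(1) algebra_simps)
      finally have "real (n i) \<le> real (m * k + (m + 1) * b i + m + 2)" by (rule of_nat_mono)
      then have "real (n i) \<le> real m * real k + real (m + 1) * real (b i) + real m + 2"
        by (simp add: algebra_simps)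
      then have "c * real (n i) \<le> c * (real m * real k + real (m + 1) * real (b i) + real m + 2)"
        using c0 by (intro mult_left_mono) auto
      then show ?thesis using B by (intro powr_mono) auto
    qed
    also have "\<dots> = \<Phi> i powr (-c)" using B by (simp add: \<Phi>_def powr_powr mult.commute flip: powr_realpow)
    finally show ?thesis .
  qed
  have merge: "\<Phi> i powr a * \<Phi> i powr a' = \<Phi> i powr (a + a')" for i a a' by (simp add: powr_add)
  have Nb: "real (N i) powr s \<le> 2 * \<Phi> i powr ((1 - s) * s)"
      "(4 * real (N i)) powr (2 * s) / real (N i) \<le> 32 * \<Phi> i powr ((1 - s) * (2 * s - 1))" for i
    unfolding N_def using uniform_weight_bounds[OF s, of "\<Phi> i powr (1 - s)"] \<Phi>1[of "1 - s" i] s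
    by (simp_all add: powr_powr)
  have Mb: "real (M i) powr s \<le> 2 * \<Phi> i powr (s * s)"
      "(4 * real (M i)) powr (2 * s) / real (M i) \<le> 32 * \<Phi> i powr (s * (2 * s - 1))" for i
    unfolding M_def using uniform_weight_bounds[OF s, of "\<Phi> i powr s"] \<Phi>1[of s i] s
    by (simp_all add: powr_powr)
  have fN: "f (h i) \<le> 32 * \<Phi> i powr ((1 - s) * (2 * s - 1))"
    "f (h i + 1) \<le> 32 * \<Phi> i powr (s * (2 * s - 1))"
    "f (h i + 2) \<le> 32 * \<Phi> i powr ((1 - s) * (2 * s - 1))" for i
    using Nb(2)[of i] Mb(2)[of i] T_special[of i] NM2[of i] by (simp_all add: f_def)
  have le1: "\<Phi> i powr a \<le> 1" if "a \<le> 0" for i a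
    using \<Phi>[of i] powr_mono[OF that, of "\<Phi> i"] by simp
  have after: "\<rho> (h i + 1) \<le> 32 * \<Phi> i powr (- c + (1 - s) * (2 * s - 1))"
     "\<rho> (h i + 2) \<le> 1024 * \<Phi> i powr (- c + (1 - s) * (2 * s - 1) + s * (2 * s - 1))"
     "\<rho> (h i + 3) \<le> D" if D: "\<rho> (b i) \<le> D" for i
  proof -
    have "\<rho> (h i + 1) \<le> \<Phi> i powr (-c) * (32 * \<Phi> i powr ((1 - s) * (2 * s - 1)))"
      using special[OF D] fN(1)[of i] \<rho>0 f0 by (simp add: \<rho>_Suc mult_mono)
    then show 1: "\<rho> (h i + 1) \<le> 32 * \<Phi> i powr (- c + (1 - s) * (2 * s - 1))"
      unfolding powr_add by (simp only: mult_ac)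
    have "\<rho> (h i + 2) = \<rho> (h i + 1) * f (h i + 1)" using \<rho>_Suc[of "h i + 1"] by simp
    also have "\<dots> \<le> (32 * \<Phi> i powr (- c + (1 - s) * (2 * s - 1))) * (32 * \<Phi> i powr (s * (2 * s - 1)))"
      using 1 fN(2)[of i] \<rho>0 f0 by (intro mult_mono) auto
    also have "\<dots> = 1024 * (\<Phi> i powr (- c + (1 - s) * (2 * s - 1)) * \<Phi> i powr (s * (2 * s - 1)))" by simp
    finally show 2: "\<rho> (h i + 2) \<le> 1024 * \<Phi> i powr (- c + (1 - s) * (2 * s - 1) + s * (2 * s - 1))"
      by (simp only: merge)
    have "\<rho> (h i + 3) = \<rho> (h i + 2) * f (h i + 2)" using \<rho>_Suc[of "h i + 2"] by (simp add: eval_nat_numeral)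
    also have "\<dots> \<le> (1024 * \<Phi> i powr (- c + (1 - s) * (2 * s - 1) + s * (2 * s - 1))) * (32 * \<Phi> i powr ((1 - s) * (2 * s - 1)))"
      using 2 fN(3)[of i] \<rho>0 f0 by (intro mult_mono) auto
    also have "\<dots> = D * (\<Phi> i powr (- c + (1 - s) * (2 * s - 1) + s * (2 * s - 1)) * \<Phi> i powr ((1 - s) * (2 * s - 1)))"
      by (simp add: D_def)
    also have "\<dots> = D * \<Phi> i powr (- c + (1 - s) * (2 * s - 1) + s * (2 * s - 1) + (1 - s) * (2 * s - 1))"
      by (simp only: merge)
    \<comment> \<open>Nonpositive, so the triple hands the bound D on to the next run and constants
      do not pile up over the runs.\<close>
    also have "- c + (1 - s) * (2 * s - 1) + s * (2 * s - 1) + (1 - s) * (2 * s - 1) = - ((1 - s)\<^sup>2)"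
      by (simp add: c_def power2_eq_square algebra_simps)
    also have "D * \<Phi> i powr (- ((1 - s)\<^sup>2)) \<le> D * 1" using le1[of "- ((1 - s)\<^sup>2)" i] by (intro mult_left_mono) (auto simp: D_def)
    finally show "\<rho> (h i + 3) \<le> D" by simp
  qed
  have \<rho>b: "\<rho> (b i) \<le> D" for i
  proof (induction i)
    case 0
    show ?case by (simp add: b0 \<rho>_def D_def)
  next
    case (Suc i)
    then show ?case using after(3)[of i] by (simp add: bh(1))
  qed
  \<comment> \<open>At the second and third special digit the exponent of \<Phi> is exactly 0, so
    the digit sizes are critical; at the first it is 1 - 2 s < 0.\<close>
  have budget: "\<rho> j * t j powr s \<le> D" for j
  proof -
    define i where "i = \<iota> j"
    have j: "b i \<le> j" "j \<le> h i + 2" using \<iota> by (auto simp: i_def)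
    consider "j < h i" | "j = h i" | "j = h i + 1" | "j = h i + 2" using j by linarith
    then show ?thesis
    proof cases
      case 1
      then have "\<rho> j = \<rho> (b i) * x ^ (j - b i)" using run[of i "j - b i"] j by simp
      also have "\<dots> \<le> D * 1" using \<rho>b[of i] x by (intro mult_mono power_le_one) (auto simp: D_def)
      finally show ?thesis using T_run[of i j] j 1 by (simp add: t_def)
    next
      case 2
      have "\<rho> j * t j powr s \<le> \<Phi> i powr (-c) * (2 * \<Phi> i powr ((1 - s) * s))"
        using special[OF \<rho>b] Nb(1)[of i] T_special[of i] NM2[of i] 2 \<rho>0 by (intro mult_mono) (auto simp: t_def)
      also have "\<dots> = 2 * (\<Phi> i powr (-c) * \<Phi> i powr ((1 - s) * s))" by simp
      also have "\<dots> = 2 * \<Phi> i powr (- c + (1 - s) * s)" by (simp only: merge)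
      also have "\<dots> \<le> 2 * 1" using s by (intro mult_left_mono le1) (auto simp: c_def power2_eq_square algebra_simps)
      finally show ?thesis by (simp add: D_def)
    next
      case 3
      have "\<rho> j * t j powr s \<le> (32 * \<Phi> i powr (- c + (1 - s) * (2 * s - 1))) * (2 * \<Phi> i powr (s * s))"
        using after(1)[OF \<rho>b] Mb(1)[of i] T_special[of i] NM2[of i] 3 \<rho>0 by (intro mult_mono) (auto simp: t_def)
      also have "\<dots> = 64 * (\<Phi> i powr (- c + (1 - s) * (2 * s - 1)) * \<Phi> i powr (s * s))" by simp
      also have "\<dots> = 64 * \<Phi> i powr (- c + (1 - s) * (2 * s - 1) + s * s)" by (simp only: merge)
      also have "\<dots> \<le> 64 * 1" by (intro mult_left_mono le1) (auto simp: c_def power2_eq_square algebra_simps)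
      finally show ?thesis by (simp add: D_def)
    next
      case 4
      have "\<rho> j * t j powr s \<le> (1024 * \<Phi> i powr (- c + (1 - s) * (2 * s - 1) + s * (2 * s - 1))) * (2 * \<Phi> i powr ((1 - s) * s))"
        using after(2)[OF \<rho>b] Nb(1)[of i] T_special[of i] NM2[of i] 4 \<rho>0 by (intro mult_mono) (auto simp: t_def)
      also have "\<dots> = 2048 * (\<Phi> i powr (- c + (1 - s) * (2 * s - 1) + s * (2 * s - 1)) * \<Phi> i powr ((1 - s) * s))" by simp
      also have "\<dots> = 2048 * \<Phi> i powr (- c + (1 - s) * (2 * s - 1) + s * (2 * s - 1) + (1 - s) * s)" by (simp only: merge)
      also have "\<dots> \<le> 2048 * 1" by (intro mult_left_mono le1) (auto simp: c_def power2_eq_square algebra_simps)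
      finally show ?thesis by (simp add: D_def)
    qed
  qed
  obtain K where K: "\<And>w a. w \<in> W \<Longrightarrow> a \<in> set w \<Longrightarrow> real a \<le> K" "0 \<le> K"
  proof
    have fin: "finite (\<Union>w\<in>W. set w)" using W(2) by auto
    show "real a \<le> real (\<Sum>(\<Union>w\<in>W. set w))" if "w \<in> W" "a \<in> set w" for w a
    proof (rule of_nat_mono)
      show "a \<le> \<Sum>(\<Union>w\<in>W. set w)" using that fin by (intro member_le_sum) auto
    qed
  qed (simp add: sum_nonneg)
  \<comment> \<open>The sum over the finite set W dominates each reciprocal probability, so the
    words of W are comparable.\<close>
  define \<Lambda> where "\<Lambda> = (\<Sum>w\<in>W. 1 / pmf P w)"
  have Wm: "pos_word w" "length w = m" if "w \<in> W" for w using that W by (auto simp: words_def)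
  interpret random_cf p len t f s "K + 2" \<Lambda> D
  proof
    show "0 \<le> \<Lambda>" by (simp add: \<Lambda>_def sum_nonneg)
    show "1 \<le> t j" for j using T2[of j] by (auto simp: t_def)
    show "pos_word w \<and> length w = len j \<and> w \<noteq> []" if "w \<in> set_pmf (p j)" for j w
    proof (cases "T j = 0")
      case True
      then have "w \<in> W" using that by (simp add: p_def P)
      then show ?thesis using Wm[of w] True m by (auto simp: len_def)
    next
      case False
      then have "\<exists>a\<ge>T j. w = [a]"
        using uniform_digit_word[OF _ that[unfolded pU[OF False]]] by simp
      then obtain a where "T j \<le> a" "w = [a]" by blast
      then show ?thesis using False by (simp add: len_def)
    qed
    show "1 / ((K + 2) * t j) \<le> cf_branch w y \<and> cf_branch w y \<le> 1 - 1 / (K + 2)"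
      if "w \<in> set_pmf (p j)" "0 \<le> y" "y \<le> 1" for j w y
    proof (cases "T j = 0")
      case True
      then have "w \<in> W" using that by (simp add: p_def P)
      then show ?thesis using cf_branch_location[of w K y] Wm[of w] K(1) m that True by (auto simp: t_def)
    next
      case False
      then show ?thesis
        using uniform_digit_location[OF T2[OF False] that(1)[unfolded pU[OF False]] that(2,3), of "K + 2"] K(2)
        by (simp add: t_def)
    qed
    show "(\<forall>w\<in>set_pmf (p j). 1 \<le> \<Lambda> * pmf (p j) w) \<or>
       (\<exists>T\<ge>1. t j = real T \<and> p j = map_pmf (\<lambda>a. [a]) (pmf_of_set {T..<2 * T}))" for j
    proof (cases "T j = 0")
      case True
      have "1 \<le> \<Lambda> * pmf P w" if "w \<in> W" for w
      proof -
        have pos: "0 < pmf P w" using that P(1) by (auto simp: pmf_positive_iff)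
        have "1 / pmf P w \<le> \<Lambda>" unfolding \<Lambda>_def using that W(2) by (intro member_le_sum) auto
        then show ?thesis using pos by (simp add: pos_divide_le_eq)
      qed
      then show ?thesis using True by (simp add: p_def P)
    next
      case False
      then show ?thesis by (intro disjI2 exI[of _ "T j"]) (auto simp: t_def p_def)
    qed
    show "pmf (p j) w * (2 * cf_den w 0) powr (2 * s) \<le> f j" if "w \<in> set_pmf (p j)" for j w
    proof (cases "T j = 0")
      case True
      then show ?thesis using that ordinary_weight[of w] by (simp add: p_def f_def P)
    next
      case False
      then show ?thesis
        using uniform_digit_weight[OF _ that[unfolded pU[OF False]], of s] s by (simp add: pU f_def)
    qed
    show "(\<Prod>i<j. f i) * t j powr s \<le> D" for j using budget[of j] by (simp add: \<rho>_def)
  qed (use s K in \<open>auto simp: D_def\<close>)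
  have len_run: "(\<Sum>j<b i + k. len j) = (\<Sum>j<b i. len j) + m * k" if "b i + k \<le> h i" for i k
    using that
  proof (induction k)
    case (Suc k)
    then have "len (b i + k) = m" using T_run[of i "b i + k"] by (simp add: len_def)
    then show ?case using Suc by simp
  qed simp
  have len_special: "len (h i) = 1" "len (h i + 1) = 1" "len (h i + 2) = 1" for i
    using T_special[of i] NM2[of i] by (auto simp: len_def)
  have len_b: "(\<Sum>j<b i. len j) = m * (b i - 3 * i) + 3 * i" for i
  proof (induction i)
    case 0
    show ?case by (simp add: b0)
  next
    case (Suc i)
    have "(\<Sum>j<h i. len j) = (\<Sum>j<b i. len j) + m * (h i - b i)" using len_run[of i "h i - b i"] b_le_h[of i] by simp
    also have "\<dots> = m * (h i - 3 * i) + 3 * i"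
    proof -
      have "(b i - 3 * i) + (h i - b i) = h i - 3 * i" using bh(2)[of i] b_le_h[of i] by simp
      then show ?thesis unfolding Suc by (simp flip: add_mult_distrib2)
    qed
    finally have "(\<Sum>j<h i. len j) = m * (h i - 3 * i) + 3 * i" .
    moreover have "(\<Sum>j<h i + 3. len j) = (\<Sum>j<h i. len j) + 3"
      using len_special[of i] by (simp add: eval_nat_numeral)
    moreover have "h i + 3 - 3 * Suc i = h i - 3 * i" by simp
    ultimately show ?case by (simp add: bh(1))
  qed
  have len_h: "(\<Sum>j<h i. len j) = m * (h i - 3 * i) + 3 * i" for i
  proof -
    have "(\<Sum>j<h i. len j) = (\<Sum>j<b i. len j) + m * (h i - b i)" using len_run[of i "h i - b i"] b_le_h[of i] by simp
    moreover have "(b i - 3 * i) + (h i - b i) = h i - 3 * i" using bh(2)[of i] b_le_h[of i] by simp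
    ultimately show ?thesis unfolding len_b by (simp flip: add_mult_distrib2)
  qed
  show ?thesis
  proof (rule hausdorff_dim_ge)
    fix \<omega> assume w: "\<omega> \<in> support"
    note g = good_seq_support[OF w]
    define y where "y = cf_limit \<omega>"
    have irr: "y \<in> irrationals01" unfolding y_def by (rule cf_limit_irrational[OF g])
    have "\<exists>k\<in>{1..n i}. \<exists>l\<in>{1..n i}. k \<noteq> l \<and>
       real (partial_quotient k y * partial_quotient (k + 1) y) \<ge> \<phi> (n i) \<and>
       real (partial_quotient l y * partial_quotient (l + 1) y) \<ge> \<phi> (n i)" for i
    proof -
      define k where "k = (\<Sum>j<h i. len j)"
      have k: "length (prefix_word \<omega> (h i)) = k" unfolding k_def by (rule length_prefix_word[OF w])
      \<comment> \<open>The two pairs start at k + 1 and k + 2, both within the first n i positions;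
        the third special digit may stand at position n i + 1.\<close>
      have kn: "k + 2 \<le> n i" using n(2)[of i] by (simp add: k_def len_h)
      have mem: "\<omega> j \<in> set_pmf (p j)" for j using w by (simp add: support_def)
      have dig: "\<exists>a\<ge>T j. \<omega> j = [a]" if "T j \<noteq> 0" for j
        using uniform_digit_word[OF _ mem[of j, unfolded pU[OF that]]] that by simp
      obtain a1 a2 a3 where a: "N i \<le> a1" "M i \<le> a2" "N i \<le> a3" "\<omega> (h i) = [a1]" "\<omega> (h i + 1) = [a2]" "\<omega> (h i + 2) = [a3]"
        using dig[of "h i"] dig[of "h i + 1"] dig[of "h i + 2"] T_special[of i] NM2[of i] by auto
      have pw: "prefix_word \<omega> (h i + 3) = prefix_word \<omega> (h i) @ [a1, a2, a3]"
      proof -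
        have "h i + 3 = Suc (Suc (Suc (h i)))" by simp
        then show ?thesis using a(4-6) by (simp only: prefix_word_Suc) simp
      qed
      have "partial_quotient (Suc (k + r)) y = [a1, a2, a3] ! r" if "r < 3" for r
        unfolding y_def using partial_quotient_cf_limit[OF g, of "k + r" "h i + 3", unfolded pw] k that
        by (simp add: nth_append)
      from this[of 0] this[of 1] this[of 2]
      have pq: "partial_quotient (k + 1) y = a1" "partial_quotient (k + 2) y = a2" "partial_quotient (k + 3) y = a3"
        by (simp_all add: eval_nat_numeral)
      have "\<phi> (n i) \<le> \<Phi> i" using n(1)[of i] by (simp add: S_def \<Phi>_def)
      also have "\<Phi> i = \<Phi> i powr (1 - s) * \<Phi> i powr s" using \<Phi>[of i] by (simp add: merge)
      also have "\<dots> \<le> real (N i) * real (M i)"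
        using NM_ge[of i] by (intro mult_mono) auto
      also have "\<dots> = real (N i * M i)" by simp
      finally have NM: "\<phi> (n i) \<le> real (N i * M i)" .
      have "N i * M i \<le> a1 * a2" "N i * M i \<le> a2 * a3" using a mult_le_mono[of "N i" a1 "M i" a2] mult_le_mono[of "M i" a2 "N i" a3]
        by (simp_all add: mult.commute)
      then have "\<phi> (n i) \<le> real (a1 * a2)" "\<phi> (n i) \<le> real (a2 * a3)"
        using NM order_trans of_nat_mono by blast+
      then have "\<phi> (n i) \<le> real (partial_quotient (k + 1) y * partial_quotient (k + 1 + 1) y)"
        "\<phi> (n i) \<le> real (partial_quotient (k + 2) y * partial_quotient (k + 2 + 1) y)"
        using pq by (simp_all add: eval_nat_numeral)
      then show ?thesis using kn by (intro bexI[of _ "k + 1"] bexI[of _ "k + 2"]) auto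
    qed
    moreover have "i \<le> n i" for i using n(2)[of i] by linarith
    ultimately have "\<exists>\<^sub>\<infinity>n. \<exists>k\<in>{1..n}. \<exists>l\<in>{1..n}. k \<noteq> l \<and>
       real (partial_quotient k y * partial_quotient (k + 1) y) \<ge> \<phi> n \<and>
       real (partial_quotient l y * partial_quotient (l + 1) y) \<ge> \<phi> n"
      unfolding INFM_nat_le by blast
    then show "cf_limit \<omega> \<in> F2_set \<phi>" using irr by (simp add: F2_set_def y_def)
  qed
qed

lemma growth_B_frequently:
  assumes "growth_B \<phi> < ereal r" "0 < r" "\<And>n. 1 \<le> n \<Longrightarrow> 0 < \<phi> n"
  shows "\<exists>\<^sub>\<infinity>n. \<phi> n \<le> r ^ n"
proof -
  have "liminf (\<lambda>n. ereal (ln (\<phi> n) / real n)) < ereal (ln r)"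
    using assms(1,2) by (simp add: growth_B_def exp_ereal_less_iff)
  then have "\<exists>\<^sub>\<infinity>n. ln (\<phi> n) / real n < ln r" by (rule frequently_less_if_liminf_less)
  then have "\<exists>\<^sub>\<infinity>n. ln (\<phi> n) / real n < ln r \<and> 1 \<le> n"
    by (intro INFM_conjI) (auto simp: MOST_nat_le)
  then show ?thesis
  proof (rule INFM_mono)
    fix n assume n: "ln (\<phi> n) / real n < ln r \<and> 1 \<le> n"
    then have "0 < real n" by simp
    then have "ln (\<phi> n) < real n * ln r" using n by (metis mult.commute pos_divide_less_eq)
    then have "exp (ln (\<phi> n)) < exp (real n * ln r)" by simp
    then show "\<phi> n \<le> r ^ n" using assms(2) assms(3)[of n] n by (simp add: exp_of_nat_mult)
  qed
qed

text \<open>Exponential thresholds stay below exp (c^n) eventually for every c > 1, so the doubly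
  exponential construction gives 1 / (1 + c), and c tends to 1. This serves the exponents up to
  1/2.\<close>

lemma dim_F2_ge_half:
  assumes "1 < B" "\<exists>\<^sub>\<infinity>n. \<phi> n \<le> B ^ n"
  shows "ereal (1/2) \<le> hausdorff_dim (F2_set \<phi>)"
proof (rule dense_le)
  fix x assume x: "x < ereal (1/2)"
  show "x \<le> hausdorff_dim (F2_set \<phi>)"
  proof (cases x)
    case (real r)
    show ?thesis
    proof (cases "0 < r")
      case True
      have r: "r < 1/2" using x real by simp
      define c where "c = (1 + (1 / r - 1)) / 2"
      have "1 < 1 / r - 1" using r True by (simp add: field_simps)
      then have c: "1 < c" "c < 1 / r - 1" by (auto simp: c_def)
      have rc: "r < 1 / (1 + c)" using c True by (simp add: field_simps)
      have "\<forall>\<^sub>F n in sequentially. real n * ln B \<le> c ^ n" using c by real_asymp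
      then have "\<exists>\<^sub>\<infinity>n. \<phi> n \<le> B ^ n \<and> real n * ln B \<le> c ^ n"
        using assms(2) by (intro INFM_conjI) (simp_all add: cofinite_eq_sequentially)
      then have "\<exists>\<^sub>\<infinity>n. \<phi> n \<le> exp (c ^ n)"
      proof (rule INFM_mono)
        fix n assume n: "\<phi> n \<le> B ^ n \<and> real n * ln B \<le> c ^ n"
        then have "\<phi> n \<le> exp (real n * ln B)" using assms(1) by (simp add: exp_of_nat_mult)
        also have "\<dots> \<le> exp (c ^ n)" using n by simp
        finally show "\<phi> n \<le> exp (c ^ n)" .
      qed
      then show ?thesis using c rc True real by (auto intro!: dim_F2_ge_doubly_exponential[of c])
    next
      case False
      then have "x \<le> 0" using real by simp
      then show ?thesis using hausdorff_dim_nonneg order_trans by blast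
    qed
  qed (use x in auto)
qed

text \<open>As the liminf is 0, every base B > 1 is allowed, so m can be fixed before B: the growth
  of word sums below exponent 1 supplies weight 4 * 4^s for words of length m, and B is then taken
  so close to 1 that B^(c m) = 2.\<close>

lemma dim_F2_growth_1:
  assumes "growth_B \<phi> = 1" "\<And>n. 1 \<le> n \<Longrightarrow> 0 < \<phi> n"
  shows "hausdorff_dim (F2_set \<phi>) = 1"
proof (rule antisym)
  show "hausdorff_dim (F2_set \<phi>) \<le> 1"
    by (rule hausdorff_dim_le_1) (auto simp: F2_set_def irrationals01_iff)
  have le: "ereal s \<le> hausdorff_dim (F2_set \<phi>)" if s: "1/2 < s" "s < 1" for s
  proof -
    define c where "c = 3 * s - 1 - s\<^sup>2"
    have c0: "0 < c" unfolding c_def using s by (rule cost_exponent_pos)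
    have "filterlim (\<lambda>k. 2 powr (2 * (1 - s) * real k)) at_top sequentially" using s by real_asymp
    then have "\<forall>\<^sub>F k in sequentially. 4 * 4 powr s < 2 powr (2 * (1 - s) * real k)"
      by (simp add: filterlim_at_top_dense)
    then have "\<forall>\<^sub>F k in sequentially. 4 * 4 powr s < 2 powr (2 * (1 - s) * real k) \<and> 1 \<le> k"
      using eventually_ge_at_top[of 1] by eventually_elim auto
    then obtain k where k: "4 * 4 powr s < 2 powr (2 * (1 - s) * real k)" "1 \<le> k"
      by (auto simp: eventually_sequentially)
    define m where "m = 2 * k"
    have m: "2 \<le> m" "m div 2 = k" using k by (auto simp: m_def)
    have "ennreal (4 * 4 powr s) < ennreal (2 powr (2 * (1 - s) * real k))"
      using k by (intro ennreal_lessI) auto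
    also have "\<dots> \<le> word_sum s m" using word_sum_growth[of s m] s m by simp
    finally obtain W where W: "W \<subseteq> words m" "finite W" "4 * 4 powr s < (\<Sum>w\<in>W. cf_den w 0 powr (-2 * s))"
      using finite_subset_word_sum[of "4 * 4 powr s" s m] by auto
    define B where "B = 2 powr (1 / (c * real m))"
    have B: "1 < B" "B powr (c * real m) = 2"
      using c0 m by (auto simp: B_def powr_powr gr_one_powr)
    show ?thesis
    proof (rule dim_F2_ge_exponential[OF s B(1) _ m(1) W(1,2)])
      show "\<exists>\<^sub>\<infinity>n. \<phi> n \<le> B ^ n" using assms B by (intro growth_B_frequently) (auto simp: one_ereal_def)
      show "2 * 4 powr s * B powr ((3 * s - 1 - s\<^sup>2) * real m) \<le> (\<Sum>w\<in>W. cf_den w 0 powr (-2 * s))"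
        unfolding c_def[symmetric] B(2) using W(3) by simp
    qed
  qed
  show "1 \<le> hausdorff_dim (F2_set \<phi>)"
  proof (rule dense_le)
    fix x :: ereal assume x: "x < 1"
    show "x \<le> hausdorff_dim (F2_set \<phi>)"
    proof (cases x)
      case (real r)
      define s where "s = max r (3/4)"
      have "1/2 < s" "s < 1" using x real by (auto simp: s_def one_ereal_def)
      from le[OF this] have "ereal s \<le> hausdorff_dim (F2_set \<phi>)" .
      moreover have "x \<le> ereal s" using real by (simp add: s_def)
      ultimately show ?thesis by (rule order_trans[rotated])
    qed (use x in auto)
  qed
qed

text \<open>Below \<open>s_B B\<close> and above 1/2 the pressure strictly exceeds the cost. The
  slack permits a base b > B, for which \<phi> n \<le> b^n infinitely often, and still leaves
  exponential growth in m.\<close>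

lemma s_B_le_dim_F2:
  assumes B: "growth_B \<phi> = ereal B" "1 < B" and pos: "\<And>n. 1 \<le> n \<Longrightarrow> 0 < \<phi> n"
  shows "s_B B \<le> hausdorff_dim (F2_set \<phi>)"
proof -
  have half: "ereal (1/2) \<le> hausdorff_dim (F2_set \<phi>)"
  proof (rule dim_F2_ge_half[of "B + 1"])
    show "\<exists>\<^sub>\<infinity>n. \<phi> n \<le> (B + 1) ^ n" using B pos by (intro growth_B_frequently) auto
  qed (use B in simp)
  have le: "ereal s \<le> hausdorff_dim (F2_set \<phi>)"
    if s: "1/2 < s" "s < 1" and P: "(3 * s - 1 - s\<^sup>2) * ln B < cf_pressure s" for s
  proof -
    define c where "c = 3 * s - 1 - s\<^sup>2"
    have "((\<lambda>b. c * ln b) \<longlongrightarrow> c * ln B) (at_right B)" using B by (intro tendsto_intros) auto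
    then have "\<forall>\<^sub>F b in at_right B. c * ln b < cf_pressure s"
      using P by (intro order_tendstoD) (auto simp: c_def)
    moreover have "\<forall>\<^sub>F b in at_right B. b \<in> {B<..<B + 1}" by (rule eventually_at_right_real) simp
    ultimately have "\<forall>\<^sub>F b in at_right B. c * ln b < cf_pressure s \<and> b \<in> {B<..<B + 1}"
      by eventually_elim auto
    then obtain b where b: "c * ln b < cf_pressure s" "B < b"
      using eventually_happens[of _ "at_right B"] by (auto simp: trivial_limit_at_right_real)
    \<comment> \<open>The surplus per digit; for large m, exp (m d) absorbs 2 * 4^s from the
      construction and the 4^s lost in \<open>word_sum_pressure_bounds\<close>.\<close>
    define d where "d = cf_pressure s - c * ln b"
    have d: "0 < d" using b by (simp add: d_def)
    have "filterlim (\<lambda>m. exp (real m * d)) at_top sequentially" using d by real_asymp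
    then have "\<forall>\<^sub>F m in sequentially. 2 * 4 powr s * 4 powr s < exp (real m * d)"
      by (simp add: filterlim_at_top_dense)
    then have "\<forall>\<^sub>F m in sequentially. 2 * 4 powr s * 4 powr s < exp (real m * d) \<and> 2 \<le> m"
      using eventually_ge_at_top[of 2] by eventually_elim auto
    then obtain m where m: "2 * 4 powr s * 4 powr s < exp (real m * d)" "2 \<le> m"
      by (auto simp: eventually_sequentially)
    define Z where "Z = 2 * 4 powr s * b powr (c * real m)"
    have Z: "Z < 4 powr (-s) * exp (real m * cf_pressure s)"
    proof -
      have "exp (real m * cf_pressure s) = exp (real m * d) * b powr (c * real m)"
        using b B by (simp add: d_def powr_def exp_add[symmetric] algebra_simps)
      moreover have "2 * 4 powr s < 4 powr (-s) * exp (real m * d)"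
        using m by (simp add: powr_minus field_simps)
      then have "2 * 4 powr s * b powr (c * real m) < 4 powr (-s) * exp (real m * d) * b powr (c * real m)"
        using b B by (intro mult_strict_right_mono) auto
      ultimately show ?thesis by (simp add: Z_def mult.assoc)
    qed
    have Z0: "0 \<le> Z" by (simp add: Z_def)
    have "ennreal Z < ennreal (4 powr (-s) * exp (real m * cf_pressure s))"
      using Z Z0 by (intro ennreal_lessI) auto
    also have "\<dots> \<le> word_sum s m" using s by (intro word_sum_pressure_bounds) auto
    finally obtain W where W: "W \<subseteq> words m" "finite W" "Z < (\<Sum>w\<in>W. cf_den w 0 powr (-2 * s))"
      using finite_subset_word_sum[of Z s m] Z0 by auto
    show ?thesis
    proof (rule dim_F2_ge_exponential[OF s _ _ m(2) W(1,2)])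
      show "1 < b" using b B by simp
      show "\<exists>\<^sub>\<infinity>n. \<phi> n \<le> b ^ n" using B b pos by (intro growth_B_frequently) auto
      show "2 * 4 powr s * b powr ((3 * s - 1 - s\<^sup>2) * real m) \<le> (\<Sum>w\<in>W. cf_den w 0 powr (-2 * s))"
        using W(3) by (simp add: Z_def c_def)
    qed
  qed
  \<comment> \<open>At s = 1 the exponent 3 s - 1 - s^2 equals 1 and the pressure is at most 0, so s
    = 1 is admissible.\<close>
  have s1: "s_B B \<le> 1"
    unfolding s_B_eq
  proof (rule Inf_lower, intro CollectI exI conjI)
    show "cf_pressure 1 \<le> (3 * 1 - 1 - 1\<^sup>2) * ln B" using cf_pressure_1 B by (simp add: order_trans[of _ 0])
  qed (auto simp: one_ereal_def)
  show ?thesis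
  proof (rule dense_le)
    fix x assume x: "x < s_B B"
    then have x1: "x < 1" using s1 by (rule less_le_trans)
    show "x \<le> hausdorff_dim (F2_set \<phi>)"
    proof (cases "x \<le> ereal (1/2)")
      case True
      then show ?thesis using half by (rule order_trans)
    next
      case False
      then obtain s where s: "x = ereal s" "1/2 < s" "s < 1" using x1 by (cases x) auto
      have "\<not> cf_pressure s \<le> (3 * s - 1 - s\<^sup>2) * ln B"
      proof
        assume "cf_pressure s \<le> (3 * s - 1 - s\<^sup>2) * ln B"
        then have "s_B B \<le> ereal s" unfolding s_B_eq using s by (intro Inf_lower) auto
        then show False using x s by simp
      qed
      then show ?thesis using le[of s] s by simp
    qed
  qed
qed

theorem theorem1p5:
  fixes \<phi> :: "nat \<Rightarrow> real"
  assumes "\<And>n. 1 \<le> n \<Longrightarrow> 0 < \<phi> n"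
  shows "(growth_B \<phi> = 1 \<longrightarrow> hausdorff_dim (F2_set \<phi>) = 1) \<and>
    (growth_B \<phi> = \<infinity> \<longrightarrow> hausdorff_dim (F2_set \<phi>) = 1 / (1 + growth_b \<phi>)) \<and>
    (1 < growth_B \<phi> \<and> growth_B \<phi> < \<infinity> \<longrightarrow>
       hausdorff_dim (F2_set \<phi>) = s_B (real_of_ereal (growth_B \<phi>)))"
proof (intro conjI impI)
  show "hausdorff_dim (F2_set \<phi>) = 1" if "growth_B \<phi> = 1"
    using that assms by (rule dim_F2_growth_1)
  show "hausdorff_dim (F2_set \<phi>) = 1 / (1 + growth_b \<phi>)" if "growth_B \<phi> = \<infinity>"
    using dim_F2_infinite_le[OF that assms] dim_F2_infinite_ge[OF that assms] by (rule antisym)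
  assume *: "1 < growth_B \<phi> \<and> growth_B \<phi> < \<infinity>"
  then obtain B where B: "growth_B \<phi> = ereal B" by (cases "growth_B \<phi>") auto
  then have "1 < B" using * by (simp add: one_ereal_def)
  then show "hausdorff_dim (F2_set \<phi>) = s_B (real_of_ereal (growth_B \<phi>))"
    using antisym[OF dim_F2_le_s_B[OF B _ assms] s_B_le_dim_F2[OF B _ assms]] B by simp
qed

end
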